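(* For every $m\in\mathbb Z$, the following equalities of maps from $F_m$ to formal series in $z^{\pm1},w^{\pm1}$ with coefficients in $F_m$ hold: $$\delta_m(z,w)=\sum_{i,j\in\mathbb Z}\delta_m(\mathcal B_{ij})z^iw^{-j}=\frac{z^m}{w^m}\,\sigma_+(z)\overline\sigma_-(z)\overline\sigma_+(w)\sigma_-(w)$$ $$=\frac{z^m}{w^m}\,i_{z,w}\frac{z}{z-w}\,\sigma_+(z)\overline\sigma_+(w)\overline\sigma_-(z)\sigma_-(w)=\frac{z^m}{w^m}\,i_{z,w}\frac{z}{z-w}\,\frac{E(w)}{E(z)}\,\overline\sigma_-(z)\sigma_-(w).$$
   Context: Exterior algebra and Schubert derivations. $M=\bigoplus_{i\in\mathbb Z}\mathbb Z b_i$ is a free abelian group with basis $(b_i)_{i\in\mathbb Z}$, $\bigwedge M$ its exterior algebra over $\mathbb Z$, and $M^*=\bigoplus_j\mathbb Z\beta_j$ with $\beta_j(b_i)=\delta_{ij}$. A Hasse–Schmidt (HS) derivation on $\bigwedge M$ is a $\mathbb Z$-linear map $\mathcal D(z):\bigwedge M\to\bigwedge M[[z]]$ (or $\bigwedge M[[z^{-1}]]$) with $\mathcal D(z)(u\wedge v)=\mathcal D(z)u\wedge\mathcal D(z)v$. The Schubert derivations $\sigma_\pm(z)=\sum_{i\ge0}\sigma_{\pm i}z^{\pm i}$ are the unique HS derivations with $\sigma_\pm(z)b_j=\sum_{i\ge0}b_{j\pm i}z^{\pm i}$; their formal inverses $\overline\sigma_\pm(z)=\sum_{i\ge0}(-1)^i\overline\sigma_{\pm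 i}z^{\pm i}$ are the unique HS derivations with $\overline\sigma_\pm(z)b_j=b_j-b_{j\pm1}z^{\pm1}$. Fermionic Fock space. $\mathcal P$ is the set of partitions, $\mathcal P_r$ those of length $\ell(\lambda)\le r$. For $\lambda\in\mathcal P_r$, $\mathbf b^r_{m+\lambda}:=b_{m+\lambda_1}\wedge b_{m-1+\lambda_2}\wedge\cdots\wedge b_{m-r+1+\lambda_r}$. Let $[M]$ be the free $\mathbb Z$-module with basis $([\mathbf b]_m)_{m\in\mathbb Z}$, and $F:=(\bigwedge M\otimes_{\mathbb Z}[M])/W$ where $W$ is the $\bigwedge M$-submodule generated by all $b_m\otimes[\mathbf b]_{m-1}-1\otimes[\mathbf b]_m$ and $b_m\otimes[\mathbf b]_m$, $m\in\mathbb Z$. The class of $u\otimes[\mathbf b]_m$ is written $u\wedge[\mathbf b]_m$. Put $[\mathbf b]_{m+\lambda}:=\mathbf b^r_{m+\lambda}\wedge[\mathbf b]_{m-r}$ for any $r\ge\ell(\lambda)$ (independent of $r$). Then $F=\bigoplus_m F_m$, $F_m=\bigoplus_{\lambda\in\mathcal P}\mathbb Z[\mathbf b]_{m+\lambda}$. Extension to $F_m$. Put $\sigma_+(z)[\mathbf b]_m=(\sigma_+(z)b_m)\wedge[\mathbf b]_{m-1}$, $\overline\sigma_+(z)[\mathbf b]_m=\sum_{j\ge0}(-1)^j[\mathbf b]_{m+(1^j)}z^j$, $\sigma_-(z)[\mathbf b]_m=\overline\sigma_-(z)[\mathbf b]_m=[\mathbf b]_m$, and for each $\tau(z)\in\{\sigma_\pm(z),\overline\sigma_\pm(z)\}$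 put $\tau(z)[\mathbf b]_{m+\lambda}=\tau(z)\mathbf b^r_{m+\lambda}\wedge\tau(z)[\mathbf b]_{m-r}$ ($r\ge\ell(\lambda)$), extended $\mathbb Z$-linearly to maps $F_m\to F_m[[z^{\pm1}]]$. Compositions are right to left, applied coefficientwise to formal series. $B$-module structure. $B=\mathbb Z[e_1,e_2,\ldots]$, $E(z)=1+\sum_{j\ge1}(-1)^je_jz^j$, and $\sum_{j}h_jz^j=1/E(z)$ ($h_j=0$ for $j<0$). $F_m$ is a $B$-module via $h_iu=\sigma_i u$ ($i\ge 0$), so $\sigma_+(z)$ is multiplication by $1/E(z)$ and $\overline\sigma_+(z)$ is multiplication by $E(z)$. Lie algebra action. $\mathcal B_{ij}=b_i\otimes\beta_j\in \mathrm{End}_{\mathbb Z}(M)$, i.e. $\mathcal B_{ij}(b_k)=\delta_{jk}b_i$, and $gl_\infty(\mathbb Z)=\bigoplus_{i,j\in\mathbb Z}\mathbb Z\mathcal B_{ij}$. For $A\in gl_\infty(\mathbb Z)$, $\delta(A)$ is the derivation of $\bigwedge M$ ($\delta(A)(u\wedge v)=\delta(A)u\wedge v+u\wedge\delta(A)v$) with $\delta(A)u=Au$ for $u\in M$. For $A=\sum a_{ij}\mathcal B_{ij}$, let $k$ be the minimum of the $j$ with some $a_{ij}\neq0$; then $\delta_m(A)\in\mathrm{End}_{\mathbb Z}(F_m)$ is defined by $\delta_m(A)[\mathbf b]_{m+\lambda}=(\delta(A)\mathbf b^r_{m+\lambda})\wedge[\mathbf b]_{m-r}$ for any $r\ge\ell(\lambda)$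 with $m-r<k$ (independent of $r$). $i_{z,w}$ denotes expansion of a rational expression as a power series in $w/z$; thus $i_{z,w}\frac{z}{z-w}=\sum_{k\ge0}(w/z)^k$. *)

theory Defs
  imports
    "HOL-Library.Poly_Mapping"
    "HOL-Library.Groups_Big_Fun"
    "HOL-Computational_Algebra.Formal_Power_Series"
begin

unbundle fps_syntax

text \<open>
  \<open>zlin f\<close> is the additive map on the free abelian group \<open>'a \<Rightarrow>\<^sub>0 int\<close> that takes the basis
  vector \<open>k\<close> to \<open>f k\<close>.
\<close>

definition zlin :: "('a \<Rightarrow> 'b::ring_1) \<Rightarrow> ('a \<Rightarrow>\<^sub>0 int) \<Rightarrow> 'b" where
  "zlin f x = (\<Sum>k\<in>Poly_Mapping.keys x. of_int (Poly_Mapping.lookup x k) * f k)"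

lemma zlin_superset:
  assumes "finite A" "Poly_Mapping.keys x \<subseteq> A"
  shows "zlin f x = (\<Sum>k\<in>A. of_int (Poly_Mapping.lookup x k) * f k)"
  unfolding zlin_def using assms
  by (intro sum.mono_neutral_left) (auto simp: in_keys_iff)

lemma zlin_zero [simp]: "zlin f 0 = 0"
  by (simp add: zlin_def)

lemma zlin_add: "zlin f (x + y) = zlin f x + zlin f y"
proof -
  let ?A = "Poly_Mapping.keys x \<union> Poly_Mapping.keys y"
  have "zlin f (x + y) = (\<Sum>k\<in>?A. of_int (Poly_Mapping.lookup (x + y) k) * f k)"
    by (rule zlin_superset) (use Poly_Mapping.keys_add[of x y] in auto)
  also have "\<dots> = zlin f x + zlin f y"
    by (simp add: zlin_superset[of ?A x] zlin_superset[of ?A y] lookup_add algebra_simps sum.distrib)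
  finally show ?thesis .
qed

lemma zlin_uminus: "zlin f (- x) = - zlin f x"
  using zlin_add[of f x "- x"] by (simp add: eq_neg_iff_add_eq_0 add.commute)

lemma zlin_diff: "zlin f (x - y) = zlin f x - zlin f y"
  using zlin_add[of f x "- y"] by (simp add: zlin_uminus)

lemma zlin_sum: "zlin f (sum g A) = (\<Sum>a\<in>A. zlin f (g a))"
  by (induction A rule: infinite_finite_induct) (auto simp: zlin_add)

lemma zlin_single [simp]: "zlin f (Poly_Mapping.single k c) = of_int c * f k"
  by (cases "c = 0") (auto simp: zlin_def)

lemma sum_singles:
  fixes x :: "'a \<Rightarrow>\<^sub>0 int"
  shows "(\<Sum>k\<in>Poly_Mapping.keys x. Poly_Mapping.single k (Poly_Mapping.lookup x k)) = x"
  by (rule poly_mapping_eqI) (auto simp: lookup_sum lookup_single when_def in_keys_iff)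

lemma poly_mapping_int_induct [case_names zero add single]:
  fixes x :: "'a \<Rightarrow>\<^sub>0 int"
  assumes "P 0" "\<And>x y. P x \<Longrightarrow> P y \<Longrightarrow> P (x + y)" "\<And>k c. P (Poly_Mapping.single k c)"
  shows "P x"
proof -
  have "P (\<Sum>k\<in>A. Poly_Mapping.single k (Poly_Mapping.lookup x k))" if "finite A" for A
    using that by (induction A) (use assms in auto)
  from this[of "Poly_Mapping.keys x"] show ?thesis
    by (simp add: sum_singles)
qed

lemma zlin_mult:
  fixes f :: "'a::monoid_add \<Rightarrow> 'b::ring_1"
  assumes "\<And>v w. f (v + w) = f v * f w"
  shows "zlin f (x * y) = zlin f x * zlin f y"
proof (induction x rule: poly_mapping_int_induct)
  case (single k c)
  show ?case
  proof (induction y rule: poly_mapping_int_induct)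
    case (single l d)
    have "of_int (c * d) * (f k * f l) = of_int c * (f k * (of_int d * f l))"
      by (metis mult.assoc mult_of_int_commute of_int_mult)
    then show ?case by (simp add: mult_single assms mult.assoc)
  qed (auto simp: zlin_add distrib_left)
qed (auto simp: zlin_add distrib_right)


section \<open>The exterior algebra\<close>

text \<open>
  The tensor algebra of the free module \<open>M\<close> is the monoid ring over the free monoid of words
  in the indices of the basis vectors; the word \<open>[i\<^sub>1, \<dots>, i\<^sub>k]\<close> is the tensor
  \<open>b\<^bsub>i\<^sub>1\<^esub> \<otimes> \<dots> \<otimes> b\<^bsub>i\<^sub>k\<^esub>\<close>.  Multiplication is the convolution product of \<^theory>\<open>HOL-Library.Poly_Mapping\<close>.
\<close>

instantiation list :: (type) monoid_add
begin
definition zero_list :: "'a list" where "zero_list = []"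
definition plus_list :: "'a list \<Rightarrow> 'a list \<Rightarrow> 'a list" where "plus_list = append"
instance by standard (auto simp: zero_list_def plus_list_def)
end

type_synonym M = "int \<Rightarrow>\<^sub>0 int"
type_synonym tensor = "int list \<Rightarrow>\<^sub>0 int"

definition tensor_of :: "M \<Rightarrow> tensor" where
  "tensor_of = zlin (\<lambda>i. Poly_Mapping.single [i] 1)"

inductive_set ext_ideal :: "tensor set" where
  square: "tensor_of u * tensor_of u \<in> ext_ideal"
| add: "x \<in> ext_ideal \<Longrightarrow> y \<in> ext_ideal \<Longrightarrow> x + y \<in> ext_ideal"
| lmult: "x \<in> ext_ideal \<Longrightarrow> p * x \<in> ext_ideal"
| rmult: "x \<in> ext_ideal \<Longrightarrow> x * p \<in> ext_ideal"

lemma ext_ideal_zero [simp]: "0 \<in> ext_ideal"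
  using ext_ideal.lmult[OF ext_ideal.square[of 0], of 0] by simp

lemma ext_ideal_uminus: "x \<in> ext_ideal \<Longrightarrow> - x \<in> ext_ideal"
  using ext_ideal.lmult[of x "- 1"] by simp

lemma ext_ideal_diff: "x \<in> ext_ideal \<Longrightarrow> y \<in> ext_ideal \<Longrightarrow> x - y \<in> ext_ideal"
  using ext_ideal.add[of x "- y"] ext_ideal_uminus[of y] by simp

definition ext_rel :: "tensor \<Rightarrow> tensor \<Rightarrow> bool" where
  "ext_rel x y \<longleftrightarrow> x - y \<in> ext_ideal"

lemma equivp_ext_rel: "equivp ext_rel"
proof (rule equivpI)
  show "reflp ext_rel" by (auto simp: reflp_def ext_rel_def)
  show "symp ext_rel"
    unfolding symp_def ext_rel_def by (metis ext_ideal_uminus minus_diff_eq)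
  show "transp ext_rel"
  proof (rule transpI)
    fix x y z assume "ext_rel x y" "ext_rel y z"
    then have "(x - y) + (y - z) \<in> ext_ideal"
      unfolding ext_rel_def by (rule ext_ideal.add)
    then show "ext_rel x z" by (simp add: ext_rel_def)
  qed
qed

quotient_type ext = tensor / ext_rel
  by (rule equivp_ext_rel)

lemma zlin_ext_ideal_eq_0:
  assumes "\<And>v w. f (v + w) = f v * f w"
    and "\<And>u. zlin f (tensor_of u) * zlin f (tensor_of u) = (0::'b::ring_1)"
    and "x \<in> ext_ideal"
  shows "zlin f x = 0"
  using assms(3)
  by induction (auto simp: zlin_mult[OF assms(1)] zlin_add assms(2))

lemma zlin_zlin_single:
  "zlin f (zlin (\<lambda>i. Poly_Mapping.single (h i) 1) u) = zlin (\<lambda>i. f (h i)) u"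
  for f :: "'a::monoid_add \<Rightarrow> 'b::ring_1"
proof (induction u rule: poly_mapping_int_induct)
  case (single k c)
  have "of_int c * Poly_Mapping.single (h k) 1 = Poly_Mapping.single (h k) c"
    by (simp flip: single_of_int add: mult_single)
  then show ?case by simp
qed (auto simp: zlin_add)

lemma zlin_tensor_of: "zlin f (tensor_of u) = zlin (\<lambda>i. f [i]) u"
  unfolding tensor_of_def by (rule zlin_zlin_single)

lemma one_notin_ext_ideal: "1 \<notin> ext_ideal"
proof
  define f :: "int list \<Rightarrow> int" where "f w = (if w = [] then 1 else 0)" for w
  have f0: "zlin (\<lambda>i. f [i]) u = 0" for u
    by (simp add: f_def zlin_def)
  assume "1 \<in> ext_ideal"
  then have "zlin f 1 = 0"
    by (rule zlin_ext_ideal_eq_0[rotated 2])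
       (simp_all add: f_def[symmetric] zlin_tensor_of f0, simp add: f_def plus_list_def)
  moreover have "zlin f 1 = 1"
    by (simp add: f_def zero_list_def flip: single_one)
  ultimately show False by simp
qed

instantiation ext :: ring_1
begin

lift_definition zero_ext :: ext is 0 .
lift_definition one_ext :: ext is 1 .
lift_definition plus_ext :: "ext \<Rightarrow> ext \<Rightarrow> ext" is "(+)"
proof -
  fix x x' y y' assume "ext_rel x x'" "ext_rel y y'"
  then have "(x - x') + (y - y') \<in> ext_ideal"
    unfolding ext_rel_def by (rule ext_ideal.add)
  then show "ext_rel (x + y) (x' + y')"
    by (simp add: ext_rel_def algebra_simps)
qed
lift_definition minus_ext :: "ext \<Rightarrow> ext \<Rightarrow> ext" is "(-)"
proof -
  fix x x' y y' assume "ext_rel x x'" "ext_rel y y'"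
  then have "(x - x') - (y - y') \<in> ext_ideal"
    unfolding ext_rel_def by (rule ext_ideal_diff)
  then show "ext_rel (x - y) (x' - y')"
    by (simp add: ext_rel_def algebra_simps)
qed
lift_definition uminus_ext :: "ext \<Rightarrow> ext" is uminus
proof -
  fix x x' assume "ext_rel x x'"
  then have "- (x - x') \<in> ext_ideal"
    unfolding ext_rel_def by (rule ext_ideal_uminus)
  then show "ext_rel (- x) (- x')"
    by (simp add: ext_rel_def algebra_simps)
qed
lift_definition times_ext :: "ext \<Rightarrow> ext \<Rightarrow> ext" is "(*)"
proof -
  fix x x' y y' assume "ext_rel x x'" "ext_rel y y'"
  then have "(x - x') * y + x' * (y - y') \<in> ext_ideal"
    unfolding ext_rel_def by (intro ext_ideal.add ext_ideal.lmult ext_ideal.rmult)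
  then show "ext_rel (x * y) (x' * y')"
    by (simp add: ext_rel_def algebra_simps)
qed

instance
proof
  fix x y z :: ext
  show "x + y + z = x + (y + z)" by transfer (simp add: ext_rel_def add.assoc)
  show "x + y = y + x" by transfer (simp add: ext_rel_def add.commute)
  show "0 + x = x" by transfer (simp add: ext_rel_def)
  show "- x + x = 0" by transfer (simp add: ext_rel_def)
  show "x - y = x + - y" by transfer (simp add: ext_rel_def)
  show "x * y * z = x * (y * z)" by transfer (simp add: ext_rel_def mult.assoc)
  show "1 * x = x" by transfer (simp add: ext_rel_def)
  show "x * 1 = x" by transfer (simp add: ext_rel_def)
  show "(x + y) * z = x * z + y * z" by transfer (simp add: ext_rel_def distrib_right)
  show "x * (y + z) = x * y + x * z" by transfer (simp add: ext_rel_def distrib_left)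
  show "(0::ext) \<noteq> 1"
    by transfer (use one_notin_ext_ideal ext_ideal_uminus[of "- 1"] in \<open>auto simp: ext_rel_def\<close>)
qed

end

text \<open>The product of the ring \<open>ext\<close> is the wedge product of \<open>\<And>M\<close>.\<close>

lift_definition bas :: "int \<Rightarrow> ext" is "\<lambda>i. Poly_Mapping.single [i] 1" .

definition incl :: "M \<Rightarrow> ext" where "incl = zlin bas"


lemma plus_ext_abs: "abs_ext x + abs_ext y = abs_ext (x + y)"
  by (rule plus_ext.abs_eq)

lemma times_ext_abs: "abs_ext x * abs_ext y = abs_ext (x * y)"
  by (rule times_ext.abs_eq)

definition bword :: "int list \<Rightarrow> ext" where
  "bword w = prod_list (map bas w)"

lemma bword_add: "bword (v + w) = bword v * bword w"
  by (simp add: bword_def plus_list_def)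

lemma bword_single [simp]: "bword [i] = bas i"
  by (simp add: bword_def)

lemma abs_ext_word: "abs_ext (Poly_Mapping.single w 1) = bword w"
proof (induction w)
  case Nil
  then show ?case
    by (simp add: bword_def one_ext.abs_eq single_one[folded zero_list_def, symmetric] zero_list_def)
next
  case (Cons i w)
  have "Poly_Mapping.single (i # w) 1 =
      Poly_Mapping.single [i] 1 * (Poly_Mapping.single w 1 :: tensor)"
    by (simp add: mult_single plus_list_def)
  then show ?case
    by (simp add: times_ext_abs[symmetric] Cons bas.abs_eq[symmetric] bword_def)
qed

lemma abs_ext_of_nat: "abs_ext (of_nat n) = of_nat n"
  by (induction n) (simp_all add: zero_ext.abs_eq[symmetric] one_ext.abs_eq[symmetric] plus_ext_abs[symmetric])

lemma abs_ext_of_int: "abs_ext (of_int c) = of_int c"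
  by (cases c rule: int_diff_cases)
     (simp add: minus_ext.abs_eq[symmetric] abs_ext_of_nat)

lemma abs_ext_eq_zlin: "abs_ext x = zlin bword x"
proof (induction x rule: poly_mapping_int_induct)
  case zero
  then show ?case by (simp add: zero_ext.abs_eq)
next
  case (add x y)
  then show ?case by (simp add: plus_ext_abs[symmetric] zlin_add)
next
  case (single w c)
  have "Poly_Mapping.single w c = of_int c * Poly_Mapping.single w 1"
    by (simp flip: single_of_int add: mult_single)
  then show ?case
    by (metis abs_ext_of_int abs_ext_word times_ext_abs zlin_single)
qed

lemma incl_eq_abs: "incl u = abs_ext (tensor_of u)"
  by (simp add: abs_ext_eq_zlin zlin_tensor_of incl_def)

lemma incl_square [simp]: "incl u * incl u = 0"
proof -
  have "ext_rel (tensor_of u * tensor_of u) 0"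
    by (simp add: ext_rel_def ext_ideal.square)
  then show ?thesis
    by (simp add: incl_eq_abs times_ext_abs zero_ext.abs_eq ext.abs_eq_iff)
qed

lemma incl_add: "incl (u + v) = incl u + incl v"
  by (simp add: incl_def zlin_add)

lemma incl_single [simp]: "incl (Poly_Mapping.single i 1) = bas i"
  by (simp add: incl_def)

lemma incl_anticommute: "incl u * incl v + incl v * incl u = 0"
  using incl_square[of "u + v"] by (simp add: incl_add algebra_simps)

lemma incl_frag_cmul: "incl (frag_cmul c u) = of_int c * incl u"
proof (induction u rule: poly_mapping_int_induct)
  case (single k d)
  have "frag_cmul c (Poly_Mapping.single k d) = Poly_Mapping.single k (c * d)"
    by (rule poly_mapping_eqI) (auto simp: lookup_frag_cmul lookup_single when_def)
  then show ?case by (simp add: incl_def mult.assoc)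
qed (auto simp: frag_cmul_distrib2 incl_add algebra_simps, simp add: incl_def)

lemma zlin_incl: "zlin (\<lambda>i. incl (h i)) u = incl (frag_extend h u)"
proof -
  have "(\<Sum>i\<in>A. of_int (Poly_Mapping.lookup u i) * incl (h i)) =
      incl (\<Sum>i\<in>A. frag_cmul (Poly_Mapping.lookup u i) (h i))" if "finite A" for A
    using that
    by (induction A) (auto simp: incl_add incl_frag_cmul, simp add: incl_def)
  then show ?thesis
    by (simp add: zlin_def frag_extend_def)
qed


section \<open>Hasse-Schmidt derivations of the exterior algebra\<close>

text \<open>
  A series in \<open>z\<^sup>-\<^sup>1\<close> is stored as the formal power series in the variable \<open>z\<^sup>-\<^sup>1\<close>, so that the
  \<open>n\<close>-th coefficient belongs to \<open>z\<^sup>-\<^sup>n\<close>.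
\<close>

definition HS_derivation :: "(ext \<Rightarrow> ext fps) \<Rightarrow> bool" where
  "HS_derivation D \<longleftrightarrow>
     (\<forall>u v. D (u + v) = D u + D v) \<and> (\<forall>u v. D (u * v) = D u * D v)"

definition fps_incl :: "M fps \<Rightarrow> ext fps" where
  "fps_incl f = Abs_fps (\<lambda>n. incl (f $ n))"

definition hs_word :: "(int \<Rightarrow> M fps) \<Rightarrow> int list \<Rightarrow> ext fps" where
  "hs_word g w = prod_list (map (\<lambda>i. fps_incl (g i)) w)"

lemma hs_word_add: "hs_word g (v + w) = hs_word g v * hs_word g w"
  by (simp add: hs_word_def plus_list_def)

lemma sum_anticommuting_eq_0:
  fixes c :: "nat \<Rightarrow> 'a::ring_1"
  assumes "\<And>i. c i * c i = 0" "\<And>i j. c i * c j + c j * c i = 0"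
  shows "(\<Sum>i=0..n. c (a + i) * c (a + n - i)) = 0"
proof (induction n arbitrary: a rule: less_induct)
  case (less n)
  consider "n = 0" | "n = 1" | k where "n = Suc (Suc k)"
    by (metis One_nat_def not0_implies_Suc)
  then show ?case
  proof cases
    case 3
    have "(\<Sum>i=0..n. c (a + i) * c (a + n - i)) =
        c a * c (a + n) + (\<Sum>i=0..k. c (a + Suc i) * c (a + n - Suc i)) + c (a + n) * c a"
      unfolding 3 by (subst sum.atLeast0_atMost_Suc_shift) simp
    also have "(\<Sum>i=0..k. c (a + Suc i) * c (a + n - Suc i)) =
        (\<Sum>i=0..k. c (Suc a + i) * c (Suc a + k - i))"
      unfolding 3 by (intro sum.cong) (auto simp: Suc_diff_le)
    also have "\<dots> = 0"
      using less.IH[of k "Suc a"] 3 by simp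
    finally show ?thesis using assms(2) by simp
  qed (use assms in auto)
qed

lemma zlin_fps_nth: "zlin f u $ n = zlin (\<lambda>i. f i $ n) u"
  for f :: "'a \<Rightarrow> 'b::ring_1 fps"
  by (simp add: zlin_def fps_sum_nth flip: fps_of_int)

lemma hs_word_square:
  "zlin (hs_word g) (tensor_of u) * zlin (hs_word g) (tensor_of u) = 0"
proof -
  define s where "s = zlin (hs_word g) (tensor_of u)"
  have s: "s $ n = incl (frag_extend (\<lambda>i. g i $ n) u)" for n
    by (simp add: s_def zlin_tensor_of zlin_fps_nth hs_word_def fps_incl_def zlin_incl)
  have "(\<Sum>i=0..n. s $ (0 + i) * s $ (0 + n - i)) = 0" for n
    by (rule sum_anticommuting_eq_0) (simp_all add: s incl_anticommute)
  then have "(s * s) $ n = 0" for n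
    by (simp add: fps_mult_nth)
  then show ?thesis
    unfolding s_def[symmetric] by (simp add: fps_eq_iff)
qed

text \<open>
  \<open>hs g\<close> is the Hasse-Schmidt derivation whose value at \<open>b\<^sub>j\<close> is the series
  \<open>g j \<in> M[[z\<^sup>\<plusminus>\<^sup>1]]\<close>; see \<open>HS_derivation_hs\<close> and \<open>hs_bas\<close> below.
\<close>

lift_definition hs :: "(int \<Rightarrow> M fps) \<Rightarrow> ext \<Rightarrow> ext fps" is
  "\<lambda>g x. zlin (hs_word g) x"
proof -
  fix g :: "int \<Rightarrow> M fps" and x y :: tensor
  assume "ext_rel x y"
  then have "zlin (hs_word g) (x - y) = 0"
    unfolding ext_rel_def by (intro zlin_ext_ideal_eq_0 hs_word_add hs_word_square)
  then show "zlin (hs_word g) x = zlin (hs_word g) y"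
    by (simp add: zlin_diff)
qed

lemma HS_derivation_hs: "HS_derivation (hs g)"
  unfolding HS_derivation_def
  by (intro conjI allI; transfer) (simp_all add: zlin_add zlin_mult hs_word_add)

lemma hs_bas: "hs g (bas j) = fps_incl (g j)"
  by transfer (simp add: hs_word_def)

lemma hs_1 [simp]: "hs g 1 = 1"
  by transfer (simp add: hs_word_def zero_list_def flip: single_one)

definition bM :: "int \<Rightarrow> M" where "bM i = Poly_Mapping.single i 1"

definition sigma_p_ext :: "ext \<Rightarrow> ext fps" where
  "sigma_p_ext = hs (\<lambda>j. Abs_fps (\<lambda>i. bM (j + int i)))"
definition sigma_m_ext :: "ext \<Rightarrow> ext fps" where
  "sigma_m_ext = hs (\<lambda>j. Abs_fps (\<lambda>i. bM (j - int i)))"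
definition sigma_bar_p_ext :: "ext \<Rightarrow> ext fps" where
  "sigma_bar_p_ext = hs (\<lambda>j. fps_const (bM j) - Abs_fps (\<lambda>i. if i = 1 then bM (j + 1) else 0))"
definition sigma_bar_m_ext :: "ext \<Rightarrow> ext fps" where
  "sigma_bar_m_ext = hs (\<lambda>j. fps_const (bM j) - Abs_fps (\<lambda>i. if i = 1 then bM (j - 1) else 0))"

lemma incl_bM [simp]: "incl (bM i) = bas i"
  by (simp add: bM_def)

lemma incl_zero [simp]: "incl 0 = 0" by (simp add: incl_def)
lemma incl_diff: "incl (u - v) = incl u - incl v" by (simp add: incl_def zlin_diff)

lemma sigma_ext_bas:
  "sigma_p_ext (bas j) $ n = bas (j + int n)"
  "sigma_m_ext (bas j) $ n = bas (j - int n)"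
  "sigma_bar_p_ext (bas j) $ n = (if n = 0 then bas j else if n = 1 then - bas (j + 1) else 0)"
  "sigma_bar_m_ext (bas j) $ n = (if n = 0 then bas j else if n = 1 then - bas (j - 1) else 0)"
  by (auto simp: sigma_p_ext_def sigma_m_ext_def sigma_bar_p_ext_def sigma_bar_m_ext_def hs_bas fps_incl_def incl_diff)


section \<open>The fermionic Fock space\<close>

text \<open>
  \<open>\<And>M \<otimes> [M]\<close> is a direct sum of copies of \<open>\<And>M\<close> indexed by the basis \<open>[b]\<^sub>m\<close> of \<open>[M]\<close>:
  \<open>u \<otimes> [b]\<^sub>m\<close> is \<open>Poly_Mapping.single m u\<close>.
\<close>

type_synonym ext_vac = "int \<Rightarrow>\<^sub>0 ext"

definition ext_act :: "ext \<Rightarrow> ext_vac \<Rightarrow> ext_vac" where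
  "ext_act a = Poly_Mapping.map (\<lambda>u. a * u)"

inductive_set fock_submod :: "ext_vac set" where
  absorb: "Poly_Mapping.single (m - 1) (bas m) - Poly_Mapping.single m 1 \<in> fock_submod"
| vanish: "Poly_Mapping.single m (bas m) \<in> fock_submod"
| add: "x \<in> fock_submod \<Longrightarrow> y \<in> fock_submod \<Longrightarrow> x + y \<in> fock_submod"
| act: "x \<in> fock_submod \<Longrightarrow> ext_act a x \<in> fock_submod"

lemma lookup_ext_act [simp]:
  "Poly_Mapping.lookup (ext_act a x) k = a * Poly_Mapping.lookup x k"
  by (auto simp: ext_act_def Poly_Mapping.map.rep_eq when_def)

lemma fock_submod_zero [simp]: "0 \<in> fock_submod"
proof -
  have "ext_act 0 (Poly_Mapping.single 0 (bas 0)) = 0" by (rule poly_mapping_eqI) simp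
  then show ?thesis using fock_submod.act[OF fock_submod.vanish[of 0], of 0] by simp
qed

lemma fock_submod_uminus: "x \<in> fock_submod \<Longrightarrow> - x \<in> fock_submod"
proof -
  assume "x \<in> fock_submod"
  moreover have "ext_act (- 1) x = - x"
    by (rule poly_mapping_eqI) (simp only: lookup_ext_act lookup_uminus mult_minus1)
  ultimately show ?thesis using fock_submod.act[of x "- 1"] by simp
qed

definition fock_rel :: "ext_vac \<Rightarrow> ext_vac \<Rightarrow> bool" where
  "fock_rel x y \<longleftrightarrow> x - y \<in> fock_submod"

lemma equivp_fock_rel: "equivp fock_rel"
proof (rule equivpI)
  show "reflp fock_rel" by (auto simp: reflp_def fock_rel_def)
  show "symp fock_rel"
    unfolding symp_def fock_rel_def by (metis fock_submod_uminus minus_diff_eq)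
  show "transp fock_rel"
  proof (rule transpI)
    fix x y z assume "fock_rel x y" "fock_rel y z"
    then have "(x - y) + (y - z) \<in> fock_submod"
      unfolding fock_rel_def by (rule fock_submod.add)
    then show "fock_rel x z" by (simp add: fock_rel_def)
  qed
qed

quotient_type fock = ext_vac / fock_rel
  by (rule equivp_fock_rel)

instantiation fock :: ab_group_add
begin

lift_definition zero_fock :: fock is 0 .
lift_definition plus_fock :: "fock \<Rightarrow> fock \<Rightarrow> fock" is "(+)"
proof -
  fix x x' y y' assume "fock_rel x x'" "fock_rel y y'"
  then have "(x - x') + (y - y') \<in> fock_submod"
    unfolding fock_rel_def by (rule fock_submod.add)
  then show "fock_rel (x + y) (x' + y')"
    by (simp add: fock_rel_def algebra_simps)
qed
lift_definition uminus_fock :: "fock \<Rightarrow> fock" is uminus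
proof -
  fix x x' assume "fock_rel x x'"
  then have "- (x - x') \<in> fock_submod"
    unfolding fock_rel_def by (rule fock_submod_uminus)
  then show "fock_rel (- x) (- x')"
    by (simp add: fock_rel_def algebra_simps)
qed
definition minus_fock :: "fock \<Rightarrow> fock \<Rightarrow> fock" where
  "minus_fock x y = x + - y"

instance
proof
  fix x y z :: fock
  show "x + y + z = x + (y + z)" by transfer (simp add: fock_rel_def add.assoc)
  show "x + y = y + x" by transfer (simp add: fock_rel_def add.commute)
  show "0 + x = x" by transfer (simp add: fock_rel_def)
  show "- x + x = 0" by transfer (simp add: fock_rel_def)
  show "x - y = x + - y" by (rule minus_fock_def)
qed

end

lift_definition wedge :: "ext \<Rightarrow> fock \<Rightarrow> fock" is ext_act
proof -
  fix a :: ext and x y :: ext_vac assume "fock_rel x y"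
  moreover have "ext_act a (x - y) = ext_act a x - ext_act a y"
    by (rule poly_mapping_eqI) (simp add: lookup_minus algebra_simps)
  ultimately show "fock_rel (ext_act a x) (ext_act a y)"
    unfolding fock_rel_def using fock_submod.act[of "x - y" a] by simp
qed

lift_definition vac :: "int \<Rightarrow> fock" is "\<lambda>m. Poly_Mapping.single m 1" .

lemma fock_rel_eqI: "x = y \<Longrightarrow> fock_rel x y"
  by (simp add: fock_rel_def)

lemma wedge_add_left: "wedge (u + v) x = wedge u x + wedge v x"
  by transfer (intro fock_rel_eqI poly_mapping_eqI, simp add: lookup_add distrib_right)

lemma wedge_add_right: "wedge u (x + y) = wedge u x + wedge u y"
  by transfer (intro fock_rel_eqI poly_mapping_eqI, simp add: lookup_add distrib_left)

lemma wedge_mult: "wedge (u * v) x = wedge u (wedge v x)"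
  by transfer (intro fock_rel_eqI poly_mapping_eqI, simp add: mult.assoc)

lemma wedge_one [simp]: "wedge 1 x = x"
  by transfer (intro fock_rel_eqI poly_mapping_eqI, simp)

lemma wedge_zero_left [simp]: "wedge 0 x = 0"
  using wedge_add_left[of 0 0 x] by simp

lemma wedge_b_vac: "wedge (bas m) (vac (m - 1)) = vac m"
proof -
  have "ext_act u (Poly_Mapping.single k 1) = Poly_Mapping.single k u" for u k
    by (rule poly_mapping_eqI) (simp add: lookup_single when_def)
  then show ?thesis
    using fock_submod.absorb[of m] by (simp add: wedge.abs_eq vac_def fock.abs_eq_iff fock_rel_def)
qed

lemma wedge_b_vac_same: "wedge (bas m) (vac m) = 0"
proof -
  have "ext_act u (Poly_Mapping.single k 1) = Poly_Mapping.single k u" for u k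
    by (rule poly_mapping_eqI) (simp add: lookup_single when_def)
  then show ?thesis
    using fock_submod.vanish[of m] by (simp add: wedge.abs_eq vac_def zero_fock_def fock.abs_eq_iff fock_rel_def)
qed


definition partitions :: "nat list set" where
  "partitions = {lam. sorted_wrt (\<ge>) lam \<and> 0 \<notin> set lam}"

text \<open>\<open>part lam i\<close> is \<open>\<lambda>\<^bsub>i+1\<^esub>\<close>.\<close>

definition part :: "nat list \<Rightarrow> nat \<Rightarrow> nat" where
  "part lam i = (if i < length lam then lam ! i else 0)"

definition bvec :: "nat \<Rightarrow> int \<Rightarrow> nat list \<Rightarrow> ext" where
  "bvec r m lam = prod_list (map (\<lambda>i. bas (m - int i + int (part lam i))) [0..<r])"

definition bvac :: "int \<Rightarrow> nat list \<Rightarrow> fock" where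
  "bvac m lam = wedge (bvec (length lam) m lam) (vac (m - int (length lam)))"

lemma bvec_Suc: "length lam \<le> r \<Longrightarrow> bvec (Suc r) m lam = bvec r m lam * bas (m - int r)"
  by (simp add: bvec_def part_def)

lemma bvac_eq:
  assumes "length lam \<le> r"
  shows "wedge (bvec r m lam) (vac (m - int r)) = bvac m lam"
  using assms
proof (induction r rule: dec_induct)
  case (step r)
  have "wedge (bas (m - int r)) (vac (m - int (Suc r))) = vac (m - int r)"
    using wedge_b_vac[of "m - int r"] by (simp add: algebra_simps)
  then show ?case
    using step by (simp only: bvec_Suc wedge_mult)
qed (simp add: bvac_def)

definition int_scale :: "int \<Rightarrow> fock \<Rightarrow> fock" where
  "int_scale c x = wedge (of_int c) x"

definition Fock :: "int \<Rightarrow> fock set" where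
  "Fock m = {(\<Sum>lam\<in>Poly_Mapping.keys c. int_scale (Poly_Mapping.lookup c lam) (bvac m lam)) |
     c. Poly_Mapping.keys c \<subseteq> partitions}"

text \<open>
  The \<open>bvac m lam\<close> with \<open>lam \<in> partitions\<close> are a basis of \<open>F = \<Oplus>\<^sub>m F\<^sub>m\<close>, so the coordinates are
  uniquely determined, and \<open>lin_ext g\<close> is the additive map with \<open>bvac m lam \<mapsto> g m lam\<close>.
\<close>

definition coords :: "fock \<Rightarrow> (int \<times> nat list \<Rightarrow>\<^sub>0 int)" where
  "coords u = (THE c. Poly_Mapping.keys c \<subseteq> UNIV \<times> partitions \<and>
     u = (\<Sum>(m, lam)\<in>Poly_Mapping.keys c.
            int_scale (Poly_Mapping.lookup c (m, lam)) (bvac m lam)))"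

definition lin_ext :: "(int \<Rightarrow> nat list \<Rightarrow> fock) \<Rightarrow> fock \<Rightarrow> fock" where
  "lin_ext g u = (\<Sum>(m, lam)\<in>Poly_Mapping.keys (coords u).
     int_scale (Poly_Mapping.lookup (coords u) (m, lam)) (g m lam))"


section \<open>Schubert derivations on the Fock space\<close>

definition fps_wedge :: "ext fps \<Rightarrow> fock fps \<Rightarrow> fock fps" where
  "fps_wedge U X = Abs_fps (\<lambda>n. \<Sum>i=0..n. wedge (U $ i) (X $ (n - i)))"

text \<open>
  The extension of \<open>T\<close> from \<open>\<And>M\<close> to \<open>F\<close> with prescribed values \<open>V m\<close> at the vacua \<open>[b]\<^sub>m\<close>.
  It maps each \<open>F\<^sub>m\<close> to \<open>F\<^sub>m[[z\<^sup>\<plusminus>\<^sup>1]]\<close>; the number \<open>r\<close> of factors is the length of the partition.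
\<close>

definition extend_fock :: "(ext \<Rightarrow> ext fps) \<Rightarrow> (int \<Rightarrow> fock fps) \<Rightarrow> fock \<Rightarrow> fock fps" where
  "extend_fock T V u = Abs_fps (\<lambda>n. lin_ext (\<lambda>m lam.
     fps_wedge (T (bvec (length lam) m lam)) (V (m - int (length lam))) $ n) u)"

definition sigma_p :: "fock \<Rightarrow> fock fps" where
  "sigma_p = extend_fock sigma_p_ext
     (\<lambda>m. fps_wedge (sigma_p_ext (bas m)) (fps_const (vac (m - 1))))"

definition sigma_bar_p :: "fock \<Rightarrow> fock fps" where
  "sigma_bar_p = extend_fock sigma_bar_p_ext
     (\<lambda>m. Abs_fps (\<lambda>j. int_scale ((- 1) ^ j) (bvac m (replicate j 1))))"

definition sigma_m :: "fock \<Rightarrow> fock fps" where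
  "sigma_m = extend_fock sigma_m_ext (\<lambda>m. fps_const (vac m))"

definition sigma_bar_m :: "fock \<Rightarrow> fock fps" where
  "sigma_bar_m = extend_fock sigma_bar_m_ext (\<lambda>m. fps_const (vac m))"


section \<open>The module structure over \<open>B = \<int>[e\<^sub>1, e\<^sub>2, \<dots>]\<close>\<close>

text \<open>The polynomial variable with index \<open>j\<close> is \<open>e\<^bsub>j+1\<^esub>\<close>, so that \<open>B\<close> has no variable \<open>e\<^sub>0\<close>.\<close>

type_synonym B = "(nat \<Rightarrow>\<^sub>0 nat) \<Rightarrow>\<^sub>0 int"

definition e_gen :: "nat \<Rightarrow> B" where
  "e_gen j = Poly_Mapping.single (Poly_Mapping.single (j - 1) 1) 1"

definition E_ser :: "B fps" where
  "E_ser = Abs_fps (\<lambda>j. if j = 0 then 1 else (- 1) ^ j * e_gen j)"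

definition inv_E_ser :: "B fps" where
  "inv_E_ser = fps_right_inverse E_ser 1"

lemma E_ser_times_inv: "E_ser * inv_E_ser = 1"
  unfolding inv_E_ser_def by (rule fps_right_inverse) (simp add: E_ser_def)

definition h_gen :: "nat \<Rightarrow> B" where "h_gen i = inv_E_ser $ i"

text \<open>
  The \<open>h_gen i\<close> generate \<open>B\<close> and the \<open>F\<^sub>m\<close> span \<open>F\<close>, so there is exactly one such module structure.
\<close>

definition B_act :: "B \<Rightarrow> fock \<Rightarrow> fock" where
  "B_act = (THE act. module act \<and> (\<forall>m. \<forall>u\<in>Fock m. \<forall>i. act (h_gen i) u = sigma_p u $ i))"


section \<open>The action of the Lie algebra of finite matrices\<close>

text \<open>An element of \<open>gl\<^sub>\<infinity>(\<int>)\<close> is given by its matrix entries \<open>a\<^bsub>ij\<^esub>\<close>.\<close>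

type_synonym gl = "int \<times> int \<Rightarrow>\<^sub>0 int"

definition Bmat :: "int \<Rightarrow> int \<Rightarrow> gl" where
  "Bmat i j = Poly_Mapping.single (i, j) 1"

definition gl_apply :: "gl \<Rightarrow> M \<Rightarrow> M" where
  "gl_apply A = frag_extend (\<lambda>k. \<Sum>(i, j)\<in>Poly_Mapping.keys A.
     if j = k then Poly_Mapping.single i (Poly_Mapping.lookup A (i, j)) else 0)"

lemma gl_apply_Bmat: "gl_apply (Bmat i j) (bM k) = (if j = k then bM i else 0)"
  by (simp add: gl_apply_def Bmat_def bM_def)

fun delta_word :: "gl \<Rightarrow> int list \<Rightarrow> ext" where
  "delta_word A [] = 0"
| "delta_word A (i # w) = incl (gl_apply A (bM i)) * bword w + bas i * delta_word A w"

lemma delta_word_add: "delta_word A (v + w) = delta_word A v * bword w + bword v * delta_word A w"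
  by (induction v) (auto simp: plus_list_def bword_def algebra_simps)

lemma zlin_delta_word_mult:
  "zlin (delta_word A) (x * y) =
     zlin (delta_word A) x * abs_ext y + abs_ext x * zlin (delta_word A) y"
proof (induction x rule: poly_mapping_int_induct)
  case (single k c)
  show ?case
  proof (induction y rule: poly_mapping_int_induct)
    case (single l d)
    have *: "of_int c * (x * (of_int d * y)) = of_int (c * d) * (x * y)" for x y :: ext
      by (metis mult.assoc mult_of_int_commute of_int_mult)
    show ?case
      by (simp add: mult_single delta_word_add abs_ext_eq_zlin mult.assoc *)
         (simp add: distrib_left mult.assoc)
  qed (auto simp: zlin_add distrib_left abs_ext_eq_zlin)
qed (auto simp: zlin_add distrib_right abs_ext_eq_zlin)

lemma zlin_delta_word_ideal:
  assumes "x \<in> ext_ideal"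
  shows "zlin (delta_word A) x = 0"
proof -
  have abs0: "abs_ext y = 0" if "y \<in> ext_ideal" for y
    using that by (simp add: zero_ext.abs_eq ext.abs_eq_iff ext_rel_def)
  show ?thesis
    using assms
  proof induction
    case (square u)
    have "zlin (delta_word A) (tensor_of u) = incl (frag_extend (\<lambda>i. gl_apply A (bM i)) u)"
      by (simp add: zlin_tensor_of zlin_incl bword_def)
    then show ?case
      by (simp add: zlin_delta_word_mult incl_anticommute flip: incl_eq_abs)
  qed (auto simp: zlin_add zlin_delta_word_mult abs0)
qed

lift_definition delta_ext :: "gl \<Rightarrow> ext \<Rightarrow> ext" is "\<lambda>A x. zlin (delta_word A) x"
proof -
  fix A :: gl and x y :: tensor
  assume "ext_rel x y"
  then show "zlin (delta_word A) x = zlin (delta_word A) y"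
    using zlin_delta_word_ideal[of "x - y" A] by (simp add: ext_rel_def zlin_diff)
qed

lemma delta_ext_add: "delta_ext A (u + v) = delta_ext A u + delta_ext A v"
  by transfer (simp add: zlin_add)

lemma delta_ext_mult: "delta_ext A (u * v) = delta_ext A u * v + u * delta_ext A v"
proof -
  have "\<exists>x. w = abs_ext x" for w
    by (induction w rule: ext.abs_induct) blast
  then obtain x y where "u = abs_ext x" "v = abs_ext y"
    by blast
  then show ?thesis
    by (simp add: times_ext_abs delta_ext.abs_eq zlin_delta_word_mult)
qed

lemma delta_ext_incl: "delta_ext A (incl u) = incl (gl_apply A u)"
proof -
  have "gl_apply A u = frag_extend (\<lambda>i. gl_apply A (bM i)) u"
    by (simp add: gl_apply_def bM_def frag_extend_compose)
  then show ?thesis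
    by (simp add: incl_eq_abs[of u] delta_ext.abs_eq zlin_tensor_of bword_def zlin_incl)
qed

text \<open>
  \<open>delta_fock A\<close> is the direct sum of the \<open>\<delta>\<^sub>m(A)\<close>, that is, its restriction to \<open>F\<^sub>m\<close> is
  \<open>\<delta>\<^sub>m(A)\<close>.  The number \<open>delta_len A m lam\<close> is the least \<open>r \<ge> \<ell>(\<lambda>)\<close> with \<open>m - r < k\<close>, where \<open>k\<close>
  is the smallest index of a nonzero column of \<open>A\<close> (for \<open>A = 0\<close> the choice of \<open>k\<close> is irrelevant).
  By \<open>delta_fock_indep\<close> any larger \<open>r\<close> gives the same value.
\<close>

definition delta_len :: "gl \<Rightarrow> int \<Rightarrow> nat list \<Rightarrow> nat" where
  "delta_len A m lam = max (length lam) (nat (m - Min (snd ` Poly_Mapping.keys A) + 1))"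

definition delta_fock :: "gl \<Rightarrow> fock \<Rightarrow> fock" where
  "delta_fock A = lin_ext (\<lambda>m lam.
     wedge (delta_ext A (bvec (delta_len A m lam) m lam)) (vac (m - int (delta_len A m lam))))"

lemma delta_fock_indep:
  assumes "delta_len A m lam \<le> r"
  shows "wedge (delta_ext A (bvec r m lam)) (vac (m - int r)) =
    wedge (delta_ext A (bvec (delta_len A m lam) m lam)) (vac (m - int (delta_len A m lam)))"
  using assms
proof (induction r rule: dec_induct)
  case (step r)
  have "m - int r < j" if "(i, j) \<in> Poly_Mapping.keys A" for i j
  proof -
    have "Min (snd ` Poly_Mapping.keys A) \<le> j"
      using that by (intro Min_le) force+
    then show ?thesis
      using step(1) by (simp add: delta_len_def nat_le_iff)
  qed
  then have "gl_apply A (bM (m - int r)) = 0"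
    by (force simp: gl_apply_def bM_def intro!: sum.neutral)
  then have 0: "delta_ext A (bas (m - int r)) = 0"
    using delta_ext_incl[of A "bM (m - int r)"] by simp
  have *: "wedge (bas (m - int r)) (vac (m - int (Suc r))) = vac (m - int r)"
    using wedge_b_vac[of "m - int r"] by (simp add: algebra_simps)
  have "length lam \<le> r"
    using step(1) by (simp add: delta_len_def)
  then have "delta_ext A (bvec (Suc r) m lam) = delta_ext A (bvec r m lam) * bas (m - int r)"
    by (simp add: bvec_Suc delta_ext_mult 0)
  then show ?case
    using step.IH by (simp only: wedge_mult *)
qed simp


section \<open>Formal series in two variables\<close>

text \<open>
  A formal series in \<open>z\<^sup>\<plusminus>\<^sup>1, w\<^sup>\<plusminus>\<^sup>1\<close> is the family of its coefficients: \<open>S p q\<close> is the coefficient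
  of \<open>z\<^sup>p w\<^sup>q\<close>.
\<close>

type_synonym 'a series2 = "int \<Rightarrow> int \<Rightarrow> 'a"

definition const2 :: "fock \<Rightarrow> fock series2" where
  "const2 u p q = (if p = 0 \<and> q = 0 then u else 0)"

text \<open>
  Coefficientwise application of an operator \<open>\<tau>(z) = \<Sum>\<^sub>k \<tau>\<^sub>k z\<^bsup>sk\<^esup>\<close> (or \<open>\<tau>(w)\<close>), where the sign \<open>s\<close>
  is \<open>1\<close> for \<open>\<sigma>\<^sub>+\<close> and its inverse and \<open>-1\<close> for \<open>\<sigma>\<^sub>-\<close> and its inverse.

  All these sums are used only where they have finitely many nonzero terms.  A minus operator
  gives finitely many nonzero coefficients at each \<open>u \<in> F\<close> and is only applied to series that
  involve no nonzero power of its own variable.  A plus operator is only applied to series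
  in which, for each fixed exponent of the other variable, almost all coefficients vanish.  The series
  multiplied by \<open>i\<^bsub>z,w\<^esub> z/(z - w)\<close> have exponents of \<open>w\<close> that are bounded below, and those
  multiplied by \<open>E(w)/E(z)\<close> are Laurent polynomials.
\<close>

definition app_z :: "int \<Rightarrow> (fock \<Rightarrow> fock fps) \<Rightarrow> fock series2 \<Rightarrow> fock series2" where
  "app_z s \<tau> S p q = Sum_any (\<lambda>k::nat. \<tau> (S (p - s * int k) q) $ k)"

definition app_w :: "int \<Rightarrow> (fock \<Rightarrow> fock fps) \<Rightarrow> fock series2 \<Rightarrow> fock series2" where
  "app_w s \<tau> S p q = Sum_any (\<lambda>k::nat. \<tau> (S p (q - s * int k)) $ k)"

text \<open>The product of a scalar series and a series with coefficients in \<open>F\<close>.\<close>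

definition mult2 ::
    "('r \<Rightarrow> fock \<Rightarrow> fock) \<Rightarrow> 'r series2 \<Rightarrow> fock series2 \<Rightarrow> fock series2" where
  "mult2 scale P S p q = Sum_any (\<lambda>(i, j). scale (P i j) (S (p - i) (q - j)))"

definition monom_zw :: "int \<Rightarrow> int \<Rightarrow> int series2" where
  "monom_zw a c i j = (if i = a \<and> j = c then 1 else 0)"

text \<open>\<open>i\<^bsub>z,w\<^esub> z/(z - w) = \<Sum>\<^bsub>k\<ge>0\<^esub> (w/z)\<^sup>k\<close>\<close>

definition geom_zw :: "int series2" where
  "geom_zw i j = (if 0 \<le> j \<and> i = - j then 1 else 0)"

text \<open>\<open>E(w)/E(z)\<close> as an element of \<open>B[[z, w]]\<close>\<close>

definition E_ratio :: "B series2" where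
  "E_ratio i j = (if 0 \<le> i \<and> 0 \<le> j then E_ser $ nat j * inv_E_ser $ nat i else 0)"

text \<open>\<open>\<delta>\<^sub>m(z, w) u = \<Sum>\<^bsub>i,j\<^esub> \<delta>\<^sub>m(\<B>\<^bsub>ij\<^esub>)u z\<^sup>i w\<^bsup>-j\<^esup>\<close> for \<open>u \<in> F\<^sub>m\<close>\<close>

definition delta_series :: "fock \<Rightarrow> fock series2" where
  "delta_series u p q = delta_fock (Bmat p (- q)) u"

end

theory Submission
  imports Defs "HOL-Library.Multiset"
begin

text \<open>
  Each of the four derivations satisfies a two-term recursion on \<open>b\<^sub>k \<and> x\<close> and is explicit on vacua.
  Put \<open>X(z) = \<sigma>\<^sub>+(z) \<sigma>\<^sub>-(z)\<^sup>-\<^sup>1\<close> and \<open>Y(w) = \<sigma>\<^sub>+(w)\<^sup>-\<^sup>1 \<sigma>\<^sub>-(w)\<close>, and let \<open>s\<close> be the index shift \<open>F\<^sub>m \<rightarrow> F\<^bsub>m+1\<^esub>\<close>.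
  The recursions give \<open>X(z) (b\<^sub>k \<and> x) = - z\<^sup>-\<^sup>1 b\<^bsub>k-1\<^esub> \<and> X(z) x\<close>, hence \<open>X(z) s x = z\<^bsup>-m-1\<^esup> \<Sum>\<^sub>i z\<^sup>i b\<^sub>i \<and> x\<close> for
  \<open>x \<in> F\<^sub>m\<close>, and, by a telescoping argument whose boundary term does not vanish,
  \<open>Y(w) (b\<^sub>k \<and> x) = - w b\<^bsub>k+1\<^esub> \<and> Y(w) x + w\<^bsup>m+1-k\<^esup> s x\<close>.  Therefore \<open>(z/w)\<^sup>m X(z) Y(w)\<close> satisfies the Leibniz
  recursion that determines \<open>\<delta>(z,w)\<close>.  The second equality is the commutation of \<open>\<sigma>\<^sub>-(z)\<^sup>-\<^sup>1\<close> and \<open>\<sigma>\<^sub>+(w)\<^sup>-\<^sup>1\<close>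
  up to the factor \<open>1 - w/z\<close>, which can be seen on the vacua; the third holds because \<open>\<sigma>\<^sub>+(z)\<close> and its
  inverse have commuting coefficients and so make \<open>F\<close> a \<open>B\<close>-module.
\<close>

section \<open>The wedge action on the Fock space\<close>

lemma additive_wedge: "additive (wedge u)"
  by (simp add: additive_def wedge_add_right)

lemma additive_wedge_left: "additive (\<lambda>u. wedge u x)"
  by (simp add: additive_def wedge_add_left)

lemmas wedge_zero_right [simp] = additive.zero[OF additive_wedge]
lemmas wedge_uminus_right = additive.minus[OF additive_wedge]
lemmas wedge_diff_right = additive.diff[OF additive_wedge]
lemmas wedge_sum_right = additive.sum[OF additive_wedge]
lemmas wedge_uminus_left = additive.minus[OF additive_wedge_left]
lemmas wedge_diff_left = additive.diff[OF additive_wedge_left]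
lemmas wedge_sum_left = additive.sum[OF additive_wedge_left]

lemma additive_comp: "additive f \<Longrightarrow> additive g \<Longrightarrow> additive (\<lambda>x. f (g x))"
  by (simp add: additive_def)

lemma bas_square [simp]: "bas i * bas i = 0"
  by (metis incl_square incl_bM)

lemma bas_anticommute: "bas i * bas j = - (bas j * bas i)"
  by (metis incl_anticommute incl_bM eq_neg_iff_add_eq_0)

lemma wedge_bas_bas [simp]: "wedge (bas i) (wedge (bas i) x) = 0"
  by (simp flip: wedge_mult)

lemma wedge_bas_swap: "wedge (bas i) (wedge (bas j) x) = - wedge (bas j) (wedge (bas i) x)"
  by (metis bas_anticommute wedge_mult wedge_uminus_left)

lemma wedge_bas_vac_pred: "k = m - 1 \<Longrightarrow> wedge (bas m) (vac k) = vac m"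
  by (simp add: wedge_b_vac)

text \<open>Induction on m upwards from j: the next vacuum is b_(m+1) wedged onto
  \<open>vac m\<close>, and b_j can be swapped past b_(m+1).\<close>

lemma wedge_bas_vac_le [simp]: "j \<le> m \<Longrightarrow> wedge (bas j) (vac m) = 0"
proof (induction m rule: int_ge_induct)
  case base
  show ?case by (rule wedge_b_vac_same)
next
  case (step m)
  then show ?case
    using wedge_bas_swap[of j "m + 1" "vac m"] by (simp add: wedge_bas_vac_pred)
qed

lemma additive_int_scale: "additive (int_scale c)"
  by (simp add: additive_def int_scale_def wedge_add_right)

lemma int_scale_add: "int_scale (c + d) x = int_scale c x + int_scale d x"
  by (simp add: int_scale_def wedge_add_left)

lemma int_scale_0 [simp]: "int_scale 0 x = 0"
  by (simp add: int_scale_def)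

lemma int_scale_1 [simp]: "int_scale 1 x = x"
  by (simp add: int_scale_def)

lemma int_scale_uminus: "int_scale (- c) x = - int_scale c x"
  by (simp add: int_scale_def wedge_uminus_left)

lemma int_scale_zero_right [simp]: "int_scale c 0 = 0"
  by (simp add: int_scale_def)

lemma abs_ext_exhaust: "\<exists>x. u = abs_ext x"
  by (induction u rule: ext.abs_induct) blast

text \<open>Closure under differences alone yields zero, negatives, sums and integer multiples, so
  additive statements need only two cases.\<close>

lemma ext_induct [case_names word diff]:
  assumes word: "\<And>w. P (bword w)" and diff: "\<And>u v. P u \<Longrightarrow> P v \<Longrightarrow> P (u - v)"
  shows "P u"
proof -
  have 0: "P 0"
    using diff[OF word word] by (metis diff_self)
  have neg: "P (- u)" if "P u" for u
    using diff[OF 0 that] by simp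
  have add: "P (u + v)" if "P u" "P v" for u v
    using diff[OF that(1) neg[OF that(2)]] by simp
  have nat: "P (of_nat n * bword w)" for n w
    by (induction n) (auto simp: 0 algebra_simps intro!: add word)
  have scale: "P (of_int c * bword w)" for c w
    using nat neg[OF nat] by (cases c rule: int_cases2) auto
  obtain x where u: "u = abs_ext x"
    using abs_ext_exhaust by blast
  show ?thesis
    unfolding u abs_ext_eq_zlin
    by (induction x rule: poly_mapping_int_induct) (auto simp: zlin_add 0 scale intro: add)
qed

lemma bword_Nil [simp]: "bword [] = 1"
  by (simp add: bword_def)

lemma bword_Cons: "bword (i # w) = bas i * bword w"
  by (simp add: bword_def)

lemma wedge_vac_abs: "wedge u (vac m) = abs_fock (Poly_Mapping.single m u)"
proof -
  have "ext_act u (Poly_Mapping.single m 1) = Poly_Mapping.single m u"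
    by (rule poly_mapping_eqI) (simp add: lookup_single when_def)
  then show ?thesis
    by (simp add: wedge.abs_eq vac_def)
qed

text \<open>F is generated as an abelian group from the vacua by the operators b_k. The derivations
  obey recursions of exactly this shape.\<close>

lemma fock_induct [case_names vac bas diff]:
  assumes vac: "\<And>m. P (vac m)" and bas: "\<And>k x. P x \<Longrightarrow> P (wedge (bas k) x)"
    and diff: "\<And>x y. P x \<Longrightarrow> P y \<Longrightarrow> P (x - y)"
  shows "P x"
proof -
  have 0: "P 0"
    using diff[OF vac vac] by (metis diff_self)
  have add: "P (x + y)" if "P x" "P y" for x y
    using diff[OF that(1) diff[OF 0 that(2)]] by simp
  have word: "P (wedge (bword w) (vac m))" for w m
    by (induction w) (auto simp: bword_Cons wedge_mult intro: vac bas)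
  have gen: "P (wedge u (vac m))" for u m
    by (induction u rule: ext_induct) (auto simp: wedge_diff_left intro: diff word)
  have "P (abs_fock y)" for y
  proof -
    have plus: "abs_fock (a + b) = abs_fock a + abs_fock b" for a b
      by (simp add: plus_fock.abs_eq)
    have "P (abs_fock (\<Sum>k\<in>A. Poly_Mapping.single k (Poly_Mapping.lookup y k)))"
      if "finite A" for A
      using that
      by (induction A) (auto simp: plus simp flip: wedge_vac_abs zero_fock_def intro!: add 0 gen)
    moreover have "(\<Sum>k\<in>Poly_Mapping.keys y. Poly_Mapping.single k (Poly_Mapping.lookup y k)) = y"
      by (rule poly_mapping_eqI) (auto simp: lookup_sum lookup_single when_def in_keys_iff)
    ultimately show ?thesis
      by (metis finite_keys)
  qed
  then show ?thesis
    by (induction x rule: fock.abs_induct)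
qed

text \<open>The universal property of the quotient by W. The target carries no action of the
  exterior algebra, so both relations are required after wedging with an arbitrary u on the
  left.\<close>

lemma fock_lift:
  fixes \<phi> :: "int \<Rightarrow> ext \<Rightarrow> 'b::ab_group_add"
  assumes add: "\<And>m. additive (\<phi> m)"
    and absorb: "\<And>m u. \<phi> (m - 1) (u * bas m) = \<phi> m u"
    and vanish: "\<And>m u. \<phi> m (u * bas m) = 0"
  obtains h where "additive h" "\<And>m u. h (wedge u (vac m)) = \<phi> m u"
proof -
  define h0 where "h0 x = (\<Sum>m\<in>Poly_Mapping.keys x. \<phi> m (Poly_Mapping.lookup x m))" for x
  note \<phi>0 [simp] = additive.zero[OF add]
  have superset: "h0 x = (\<Sum>m\<in>A. \<phi> m (Poly_Mapping.lookup x m))"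
    if "finite A" "Poly_Mapping.keys x \<subseteq> A" for x A
    unfolding h0_def using that
    by (intro sum.mono_neutral_left) (auto simp: in_keys_iff)
  have h0_add: "h0 (x + y) = h0 x + h0 y" for x y
  proof -
    let ?A = "Poly_Mapping.keys x \<union> Poly_Mapping.keys y"
    have "h0 (x + y) = (\<Sum>m\<in>?A. \<phi> m (Poly_Mapping.lookup (x + y) m))"
      by (rule superset) (use Poly_Mapping.keys_add[of x y] in auto)
    then show ?thesis
      by (simp add: superset[of ?A x] superset[of ?A y] lookup_add additive.add[OF add] sum.distrib)
  qed
  have h0: "additive h0"
    by (simp add: additive_def h0_add)
  have h0_single [simp]: "h0 (Poly_Mapping.single m u) = \<phi> m u" for m u
    by (cases "u = 0") (auto simp: h0_def)
  have act_single: "ext_act a (Poly_Mapping.single m u) = Poly_Mapping.single m (a * u)" for a m u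
    by (rule poly_mapping_eqI) (simp add: lookup_single when_def)
  have act_diff: "ext_act a (x - y) = ext_act a x - ext_act a y" for a x y
    by (rule poly_mapping_eqI) (simp add: lookup_minus algebra_simps)
  have act_add: "ext_act a (x + y) = ext_act a x + ext_act a y" for a x y
    by (rule poly_mapping_eqI) (simp add: lookup_add algebra_simps)
  have act_act: "ext_act a (ext_act b x) = ext_act (a * b) x" for a b x
    by (rule poly_mapping_eqI) (simp add: mult.assoc)
  \<comment> \<open>Quantifying over a lets the closure of W under the action be absorbed into the
    multiplier.\<close>
  have "h0 (ext_act a x) = 0" if "x \<in> fock_submod" for x a
    using that
    by (induction arbitrary: a)
      (auto simp: act_diff act_add act_single act_act absorb vanish additive.diff[OF h0] h0_add)
  from this[where a = 1] have sub: "h0 x = 0" if "x \<in> fock_submod" for x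
  proof -
    have "ext_act 1 x = x"
      by (rule poly_mapping_eqI) simp
    then show ?thesis
      using that \<open>\<And>x. x \<in> fock_submod \<Longrightarrow> h0 (ext_act 1 x) = 0\<close> by fastforce
  qed
  define h where "h x = h0 (rep_fock x)" for x
  have h_abs: "h (abs_fock y) = h0 y" for y
  proof -
    have "fock_rel (rep_fock (abs_fock y)) y"
      by (rule Quotient3_rep_abs[OF Quotient3_fock]) (simp add: fock_rel_eqI)
    then have "h0 (rep_fock (abs_fock y) - y) = 0"
      using sub by (simp add: fock_rel_def)
    then show ?thesis
      by (simp add: h_def additive.diff[OF h0])
  qed
  show thesis
  proof
    show "additive h"
    proof
      fix x y
      show "h (x + y) = h x + h y"
        by (induction x rule: fock.abs_induct, induction y rule: fock.abs_induct)
          (simp add: plus_fock.abs_eq h_abs h0_add)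
    qed
    show "h (wedge u (vac m)) = \<phi> m u" for m u
      by (simp add: wedge_vac_abs h_abs)
  qed
qed

section \<open>The partition basis\<close>

text \<open>
  Linear independence is read off in the free abelian group on the subsets of \<open>\<int>\<close>: a semi-infinite
  wedge corresponds to the set of its indices, and \<open>b\<^sub>i\<close> acts by signed insertion.  The sign is
  meaningful only for sets bounded above; the other sets are sent to \<open>0\<close>.
\<close>

type_synonym maya = "int set \<Rightarrow>\<^sub>0 int"

definition maya_ins :: "int \<Rightarrow> maya \<Rightarrow> maya" where
  "maya_ins i = frag_extend (\<lambda>S. if i \<in> S \<or> infinite {s \<in> S. i < s} then 0
     else Poly_Mapping.single (insert i S) ((- 1) ^ card {s \<in> S. i < s}))"

lemma additive_maya_ins: "additive (maya_ins i)"
  by (simp add: additive_def maya_ins_def frag_extend_add)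

lemma maya_ins_single:
  "maya_ins i (Poly_Mapping.single S c) = (if i \<in> S \<or> infinite {s \<in> S. i < s} then 0
     else Poly_Mapping.single (insert i S) (c * (- 1) ^ card {s \<in> S. i < s}))"
proof (cases "c = 0")
  case False
  have "frag_cmul c (Poly_Mapping.single T d) = Poly_Mapping.single T (c * d)" for T :: "int set" and d
    by (rule poly_mapping_eqI) (simp add: lookup_single when_def)
  then show ?thesis
    using False by (simp add: maya_ins_def frag_extend_def)
qed (simp add: maya_ins_def)

text \<open>Changing the index alters the set above it by finitely many integers only. Hence both
  orders of a double insertion fall into the zero case together.\<close>

lemma infinite_above_iff:
  "infinite {s \<in> S. (i::int) < s} \<longleftrightarrow> infinite {s \<in> S. j < s}"
proof -
  have "{s \<in> S. i < s} \<subseteq> {s \<in> S. j < s} \<union> {i..j}" for i j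
    by auto
  then show ?thesis
    by (meson finite_UnI finite_atLeastAtMost_int finite_subset)
qed

text \<open>For distinct i and j the index inserted first is counted in the second sign exactly when
  it is the larger one. This happens in only one of the two orders.\<close>

lemma maya_ins_anticommute: "maya_ins i (maya_ins j g) = - maya_ins j (maya_ins i g)"
proof (induction g rule: poly_mapping_int_induct)
  case zero
  then show ?case by (simp add: maya_ins_def)
next
  case (add x y)
  then show ?case by (simp add: additive.add[OF additive_maya_ins])
next
  case (single S c)
  have card_ins: "card {s. (s = k \<or> s \<in> S) \<and> l < s} =
      (if l < k then Suc (card {s \<in> S. l < s}) else card {s \<in> S. l < s})"
    if "k \<notin> S" "finite {s \<in> S. l < s}" for k l
  proof -
    have "{s. (s = k \<or> s \<in> S) \<and> l < s} =
        (if l < k then insert k {s \<in> S. l < s} else {s \<in> S. l < s})"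
      by auto
    then show ?thesis
      using that by auto
  qed
  have inf_ins: "infinite {s. (s = k \<or> s \<in> S) \<and> l < s} \<longleftrightarrow> infinite {s \<in> S. l < s}" for k l
  proof -
    have "{s. (s = k \<or> s \<in> S) \<and> l < s} = {s \<in> S. l < s} \<union> {s \<in> {k}. l < s}"
      by auto
    then show ?thesis by simp
  qed
  show ?case
  proof (cases "i = j \<or> infinite {s \<in> S. i < s}")
    case True
    then show ?thesis
      using infinite_above_iff[of S i j]
      by (auto simp: maya_ins_single inf_ins additive.zero[OF additive_maya_ins])
  next
    case False
    then have "finite {s \<in> S. i < s}" "finite {s \<in> S. j < s}"
      using infinite_above_iff[of S i j] by auto
    moreover have "i < j \<or> j < i"
      using False by auto
    ultimately show ?thesis
      by (auto simp: maya_ins_single inf_ins card_ins insert_commute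
          additive.zero[OF additive_maya_ins] mult_ac simp flip: single_uminus)
  qed
qed

definition maya_act :: "tensor \<Rightarrow> maya \<Rightarrow> maya" where
  "maya_act x g = frag_extend (\<lambda>w. foldr maya_ins w g) x"

lemma maya_act_add: "maya_act (x + y) g = maya_act x g + maya_act y g"
  by (simp add: maya_act_def frag_extend_add)

lemma maya_act_diff: "maya_act (x - y) g = maya_act x g - maya_act y g"
  by (simp add: maya_act_def frag_extend_diff)

lemma maya_act_0 [simp]: "maya_act 0 g = 0"
  by (simp add: maya_act_def)

lemma maya_act_single: "maya_act (Poly_Mapping.single w c) g = frag_cmul c (foldr maya_ins w g)"
  by (cases "c = 0") (simp_all add: maya_act_def frag_extend_def)

lemma maya_ins_cmul: "maya_ins i (frag_cmul c g) = frag_cmul c (maya_ins i g)"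
  by (simp add: maya_ins_def frag_extend_cmul)

lemma foldr_maya_ins_add: "foldr maya_ins w (g + h) = foldr maya_ins w g + foldr maya_ins w h"
  by (induction w) (simp_all add: additive.add[OF additive_maya_ins])

lemma foldr_maya_ins_cmul: "foldr maya_ins w (frag_cmul c g) = frag_cmul c (foldr maya_ins w g)"
  by (induction w) (simp_all add: maya_ins_cmul)

lemma maya_act_add_right: "maya_act x (g + h) = maya_act x g + maya_act x h"
  by (simp add: maya_act_def frag_extend_def foldr_maya_ins_add frag_cmul_distrib2 sum.distrib)

lemma additive_maya_act: "additive (maya_act x)"
  by (simp add: additive_def maya_act_add_right)

lemma maya_act_mult: "maya_act (x * y) g = maya_act x (maya_act y g)"
proof (induction x rule: poly_mapping_int_induct)
  case (single v c)
  show ?case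
  proof (induction y rule: poly_mapping_int_induct)
    case (single w d)
    then show ?case
      by (simp add: mult_single maya_act_single plus_list_def foldr_maya_ins_cmul)
  qed (auto simp: distrib_left maya_act_add maya_act_add_right additive.zero[OF additive_maya_act])
qed (auto simp: distrib_right maya_act_add)

lemma maya_act_tensor_of: "maya_act (tensor_of u) g = frag_extend (\<lambda>i. maya_ins i g) u"
proof (induction u rule: poly_mapping_int_induct)
  case (single i c)
  have "of_int c * Poly_Mapping.single [i] 1 = Poly_Mapping.single [i] c"
    by (simp flip: single_of_int add: mult_single)
  then show ?case
    by (cases "c = 0") (simp_all add: tensor_of_def maya_act_single frag_extend_def)
qed (simp_all add: tensor_of_def zlin_add maya_act_add frag_extend_add)

lemma maya_act_anticommute:
  "maya_act (tensor_of u) (maya_act (tensor_of v) g) = - maya_act (tensor_of v) (maya_act (tensor_of u) g)"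
proof (induction u rule: poly_mapping_int_induct)
  case (single i c)
  show ?case
  proof (induction v rule: poly_mapping_int_induct)
    case (single j d)
    have *: "maya_act (tensor_of (Poly_Mapping.single i c)) g = frag_cmul c (maya_ins i g)" for i c g
      by (cases "c = 0") (simp_all add: maya_act_tensor_of frag_extend_def)
    show ?case
      by (rule poly_mapping_eqI)
        (simp add: * maya_ins_cmul maya_ins_anticommute[of i j] mult.commute)
  qed (simp_all add: tensor_of_def zlin_add maya_act_add maya_act_add_right additive.zero[OF additive_maya_act])
qed (simp_all add: tensor_of_def zlin_add maya_act_add maya_act_add_right additive.zero[OF additive_maya_act])

lemma maya_act_ideal:
  assumes "x \<in> ext_ideal"
  shows "maya_act x g = 0"
  using assms
proof (induction arbitrary: g)
  case (square u)
  let ?y = "maya_act (tensor_of u * tensor_of u) g"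
  \<comment> \<open>Anticommutation only gives twice \<open>?y\<close> equal to zero; integer
    coefficients then force \<open>?y\<close> to vanish.\<close>
  have "?y = - ?y"
    using maya_act_anticommute[of u u g] by (simp add: maya_act_mult)
  then have "Poly_Mapping.lookup ?y k = - Poly_Mapping.lookup ?y k" for k
    by (metis lookup_uminus)
  then show ?case
    by (intro poly_mapping_eqI) (simp add: eq_neg_iff_add_eq_0)
qed (simp_all add: maya_act_add maya_act_mult additive.zero[OF additive_maya_act])

lift_definition maya_ext :: "ext \<Rightarrow> maya \<Rightarrow> maya" is maya_act
proof -
  fix x y assume "ext_rel x y"
  then have "maya_act (x - y) g = 0" for g
    by (simp add: ext_rel_def maya_act_ideal)
  then show "maya_act x = maya_act y"
    by (auto simp: maya_act_diff)
qed

lemma maya_ext_mult: "maya_ext (u * v) g = maya_ext u (maya_ext v g)"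
  by transfer (rule maya_act_mult)

lemma additive_maya_ext: "additive (\<lambda>u. maya_ext u g)"
  unfolding additive_def by transfer (simp add: maya_act_add)

lemma additive_maya_ext_right: "additive (maya_ext u)"
  unfolding additive_def by transfer (simp add: maya_act_add_right)

lemma maya_ext_bas: "maya_ext (bas i) g = maya_ins i g"
  by transfer (simp add: maya_act_single)

lemma maya_ext_1: "maya_ext 1 g = g"
  by transfer (simp add: maya_act_single zero_list_def flip: single_one)

text \<open>The vacuum k becomes the set of all integers up to k. Inserting m into the set up to m -
  1 costs no sign, and inserting it into the set up to m gives zero: these are the two relations of
  W.\<close>

lemma maya_embedding:
  obtains h :: "fock \<Rightarrow> maya" where "additive h"
    "\<And>w k. h (wedge (bword w) (vac k)) = foldr maya_ins w (Poly_Mapping.single {..k} 1)"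
proof -
  have fin: "finite {s \<in> {..k}. j < s}" for j k :: int
    by (rule finite_subset[of _ "{j..k}"]) auto
  obtain h where h: "additive h" "\<And>m u. h (wedge u (vac m)) = maya_ext u (Poly_Mapping.single {..m} 1)"
  proof (rule fock_lift[where \<phi> = "\<lambda>m u. maya_ext u (Poly_Mapping.single {..m} 1)"])
    fix m u
    have "maya_ins m (Poly_Mapping.single {..m - 1} 1) = Poly_Mapping.single {..m} 1"
    proof -
      have *: "{s. s < m \<and> m < s} = {}" "insert m {..m - 1} = {..m}"
        by auto
      show ?thesis
        by (simp add: maya_ins_single *)
    qed
    then show "maya_ext (u * bas m) (Poly_Mapping.single {..m - 1} 1) =
        maya_ext u (Poly_Mapping.single {..m} 1)"
      by (simp add: maya_ext_mult maya_ext_bas)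
    show "maya_ext (u * bas m) (Poly_Mapping.single {..m} 1) = 0"
      by (simp add: maya_ext_mult maya_ext_bas maya_ins_single additive.zero[OF additive_maya_ext_right])
  qed (auto intro: additive_maya_ext)
  have "maya_ext (bword w) g = foldr maya_ins w g" for w g
    by (induction w) (simp_all add: maya_ext_1 bword_Cons maya_ext_mult maya_ext_bas)
  with h show thesis
    by (auto intro: that)
qed

text \<open>Letters are inserted from right to left, so each lies above everything already present
  and no sign arises.\<close>

lemma foldr_maya_ins_decreasing:
  assumes "sorted_wrt (>) w" "\<forall>i\<in>set w. k < i"
  shows "foldr maya_ins w (Poly_Mapping.single {..k} 1) = Poly_Mapping.single (set w \<union> {..k}) 1"
  using assms
proof (induction w)
  case (Cons i w)
  then have "{s \<in> set w \<union> {..k}. i < s} = {}" "i \<notin> set w \<union> {..k}"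
    by fastforce+
  note * = this
  show ?case
    using Cons by (simp add: maya_ins_single * del: Un_iff)
qed simp

section \<open>Index sets (Maya diagrams) of the partition vectors\<close>

definition bidx :: "int \<Rightarrow> nat list \<Rightarrow> nat \<Rightarrow> int" where
  "bidx m lam i = m - int i + int (part lam i)"

lemma bvec_eq_bword: "bvec r m lam = bword (map (bidx m lam) [0..<r])"
  by (simp add: bvec_def bword_def bidx_def comp_def)

lemma part_antimono:
  assumes "lam \<in> partitions" "i \<le> j"
  shows "part lam j \<le> part lam i"
  using assms by (cases "i = j") (auto simp: part_def partitions_def sorted_wrt_iff_nth_less)

lemma bidx_less:
  assumes "lam \<in> partitions" "i < j"
  shows "bidx m lam j < bidx m lam i"
  using part_antimono[OF assms(1), of i j] assms(2) by (simp add: bidx_def)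

lemma bidx_decreasing:
  assumes "lam \<in> partitions"
  shows "sorted_wrt (>) (map (bidx m lam) [0..<r])" "\<forall>i\<in>set (map (bidx m lam) [0..<r]). m - int r < i"
  using assms by (auto simp: sorted_wrt_iff_nth_less bidx_less) (simp add: bidx_def)

lemma range_bidx:
  "range (bidx m lam) = set (map (bidx m lam) [0..<length lam]) \<union> {..m - int (length lam)}"
proof -
  have "{..m - int (length lam)} \<subseteq> bidx m lam ` {length lam..}"
  proof
    fix x assume "x \<in> {..m - int (length lam)}"
    then show "x \<in> bidx m lam ` {length lam..}"
      by (intro image_eqI[of _ _ "nat (m - x)"]) (auto simp: bidx_def part_def)
  qed
  moreover have "bidx m lam i \<le> m - int (length lam)" if "length lam \<le> i" for i
    using that by (simp add: bidx_def part_def)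
  ultimately have "bidx m lam ` {length lam..} = {..m - int (length lam)}"
    by auto
  moreover have "bidx m lam ` {..<length lam} = set (map (bidx m lam) [0..<length lam])"
    by (simp add: atLeast0LessThan)
  moreover have "UNIV = {..<length lam} \<union> {length lam..}"
    by auto
  ultimately show ?thesis
    by (metis image_Un)
qed

text \<open>The sequence \<open>bidx m lam\<close> is strictly decreasing, so its i-th entry is the
  element of the range with exactly i elements above it, and the set determines the sequence.
  Entries far out give m, and the absence of zero parts gives the length.\<close>

lemma inj_bidx:
  assumes lam: "lam \<in> partitions" and mu: "mu \<in> partitions" and eq: "range (bidx m lam) = range (bidx n mu)"
  shows "m = n \<and> lam = mu"
proof -
  have card: "card {t \<in> range (bidx m lam). bidx m lam i < t} = i" if "lam \<in> partitions" for m lam i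
  proof -
    have less: "bidx m lam i < bidx m lam j \<longleftrightarrow> j < i" for i j
      using bidx_less[OF that] by (metis linorder_less_linear order_less_asym)
    then have "{t \<in> range (bidx m lam). bidx m lam i < t} = bidx m lam ` {..<i}"
      by auto
    moreover have "inj_on (bidx m lam) {..<i}"
      using bidx_less[OF that] by (metis (mono_tags, lifting) inj_onI linorder_neqE_nat less_irrefl)
    ultimately show ?thesis
      by (simp add: card_image)
  qed
  have bidx_eq: "bidx m lam i = bidx n mu i" for i
  proof -
    obtain j where j: "bidx m lam i = bidx n mu j"
      using eq by (metis rangeE rangeI)
    then have "i = j"
      using card[OF lam, of m i] card[OF mu, of n j] eq by simp
    with j show ?thesis by simp
  qed
  from bidx_eq[of "length lam + length mu"] have "m = n"
    by (simp add: bidx_def part_def)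
  then have part_eq: "part lam i = part mu i" for i
    using bidx_eq[of i] by (simp add: bidx_def)
  have len: "length lam \<le> length mu" if "lam \<in> partitions" "\<And>i. part lam i = part mu i" for lam mu
  proof (rule ccontr)
    assume less: "\<not> ?thesis"
    then have "lam ! length mu = 0"
      using that(2)[of "length mu"] by (simp add: part_def)
    then show False
      using that(1) less by (metis (mono_tags) linorder_not_less mem_Collect_eq nth_mem partitions_def)
  qed
  have "length lam = length mu"
    using len[OF lam part_eq] len[OF mu part_eq[symmetric]] by simp
  then have "lam = mu"
    using part_eq by (intro nth_equalityI) (auto simp: part_def, metis)
  with \<open>m = n\<close> show ?thesis by simp
qed

section \<open>Linear independence of the partition vectors\<close>

definition flin :: "('a \<Rightarrow> fock) \<Rightarrow> ('a \<Rightarrow>\<^sub>0 int) \<Rightarrow> fock" where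
  "flin f c = (\<Sum>k\<in>Poly_Mapping.keys c. int_scale (Poly_Mapping.lookup c k) (f k))"

lemma additive_flin: "additive (flin f)"
proof
  fix x y :: "'a \<Rightarrow>\<^sub>0 int"
  let ?A = "Poly_Mapping.keys x \<union> Poly_Mapping.keys y"
  have superset: "flin f c = (\<Sum>k\<in>?A. int_scale (Poly_Mapping.lookup c k) (f k))"
    if "Poly_Mapping.keys c \<subseteq> ?A" for c :: "'a \<Rightarrow>\<^sub>0 int"
    unfolding flin_def using that
    by (intro sum.mono_neutral_left) (auto simp: in_keys_iff)
  show "flin f (x + y) = flin f x + flin f y"
    using Poly_Mapping.keys_add[of x y]
    by (simp add: superset lookup_add int_scale_add sum.distrib)
qed

lemma flin_single [simp]: "flin f (Poly_Mapping.single k c) = int_scale c (f k)"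
  by (cases "c = 0") (simp_all add: flin_def)

definition ev :: "(int \<times> nat list \<Rightarrow>\<^sub>0 int) \<Rightarrow> fock" where
  "ev = flin (\<lambda>(m, lam). bvac m lam)"

lemma ev_eq: "ev c = (\<Sum>(m, lam)\<in>Poly_Mapping.keys c. int_scale (Poly_Mapping.lookup c (m, lam)) (bvac m lam))"
  by (simp add: ev_def flin_def case_prod_unfold)

lemma additive_ev: "additive ev"
  unfolding ev_def by (rule additive_flin)

lemma ev_single [simp]: "ev (Poly_Mapping.single (m, lam) 1) = bvac m lam"
  by (simp add: ev_def)

lemma int_scale_succ: "int_scale (c + 1) x = int_scale c x + x" "int_scale (c - 1) x = int_scale c x - x"
  using int_scale_add[of "c - 1" 1 x] by (simp_all add: int_scale_add)

lemma additive_int_scale_commute: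
  assumes "additive h"
  shows "h (int_scale c x) = int_scale c (h x)"
  by (induction c rule: int_induct[where k = 0])
    (simp_all add: int_scale_succ additive.add[OF assms] additive.diff[OF assms] additive.zero[OF assms])

text \<open>Partition vectors go to distinct basis vectors of \<open>maya\<close>, so every
  coordinate is the coefficient of the image at the corresponding index set.\<close>

lemma ev_inj:
  assumes "ev c = ev d" "Poly_Mapping.keys c \<subseteq> UNIV \<times> partitions" "Poly_Mapping.keys d \<subseteq> UNIV \<times> partitions"
  shows "c = d"
proof -
  obtain h :: "fock \<Rightarrow> maya" where h: "additive h"
    and h_word: "\<And>w k. h (wedge (bword w) (vac k)) = foldr maya_ins w (Poly_Mapping.single {..k} 1)"
    using maya_embedding by blast
  have h_bvac: "h (bvac m lam) = Poly_Mapping.single (range (bidx m lam)) 1"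
    if "lam \<in> partitions" for m lam
    unfolding bvac_def bvec_eq_bword h_word range_bidx
    by (rule foldr_maya_ins_decreasing) (use bidx_decreasing[OF that] in auto)
  have h_scale: "h (int_scale c x) = frag_cmul c (h x)" for c x
    by (induction c rule: int_induct[where k = 0])
      (simp_all add: int_scale_succ additive.add[OF h] additive.diff[OF h] additive.zero[OF h]
        frag_cmul_distrib frag_cmul_diff_distrib)
  have coeff: "Poly_Mapping.lookup c (m, lam) = Poly_Mapping.lookup (h (ev c)) (range (bidx m lam))"
    if c: "Poly_Mapping.keys c \<subseteq> UNIV \<times> partitions" and lam: "lam \<in> partitions" for c m lam
  proof -
    have "Poly_Mapping.lookup (h (ev c)) (range (bidx m lam)) =
        (\<Sum>(n, mu)\<in>Poly_Mapping.keys c. Poly_Mapping.lookup c (n, mu) *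
          Poly_Mapping.lookup (h (bvac n mu)) (range (bidx m lam)))"
      by (simp add: ev_eq additive.sum[OF h] case_prod_unfold lookup_sum h_scale)
    also have "\<dots> = (\<Sum>p\<in>Poly_Mapping.keys c. if p = (m, lam) then Poly_Mapping.lookup c (m, lam) else 0)"
    proof (rule sum.cong, safe)
      fix n mu assume "(n, mu) \<in> Poly_Mapping.keys c"
      then have "mu \<in> partitions"
        using c by auto
      then show "Poly_Mapping.lookup c (n, mu) * Poly_Mapping.lookup (h (bvac n mu)) (range (bidx m lam)) =
          (if (n, mu) = (m, lam) then Poly_Mapping.lookup c (m, lam) else 0)"
        using inj_bidx[OF _ lam, of mu n m] by (auto simp: h_bvac lookup_single when_def)
    qed
    also have "\<dots> = Poly_Mapping.lookup c (m, lam)"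
      by (auto simp: in_keys_iff)
    finally show ?thesis ..
  qed
  show ?thesis
  proof (rule poly_mapping_eqI, clarify)
    fix m lam
    show "Poly_Mapping.lookup c (m, lam) = Poly_Mapping.lookup d (m, lam)"
    proof (cases "lam \<in> partitions")
      case True
      then show ?thesis
        using coeff[OF assms(2)] coeff[OF assms(3)] assms(1) by simp
    next
      case False
      then show ?thesis
        using assms(2,3) by (metis (no_types, lifting) in_keys_iff mem_Sigma_iff subsetD)
    qed
  qed
qed

section \<open>Spanning by the partition vectors\<close>

definition bspan :: "fock set" where
  "bspan = {ev c | c. Poly_Mapping.keys c \<subseteq> UNIV \<times> partitions}"

lemma bspan_diff:
  assumes "x \<in> bspan" "y \<in> bspan"
  shows "x - y \<in> bspan"
proof -
  obtain c d where "x = ev c" "Poly_Mapping.keys c \<subseteq> UNIV \<times> partitions"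
    "y = ev d" "Poly_Mapping.keys d \<subseteq> UNIV \<times> partitions"
    using assms by (auto simp: bspan_def)
  then have "x - y = ev (c - d)" "Poly_Mapping.keys (c - d) \<subseteq> UNIV \<times> partitions"
    using Poly_Mapping.keys_diff[of c d] by (auto simp: additive.diff[OF additive_ev])
  then show ?thesis
    by (auto simp: bspan_def)
qed

lemma bspan_0: "0 \<in> bspan"
  unfolding bspan_def by (auto simp: ev_eq intro!: exI[of _ 0])

lemma bspan_uminus: "x \<in> bspan \<Longrightarrow> - x \<in> bspan"
  using bspan_diff[OF bspan_0] by simp

lemma bspan_bvac: "lam \<in> partitions \<Longrightarrow> bvac m lam \<in> bspan"
  unfolding bspan_def by (auto intro!: exI[of _ "Poly_Mapping.single (m, lam) 1"])

lemma decreasing_word_bspan: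
  assumes w: "sorted_wrt (>) w" "\<forall>i\<in>set w. k < i"
  shows "wedge (bword w) (vac k) \<in> bspan"
proof -
  \<comment> \<open>The charge is k plus the number of letters, and \<open>nu i\<close> is the
    excess of the i-th letter over its vacuum position m - i.\<close>
  define m where "m = k + int (length w)"
  define nu where "nu i = nat (w ! i - (m - int i))" for i
  have step: "w ! j + int (j - i) \<le> w ! i" if "i \<le> j" "j < length w" for i j
    using that
  proof (induction j rule: dec_induct)
    case (step j)
    then have "w ! Suc j < w ! j"
      using w(1) by (auto simp: sorted_wrt_iff_nth_less)
    with step show ?case by simp
  qed simp
  \<comment> \<open>Guards the truncation in \<open>nat\<close>: the last letter exceeds k, and each
    step to the left raises the letter by at least one.\<close>
  have ge: "m - int i \<le> w ! i" if "i < length w" for i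
  proof -
    have "k < w ! (length w - 1)"
      using that w(2) by (auto intro: nth_mem)
    moreover have "w ! (length w - 1) + int (length w - 1 - i) \<le> w ! i"
      using that by (intro step) auto
    ultimately show ?thesis
      using that by (simp add: m_def)
  qed
  have nu_mono: "nu j \<le> nu i" if "i \<le> j" "j < length w" for i j
    using step[OF that] that by (simp add: nu_def nat_mono)
  \<comment> \<open>Partitions have no zero entries; as \<open>nu\<close> is weakly decreasing, its
    zeros form the tail that is cut off here.\<close>
  define lam where "lam = takeWhile (\<lambda>x. x \<noteq> 0) (map nu [0..<length w])"
  have "sorted_wrt (\<ge>) (map nu [0..<length w])"
    by (auto simp: sorted_wrt_iff_nth_less nu_mono)
  then have lam: "lam \<in> partitions"
    by (auto simp: lam_def partitions_def dest: set_takeWhileD)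
  have len: "length lam \<le> length w"
    using length_takeWhile_le[of "\<lambda>x. x \<noteq> 0" "map nu [0..<length w]"] by (simp add: lam_def)
  have part: "part lam i = nu i" if "i < length w" for i
  proof (cases "i < length lam")
    case True
    then show ?thesis
      using that unfolding part_def lam_def by (simp add: takeWhile_nth)
  next
    case False
    then have "length lam < length w"
      using that by simp
    then have "nu (length lam) = 0"
      using nth_length_takeWhile[of "\<lambda>x. x \<noteq> 0" "map nu [0..<length w]"] by (simp add: lam_def)
    then show ?thesis
      using nu_mono[of "length lam" i] that False by (simp add: part_def)
  qed
  have "map (bidx m lam) [0..<length w] = w"
    by (rule nth_equalityI) (use ge part in \<open>auto simp: bidx_def nu_def\<close>)
  then have "wedge (bword w) (vac k) = bvac m lam"
    using bvac_eq[OF len, of m] by (simp add: bvec_eq_bword m_def)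
  then show ?thesis
    by (simp add: bspan_bvac lam)
qed

text \<open>Insertion sort: b_i moves right past larger letters, each time with a sign, and dies on
  meeting an equal one. The bound on \<open>set w'\<close> keeps all letters above k, as
  \<open>decreasing_word_bspan\<close> demands.\<close>

lemma wedge_bas_decreasing_word:
  assumes "sorted_wrt (>) w" "\<forall>i\<in>set w. k < i" "k < i"
  shows "\<exists>w'. sorted_wrt (>) w' \<and> set w' \<subseteq> insert i (set w) \<and> wedge (bas i) (wedge (bword w) x) \<in>
    {0, wedge (bword w') x, - wedge (bword w') x}"
  using assms
proof (induction w)
  case Nil
  then show ?case
    by (intro exI[of _ "[i]"]) (simp add: bword_Cons)
next
  case (Cons a w)
  consider "a < i" | "a = i" | "i < a"
    by linarith
  then show ?case
  proof cases
    case 1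
    with Cons.prems show ?thesis
      by (intro exI[of _ "i # a # w"]) (auto simp: bword_Cons wedge_mult)
  next
    case 2
    then show ?thesis
      by (intro exI[of _ "[]"]) (simp add: bword_Cons wedge_mult)
  next
    case 3
    obtain w' where w': "sorted_wrt (>) w'" "set w' \<subseteq> insert i (set w)"
      "wedge (bas i) (wedge (bword w) x) \<in> {0, wedge (bword w') x, - wedge (bword w') x}"
      using Cons by auto
    with 3 Cons.prems show ?thesis
      by (intro exI[of _ "a # w'"])
        (auto simp: bword_Cons wedge_mult wedge_bas_swap[of i a] wedge_uminus_right)
  qed
qed

lemma wedge_bas_word_eq_0: "wedge (bas i) x = 0 \<Longrightarrow> wedge (bas i) (wedge (bword w) x) = 0"
  by (induction w) (simp_all add: bword_Cons wedge_mult wedge_bas_swap[of i])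

lemma wedge_bas_bvac_bspan:
  assumes "lam \<in> partitions"
  shows "wedge (bas i) (bvac m lam) \<in> bspan"
proof -
  let ?w = "map (bidx m lam) [0..<length lam]" and ?k = "m - int (length lam)"
  note w = bidx_decreasing[OF assms, of m "length lam"]
  have bvac: "bvac m lam = wedge (bword ?w) (vac ?k)"
    by (simp add: bvac_def bvec_eq_bword)
  show ?thesis
  proof (cases "i \<le> ?k")
    case True
    then show ?thesis
      by (simp add: bvac wedge_bas_word_eq_0 bspan_0)
  next
    case False
    then obtain w' where "sorted_wrt (>) w'" "set w' \<subseteq> insert i (set ?w)"
      and *: "wedge (bas i) (wedge (bword ?w) (vac ?k)) \<in>
        {0, wedge (bword w') (vac ?k), - wedge (bword w') (vac ?k)}"
      using wedge_bas_decreasing_word[OF w, of i "vac ?k"] by auto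
    moreover from this have "wedge (bword w') (vac ?k) \<in> bspan"
      using w(2) False by (intro decreasing_word_bspan) auto
    ultimately show ?thesis
      by (auto simp: bvac bspan_0 bspan_uminus)
  qed
qed

text \<open>Stated relative to \<open>bspan\<close> because it serves in the proof that
  \<open>bspan\<close> is everything; afterwards it becomes \<open>bvac_induct\<close>.\<close>

lemma bvac_span_induct [consumes 1, case_names bvac diff]:
  assumes x: "x \<in> bspan" and bvac: "\<And>m lam. lam \<in> partitions \<Longrightarrow> P (bvac m lam)"
    and diff: "\<And>x y. P x \<Longrightarrow> P y \<Longrightarrow> P (x - y)"
  shows "P x"
proof -
  have [simp]: "[] \<in> partitions"
    by (simp add: partitions_def)
  have 0: "P 0"
    using diff[OF bvac bvac, of "[]" "[]" 0 0] by simp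
  have add: "P (x + y)" if "P x" "P y" for x y
    using diff[OF that(1) diff[OF 0 that(2)]] by simp
  have scale: "P (int_scale c (bvac m lam))" if "lam \<in> partitions" for c m lam
    by (induction c rule: int_induct[where k = 0])
      (auto simp: 0 int_scale_succ intro!: add diff bvac that)
  obtain c where c: "x = ev c" "Poly_Mapping.keys c \<subseteq> UNIV \<times> partitions"
    using x by (auto simp: bspan_def)
  have "P (\<Sum>(m, lam)\<in>A. int_scale (Poly_Mapping.lookup c (m, lam)) (bvac m lam))"
    if "finite A" "A \<subseteq> UNIV \<times> partitions" for A
    using that by (induction A) (auto simp: 0 intro!: add scale)
  from this[OF _ c(2)] show ?thesis
    by (simp add: c(1) ev_eq)
qed

lemma bvac_Nil [simp]: "bvac m [] = vac m"
  by (simp add: bvac_def bvec_def)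

lemma bspan_UNIV: "x \<in> bspan"
proof (induction x rule: fock_induct)
  case (vac m)
  then show ?case
    using bspan_bvac[of "[]" m] by (simp add: partitions_def)
next
  case (bas k x)
  from bas show ?case
    by (induction x rule: bvac_span_induct) (auto simp: wedge_diff_right wedge_bas_bvac_bspan bspan_diff)
qed (rule bspan_diff)

lemmas bvac_induct [case_names bvac diff] = bvac_span_induct[OF bspan_UNIV]

text \<open>The bridge from coordinates to additive maps: an operator given on partition vectors
  through \<open>lin_ext\<close> is identified with a map obtained from
  \<open>fock_lift\<close>.\<close>

lemma lin_ext_additive:
  assumes h: "additive h" and g: "\<And>m lam. lam \<in> partitions \<Longrightarrow> g m lam = h (bvac m lam)"
  shows "lin_ext g u = h u"
proof -
  obtain c where c: "u = ev c" "Poly_Mapping.keys c \<subseteq> UNIV \<times> partitions"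
    using bspan_UNIV[of u] by (auto simp: bspan_def)
  have "coords u = c"
    unfolding coords_def ev_eq[symmetric]
    by (rule the_equality) (use c ev_inj in auto)
  then show ?thesis
    using c(2) by (auto simp: lin_ext_def c(1) ev_eq additive.sum[OF h] g
        additive_int_scale_commute[OF h] intro!: sum.cong)
qed

section \<open>Extending Hasse-Schmidt derivations to the Fock space\<close>

lemma fps_wedge_nth: "fps_wedge U X $ n = (\<Sum>i=0..n. wedge (U $ i) (X $ (n - i)))"
  by (simp add: fps_wedge_def)

lemma fps_wedge_assoc: "fps_wedge (U * W) X = fps_wedge U (fps_wedge W X)"
proof (rule fps_ext)
  fix n
  have "fps_wedge (U * W) X $ n =
      (\<Sum>j=0..n. \<Sum>i=0..j. wedge (U $ i) (wedge (W $ (j - i)) (X $ (n - j))))"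
    by (simp add: fps_wedge_nth fps_mult_nth wedge_sum_left wedge_mult)
  also have "\<dots> = (\<Sum>j=0..n. \<Sum>i=0..n - j. wedge (U $ j) (wedge (W $ i) (X $ (n - j - i))))"
    by (rule fps_mult_assoc_lemma)
  finally show "fps_wedge (U * W) X $ n = fps_wedge U (fps_wedge W X) $ n"
    by (simp add: fps_wedge_nth wedge_sum_right)
qed

lemma additive_fps_wedge_left: "additive (\<lambda>U. fps_wedge U X)"
  by (auto simp: additive_def fps_eq_iff fps_wedge_nth wedge_add_left sum.distrib)

lemma additive_fps_wedge_right: "additive (fps_wedge U)"
  by (auto simp: additive_def fps_eq_iff fps_wedge_nth wedge_add_right sum.distrib)

lemma fps_wedge_one: "fps_wedge 1 X = X"
proof (rule fps_ext)
  fix n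
  have "fps_wedge 1 X $ n = (\<Sum>i=0..n. if i = 0 then X $ n else 0)"
    unfolding fps_wedge_nth by (intro sum.cong) auto
  then show "fps_wedge 1 X $ n = X $ n"
    by simp
qed

text \<open>The vacuum values need only respect the two relations of W. Then
  \<open>fock_lift\<close> gives an additive map that agrees with \<open>extend_fock T V\<close> on
  partition vectors and is multiplicative for every left factor.\<close>

lemma extend_fock:
  assumes T: "HS_derivation T" "T 1 = 1"
    and absorb: "\<And>m. fps_wedge (T (bas m)) (V (m - 1)) = V m"
    and vanish: "\<And>m. fps_wedge (T (bas m)) (V m) = 0"
  shows "additive (extend_fock T V)"
    and "extend_fock T V (wedge u x) = fps_wedge (T u) (extend_fock T V x)"
    and "extend_fock T V (vac m) = V m"
proof -
  have T_mult: "T (u * v) = T u * T v" and T_add: "T (u + v) = T u + T v" for u v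
    using T(1) by (auto simp: HS_derivation_def)
  note zero = additive.zero[OF additive_fps_wedge_right]
  obtain h where h: "additive h" and h_vac: "\<And>m u. h (wedge u (vac m)) = fps_wedge (T u) (V m)"
  proof (rule fock_lift[where \<phi> = "\<lambda>m u. fps_wedge (T u) (V m)"])
    show "additive (\<lambda>u. fps_wedge (T u) (V m))" for m
      by (simp add: additive_def T_add additive.add[OF additive_fps_wedge_left])
  qed (auto simp: T_mult fps_wedge_assoc absorb vanish zero)
  have h_wedge: "h (wedge u x) = fps_wedge (T u) (h x)" for u x
  proof (induction x arbitrary: u rule: fock_induct)
    case (vac m)
    then show ?case
      using h_vac[of 1 m] by (simp add: h_vac T(2) fps_wedge_one)
  next
    case (bas k x)
    then show ?case
      by (metis T_mult fps_wedge_assoc wedge_mult)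
  next
    case (diff x y)
    then show ?case
      by (simp add: wedge_diff_right additive.diff[OF h] additive.diff[OF additive_fps_wedge_right])
  qed
  have "extend_fock T V u = h u" for u
  proof (rule fps_ext)
    fix n
    have "additive (\<lambda>u. h u $ n)"
      by (simp add: additive_def additive.add[OF h])
    then have "lin_ext (\<lambda>m lam. fps_wedge (T (bvec (length lam) m lam)) (V (m - int (length lam))) $ n) u =
        h u $ n"
      by (rule lin_ext_additive) (simp add: bvac_def h_vac)
    then show "extend_fock T V u $ n = h u $ n"
      by (simp add: extend_fock_def)
  qed
  then have *: "extend_fock T V = h"
    by auto
  show "additive (extend_fock T V)" "extend_fock T V (wedge u x) = fps_wedge (T u) (extend_fock T V x)"
    unfolding * by (fact h, fact h_wedge)
  show "extend_fock T V (vac m) = V m"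
    unfolding * using h_vac[of 1 m] by (simp add: T(2) fps_wedge_one)
qed

text \<open>A coefficient of the square of sigma_+(z) b_a, which vanishes because the coefficients
  of this series anticommute and square to zero.\<close>

lemma sum_wedge_bas_bas: "(\<Sum>i=0..n. wedge (bas (a + int i)) (wedge (bas (a + int (n - i))) x)) = 0"
proof -
  have "bas i * bas j + bas j * bas i = 0" for i j
    by (metis incl_anticommute incl_bM)
  then have "(\<Sum>i=0..n. bas (a + int (0 + i)) * bas (a + int (0 + n - i))) = 0"
    by (intro sum_anticommuting_eq_0) simp_all
  then show ?thesis
    by (simp flip: wedge_mult wedge_sum_left)
qed

lemma HS_sigma_ext:
  "HS_derivation sigma_p_ext" "HS_derivation sigma_m_ext"
  "HS_derivation sigma_bar_p_ext" "HS_derivation sigma_bar_m_ext"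
  "sigma_p_ext 1 = 1" "sigma_m_ext 1 = 1" "sigma_bar_p_ext 1 = 1" "sigma_bar_m_ext 1 = 1"
  by (simp_all add: sigma_p_ext_def sigma_m_ext_def sigma_bar_p_ext_def sigma_bar_m_ext_def HS_derivation_hs)

lemma fps_wedge_const: "fps_wedge U (fps_const x) $ n = wedge (U $ n) x"
proof -
  have "fps_wedge U (fps_const x) $ n = (\<Sum>i=0..n. if i = n then wedge (U $ n) x else 0)"
    unfolding fps_wedge_nth by (intro sum.cong) auto
  then show ?thesis by simp
qed

lemma fps_wedge_linear:
  assumes "\<And>n. U $ n = (if n = 0 then a else if n = 1 then b else 0)"
  shows "fps_wedge U X $ n = wedge a (X $ n) + (if n = 0 then 0 else wedge b (X $ (n - 1)))"
proof (cases n)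
  case 0
  then show ?thesis by (simp add: fps_wedge_nth assms)
next
  case (Suc k)
  have "fps_wedge U X $ n = wedge (U $ 0) (X $ n) + (\<Sum>i=0..k. wedge (U $ Suc i) (X $ (k - i)))"
    unfolding fps_wedge_nth Suc by (subst sum.atLeast0_atMost_Suc_shift) simp
  also have "(\<Sum>i=0..k. wedge (U $ Suc i) (X $ (k - i))) = (\<Sum>i=0..k. if i = 0 then wedge b (X $ k) else 0)"
    by (intro sum.cong) (auto simp: assms)
  finally show ?thesis
    by (simp add: Suc assms)
qed

text \<open>Peeling off the first factor of a column leaves a shorter column at charge m - 1. This
  turns the alternating sum defining \<open>sigma_bar_p\<close> on vacua into a one-step
  recursion.\<close>

lemma bvac_replicate_Suc:
  "bvac m (replicate (Suc j) 1) = wedge (bas (m + 1)) (bvac (m - 1) (replicate j 1))"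
proof -
  have "map (bidx m (replicate (Suc j) 1)) [0..<Suc j] =
      (m + 1) # map (bidx (m - 1) (replicate j 1)) [0..<j]"
    by (intro nth_equalityI) (auto simp: bidx_def part_def nth_Cons' simp del: upt_Suc)
  then show ?thesis
    by (simp add: bvac_def bvec_eq_bword bword_Cons wedge_mult algebra_simps del: upt_Suc replicate_Suc)
qed

lemma sigma_p:
  "additive sigma_p" "sigma_p (wedge u x) = fps_wedge (sigma_p_ext u) (sigma_p x)"
  "sigma_p (vac m) = fps_wedge (sigma_p_ext (bas m)) (fps_const (vac (m - 1)))"
proof -
  let ?V = "\<lambda>m. fps_wedge (sigma_p_ext (bas m)) (fps_const (vac (m - 1)))"
  have 1: "fps_wedge (sigma_p_ext (bas m)) (?V (m - 1)) = ?V m" for m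
  proof (rule fps_ext)
    fix n
    show "fps_wedge (sigma_p_ext (bas m)) (?V (m - 1)) $ n = ?V m $ n"
    proof (cases n)
      case 0
      then show ?thesis
        by (simp add: fps_wedge_const sigma_ext_bas fps_wedge_nth[of _ "fps_wedge _ _"] wedge_bas_vac_pred)
    next
      case (Suc k)
      \<comment> \<open>Since sigma_+(z) b_(m-1) = b_(m-1) + z sigma_+(z) b_m, all terms but the
        last form a coefficient of the square of sigma_+(z) b_m.\<close>
      have "(\<Sum>i=0..k. wedge (bas (m + int i)) (wedge (bas (m - 1 + int (n - i))) (vac (m - 2)))) =
          (\<Sum>i=0..k. wedge (bas (m + int i)) (wedge (bas (m + int (k - i))) (vac (m - 2))))"
        by (intro sum.cong) (auto simp: Suc of_nat_diff algebra_simps)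
      also have "\<dots> = 0"
        by (rule sum_wedge_bas_bas)
      finally have *: "(\<Sum>i=0..k. wedge (bas (m + int i)) (wedge (bas (m - 1 + int (n - i))) (vac (m - 2)))) = 0" .
      have "fps_wedge (sigma_p_ext (bas m)) (?V (m - 1)) $ n =
          (\<Sum>i=0..Suc k. wedge (bas (m + int i)) (wedge (bas (m - 1 + int (n - i))) (vac (m - 2))))"
        by (simp add: fps_wedge_const sigma_ext_bas fps_wedge_nth[of _ "fps_wedge _ _"] Suc del: sum.atLeast0_atMost_Suc)
      also have "\<dots> = wedge (bas (m + int n)) (wedge (bas (m - 1)) (vac (m - 2)))"
        unfolding sum.atLeast0_atMost_Suc * by (simp add: Suc)
      finally show ?thesis
        by (simp add: fps_wedge_const sigma_ext_bas wedge_bas_vac_pred)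
    qed
  qed
  have 2: "fps_wedge (sigma_p_ext (bas m)) (?V m) = 0" for m
    using sum_wedge_bas_bas[of m _ "vac (m - 1)"]
    by (intro fps_ext) (simp add: fps_wedge_const sigma_ext_bas fps_wedge_nth[of _ "fps_wedge _ _"])
  show "additive sigma_p" "sigma_p (wedge u x) = fps_wedge (sigma_p_ext u) (sigma_p x)"
    "sigma_p (vac m) = fps_wedge (sigma_p_ext (bas m)) (fps_const (vac (m - 1)))"
    unfolding sigma_p_def by (intro extend_fock HS_sigma_ext 1 2)+
qed

lemma sigma_m:
  "additive sigma_m" "sigma_m (wedge u x) = fps_wedge (sigma_m_ext u) (sigma_m x)"
  "sigma_m (vac m) = fps_const (vac m)"
proof -
  have 1: "fps_wedge (sigma_m_ext (bas m)) (fps_const (vac (m - 1))) = fps_const (vac m)" for m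
    by (rule fps_ext) (simp add: fps_wedge_const sigma_ext_bas wedge_bas_vac_pred)
  have 2: "fps_wedge (sigma_m_ext (bas m)) (fps_const (vac m)) = 0" for m
    by (rule fps_ext) (simp add: fps_wedge_const sigma_ext_bas)
  show "additive sigma_m" "sigma_m (wedge u x) = fps_wedge (sigma_m_ext u) (sigma_m x)"
    "sigma_m (vac m) = fps_const (vac m)"
    unfolding sigma_m_def by (rule extend_fock[OF HS_sigma_ext(2,6) 1 2])+
qed

lemma sigma_bar_m:
  "additive sigma_bar_m" "sigma_bar_m (wedge u x) = fps_wedge (sigma_bar_m_ext u) (sigma_bar_m x)"
  "sigma_bar_m (vac m) = fps_const (vac m)"
proof -
  have 1: "fps_wedge (sigma_bar_m_ext (bas m)) (fps_const (vac (m - 1))) = fps_const (vac m)" for m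
    by (rule fps_ext) (simp add: fps_wedge_const sigma_ext_bas wedge_bas_vac_pred wedge_uminus_left)
  have 2: "fps_wedge (sigma_bar_m_ext (bas m)) (fps_const (vac m)) = 0" for m
    by (rule fps_ext) (simp add: fps_wedge_const sigma_ext_bas wedge_uminus_left)
  show "additive sigma_bar_m" "sigma_bar_m (wedge u x) = fps_wedge (sigma_bar_m_ext u) (sigma_bar_m x)"
    "sigma_bar_m (vac m) = fps_const (vac m)"
    unfolding sigma_bar_m_def by (rule extend_fock[OF HS_sigma_ext(4,8) 1 2])+
qed

lemma sigma_bar_p:
  "additive sigma_bar_p" "sigma_bar_p (wedge u x) = fps_wedge (sigma_bar_p_ext u) (sigma_bar_p x)"
  "sigma_bar_p (vac m) $ 0 = vac m"
  "sigma_bar_p (vac m) $ Suc n = - wedge (bas (m + 1)) (sigma_bar_p (vac (m - 1)) $ n)"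
proof -
  define V where "V = (\<lambda>m. Abs_fps (\<lambda>j. int_scale ((- 1) ^ j) (bvac m (replicate j 1))))"
  have V0: "V m $ 0 = vac m" for m
    by (simp add: V_def)
  have V_Suc: "V m $ Suc n = - wedge (bas (m + 1)) (V (m - 1) $ n)" for m n
    by (simp add: V_def bvac_replicate_Suc[unfolded One_nat_def] int_scale_uminus additive_int_scale_commute[OF additive_wedge]
        del: replicate_Suc)
  have V: "fps_wedge (sigma_bar_p_ext (bas m)) X $ n =
      wedge (bas m) (X $ n) + (if n = 0 then 0 else wedge (- bas (m + 1)) (X $ (n - 1)))" for m n X
    by (rule fps_wedge_linear) (simp add: sigma_ext_bas)
  have 1: "fps_wedge (sigma_bar_p_ext (bas m)) (V (m - 1)) = V m" for m
  proof (rule fps_ext)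
    fix n show "fps_wedge (sigma_bar_p_ext (bas m)) (V (m - 1)) $ n = V m $ n"
      by (cases n) (simp_all add: V V0 V_Suc wedge_bas_vac_pred wedge_uminus_left wedge_uminus_right)
  qed
  have 2: "fps_wedge (sigma_bar_p_ext (bas m)) (V m) = 0" for m
  proof (rule fps_ext)
    fix n
    \<comment> \<open>Only at n = 1 do two nonzero terms cancel, by swapping b_m and b_(m+1); from n
      = 2 on each term contains a repeated factor.\<close>
    consider "n = 0" | "n = Suc 0" | k where "n = Suc (Suc k)"
      by (metis not0_implies_Suc)
    then show "fps_wedge (sigma_bar_p_ext (bas m)) (V m) $ n = 0 $ n"
      by cases (simp_all add: V V0 V_Suc wedge_uminus_left wedge_uminus_right
        wedge_bas_swap[of m "m + 1"] wedge_bas_vac_pred)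
  qed
  have sbp: "sigma_bar_p = extend_fock sigma_bar_p_ext V"
    by (simp only: sigma_bar_p_def V_def)
  note e = extend_fock[OF HS_sigma_ext(3,7) 1 2, folded sbp]
  show "additive sigma_bar_p" "sigma_bar_p (wedge u x) = fps_wedge (sigma_bar_p_ext u) (sigma_bar_p x)"
    by (rule e)+
  show "sigma_bar_p (vac m) $ 0 = vac m"
    "sigma_bar_p (vac m) $ Suc n = - wedge (bas (m + 1)) (sigma_bar_p (vac (m - 1)) $ n)"
    by (simp_all add: e V0 V_Suc)
qed

text \<open>
  Coefficients are indexed by integers, vanishing at the negative ones, so that all recursions
  below hold without side conditions.
\<close>

definition cf :: "(fock \<Rightarrow> fock fps) \<Rightarrow> int \<Rightarrow> fock \<Rightarrow> fock" where
  "cf \<tau> n x = (if n < 0 then 0 else \<tau> x $ nat n)"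

abbreviation "sp \<equiv> cf sigma_p"
abbreviation "sm \<equiv> cf sigma_m"
abbreviation "sbp \<equiv> cf sigma_bar_p"
abbreviation "sbm \<equiv> cf sigma_bar_m"

lemma cf_neg [simp]: "n < 0 \<Longrightarrow> cf \<tau> n x = 0"
  by (simp add: cf_def)

lemma additive_cf: "additive \<tau> \<Longrightarrow> additive (cf \<tau> n)"
  by (simp add: additive_def cf_def)

lemmas additive_sp = additive_cf[OF sigma_p(1)]
lemmas additive_sm = additive_cf[OF sigma_m(1)]
lemmas additive_sbp = additive_cf[OF sigma_bar_p(1)]
lemmas additive_sbm = additive_cf[OF sigma_bar_m(1)]

lemmas cf_zero [simp] = additive.zero[OF additive_sp] additive.zero[OF additive_sm]
  additive.zero[OF additive_sbp] additive.zero[OF additive_sbm]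
lemmas cf_add = additive.add[OF additive_sp] additive.add[OF additive_sm]
  additive.add[OF additive_sbp] additive.add[OF additive_sbm]
lemmas cf_diff = additive.diff[OF additive_sp] additive.diff[OF additive_sm]
  additive.diff[OF additive_sbp] additive.diff[OF additive_sbm]
lemmas cf_uminus = additive.minus[OF additive_sp] additive.minus[OF additive_sm]
  additive.minus[OF additive_sbp] additive.minus[OF additive_sbm]

text \<open>Splitting off the constant term of the geometric series at b_k leaves the same series
  started at b_(k+e), times one power of the variable.\<close>

lemma cf_geometric:
  assumes "\<And>u x. \<tau> (wedge u x) = fps_wedge (T u) (\<tau> x)" "\<And>j n. T (bas j) $ n = bas (j + e * int n)"
  shows "cf \<tau> n (wedge (bas k) x) = wedge (bas k) (cf \<tau> n x) + cf \<tau> (n - 1) (wedge (bas (k + e)) x)"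
proof -
  consider "n < 0" | "n = 0" | i where "n = int (Suc i)"
    by (metis int_cases2 linorder_neqE_linordered_idom nat_less_le not_less of_nat_0_less_iff zero_less_imp_eq_int gr0_implies_Suc)
  then show ?thesis
  proof cases
    case 3
    have "\<tau> (wedge (bas k) x) $ Suc i = wedge (bas k) (\<tau> x $ Suc i) +
        (\<Sum>l=0..i. wedge (bas (k + e * int (Suc l))) (\<tau> x $ (i - l)))"
      unfolding assms(1) fps_wedge_nth by (subst sum.atLeast0_atMost_Suc_shift) (simp add: assms(2))
    also have "(\<Sum>l=0..i. wedge (bas (k + e * int (Suc l))) (\<tau> x $ (i - l))) =
        \<tau> (wedge (bas (k + e)) x) $ i"
      unfolding assms(1) fps_wedge_nth by (simp add: assms(2) algebra_simps)
    finally show ?thesis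
      by (simp add: cf_def 3 nat_add_distrib)
  qed (simp_all add: cf_def assms(1) fps_wedge_nth assms(2))
qed

lemma cf_linear:
  assumes "\<And>u x. \<tau> (wedge u x) = fps_wedge (T u) (\<tau> x)"
    "\<And>n. T (bas k) $ n = (if n = 0 then bas k else if n = 1 then - bas l else 0)"
  shows "cf \<tau> n (wedge (bas k) x) = wedge (bas k) (cf \<tau> n x) - wedge (bas l) (cf \<tau> (n - 1) x)"
  unfolding cf_def assms(1) fps_wedge_linear[of "T (bas k)", OF assms(2)]
  by (auto simp: wedge_uminus_left nat_diff_distrib)

lemma sp_bas: "sp n (wedge (bas k) x) = wedge (bas k) (sp n x) + sp (n - 1) (wedge (bas (k + 1)) x)"
  by (rule cf_geometric[OF sigma_p(2)]) (simp add: sigma_ext_bas)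

lemma sm_bas: "sm n (wedge (bas k) x) = wedge (bas k) (sm n x) + sm (n - 1) (wedge (bas (k - 1)) x)"
proof -
  have "sm n (wedge (bas k) x) = wedge (bas k) (sm n x) + sm (n - 1) (wedge (bas (k + - 1)) x)"
    by (rule cf_geometric[OF sigma_m(2)]) (simp add: sigma_ext_bas)
  then show ?thesis by simp
qed

lemma sbp_bas: "sbp n (wedge (bas k) x) = wedge (bas k) (sbp n x) - wedge (bas (k + 1)) (sbp (n - 1) x)"
  by (rule cf_linear[OF sigma_bar_p(2)]) (simp add: sigma_ext_bas)

lemma sbm_bas: "sbm n (wedge (bas k) x) = wedge (bas k) (sbm n x) - wedge (bas (k - 1)) (sbm (n - 1) x)"
  by (rule cf_linear[OF sigma_bar_m(2)]) (simp add: sigma_ext_bas)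

text \<open>Valid also for negative n, where b_(m+n) is already a factor of
  \<open>vac (m - 1)\<close>.\<close>

lemma sp_vac: "sp n (vac m) = wedge (bas (m + n)) (vac (m - 1))"
  by (simp add: cf_def sigma_p(3) fps_wedge_const sigma_ext_bas)

lemma sm_vac: "sm n (vac m) = (if n = 0 then vac m else 0)"
  by (auto simp: cf_def sigma_m(3))

lemma sbm_vac: "sbm n (vac m) = (if n = 0 then vac m else 0)"
  by (auto simp: cf_def sigma_bar_m(3))

lemma sbp_vac_0: "sbp 0 (vac m) = vac m"
  by (simp add: cf_def sigma_bar_p(3))

lemma sbp_vac: "n \<noteq> 0 \<Longrightarrow> sbp n (vac m) = - wedge (bas (m + 1)) (sbp (n - 1) (vac (m - 1)))"
  using sigma_bar_p(4)[of m "nat n - 1"] by (auto simp: cf_def nat_diff_distrib)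

lemma wedge_bas_eventually_0: "\<exists>J. \<forall>j\<le>J. wedge (bas j) x = 0"
proof (induction x rule: fock_induct)
  case (vac m)
  then show ?case by (meson wedge_bas_vac_le)
next
  case (bas k x)
  then show ?case by (metis wedge_bas_swap wedge_zero_right neg_equal_0_iff_equal)
next
  case (diff x y)
  then obtain J K where "\<forall>j\<le>J. wedge (bas j) x = 0" "\<forall>j\<le>K. wedge (bas j) y = 0"
    by auto
  then show ?case
    by (intro exI[of _ "min J K"]) (simp add: wedge_diff_right)
qed

lemma sbm_eventually_0: "\<exists>N. \<forall>n\<ge>N. sbm n x = 0"
proof (induction x rule: fock_induct)
  case (vac m)
  then show ?case by (intro exI[of _ 1]) (simp add: sbm_vac)
next
  case (bas k x)
  then obtain N where "\<forall>n\<ge>N. sbm n x = 0" ..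
  then show ?case by (intro exI[of _ "N + 1"]) (simp add: sbm_bas)
next
  case (diff x y)
  then obtain J K where "\<forall>j\<ge>J. sbm j x = 0" "\<forall>j\<ge>K. sbm j y = 0"
    by auto
  then show ?case
    by (intro exI[of _ "max J K"]) (simp add: cf_diff)
qed

text \<open>Beyond the bound for x the recursion for b_k loses its first term and merely trades n
  for n - 1 and k for k - 1. After enough steps the lowered index annihilates x.\<close>

lemma sm_eventually_0: "\<exists>N. \<forall>n\<ge>N. sm n x = 0"
proof (induction x rule: fock_induct)
  case (vac m)
  then show ?case by (intro exI[of _ 1]) (simp add: sm_vac)
next
  case (bas k x)
  then obtain N where N: "\<forall>n\<ge>N. sm n x = 0" ..
  obtain J where J: "\<forall>j\<le>J. wedge (bas j) x = 0"
    using wedge_bas_eventually_0 by blast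
  have shift: "n \<ge> N \<Longrightarrow> sm (n + int t) (wedge (bas k) x) = sm n (wedge (bas (k - int t)) x)" for n t
  proof (induction t arbitrary: n)
    case (Suc t)
    from Suc.IH[of "n + 1"] Suc.prems have "sm (n + 1 + int t) (wedge (bas k) x) =
        sm (n + 1) (wedge (bas (k - int t)) x)"
      by simp
    also have "\<dots> = sm n (wedge (bas (k - int t - 1)) x)"
      using N Suc.prems by (simp add: sm_bas[of "n + 1"])
    finally show ?case
      by (simp add: algebra_simps)
  qed simp
  show ?case
  proof (intro exI allI impI)
    fix n assume n: "n \<ge> N + int (nat (k - J))"
    have "sm n (wedge (bas k) x) = sm (n - int (nat (k - J))) (wedge (bas (k - int (nat (k - J)))) x)"
      using shift[of "n - int (nat (k - J))" "nat (k - J)"] n by simp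
    then show "sm n (wedge (bas k) x) = 0"
      using J by simp
  qed
next
  case (diff x y)
  then obtain J K where "\<forall>j\<ge>J. sm j x = 0" "\<forall>j\<ge>K. sm j y = 0"
    by auto
  then show ?case
    by (intro exI[of _ "max J K"]) (simp add: cf_diff)
qed

lemma finite_support_cf:
  assumes "\<exists>N. \<forall>n\<ge>N. cf \<tau> n x = 0"
  shows "finite {n. cf \<tau> n x \<noteq> 0}"
proof -
  obtain N where "\<forall>n\<ge>N. cf \<tau> n x = 0"
    using assms ..
  then have "{n. cf \<tau> n x \<noteq> 0} \<subseteq> {0..N}"
    by (auto simp: not_less) (meson cf_neg not_less, meson linear)
  then show ?thesis
    by (rule finite_subset) simp
qed

lemmas finite_sm = finite_support_cf[OF sm_eventually_0]
lemmas finite_sbm = finite_support_cf[OF sbm_eventually_0]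

section \<open>The action of matrices\<close>

lemma additive_delta_ext: "additive (delta_ext A)"
  by (simp add: additive_def delta_ext_add)

text \<open>The values \<open>d m\<close> on the vacua respect the relations of W, so
  \<open>fock_lift\<close> gives the derivation. By \<open>delta_fock_indep\<close> they may be
  computed with any sufficiently large number of factors.\<close>

lemma delta_fock:
  "additive (delta_fock A)"
  "delta_fock A (wedge u x) = wedge (delta_ext A u) x + wedge u (delta_fock A x)"
  "m < Min (snd ` Poly_Mapping.keys A) \<Longrightarrow> delta_fock A (vac m) = 0"
proof -
  define d where "d m = wedge (delta_ext A (bvec (delta_len A m []) m [])) (vac (m - int (delta_len A m [])))" for m
  have d: "d m = wedge (delta_ext A (bvec r m [])) (vac (m - int r))" if "delta_len A m [] \<le> r" for m r
    unfolding d_def by (rule delta_fock_indep[OF that, symmetric])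
  have bvec_vac: "wedge (bvec r m []) (vac (m - int r)) = vac m" for r m
    using bvac_eq[of "[]" r m] by simp
  have bvec_Suc_left: "bvec (Suc r) m [] = bas m * bvec r (m - 1) []" for r m
  proof -
    have "map (bidx m []) [0..<Suc r] = m # map (bidx (m - 1) []) [0..<r]"
      by (intro nth_equalityI) (auto simp: bidx_def part_def nth_Cons' simp del: upt_Suc)
    then show ?thesis
      by (simp only: bvec_eq_bword bword_Cons)
  qed
  have absorb: "d m = wedge (delta_ext A (bas m)) (vac (m - 1)) + wedge (bas m) (d (m - 1))" for m
  proof -
    \<comment> \<open>\<open>Suc r\<close> factors starting at m are b_m followed by
      \<open>r\<close> factors starting at m - 1; the maximum makes both counts admissible.\<close>
    define r where "r = max (delta_len A m []) (delta_len A (m - 1) [])"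
    have "d m = wedge (delta_ext A (bas m * bvec r (m - 1) [])) (vac (m - 1 - int r))"
      using d[of m "Suc r"] by (simp add: r_def bvec_Suc_left algebra_simps)
    also have "\<dots> = wedge (delta_ext A (bas m)) (vac (m - 1)) + wedge (bas m) (d (m - 1))"
      using d[of "m - 1" r] by (simp add: r_def delta_ext_mult wedge_add_left wedge_mult bvec_vac)
    finally show ?thesis .
  qed
  have vanish: "wedge (delta_ext A (bas m)) (vac m) + wedge (bas m) (d m) = 0" for m
  proof -
    define r where "r = delta_len A m []"
    have "bas m * bvec (Suc r) m [] = 0"
      by (simp add: bvec_Suc_left flip: mult.assoc)
    then have "0 = wedge (delta_ext A (bas m * bvec (Suc r) m [])) (vac (m - int (Suc r)))"
      by (simp only: additive.zero[OF additive_delta_ext] wedge_zero_left)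
    also have "\<dots> = wedge (delta_ext A (bas m)) (vac m) + wedge (bas m) (d m)"
      using d[of m "Suc r"] by (simp only: r_def delta_ext_mult wedge_add_left wedge_mult bvec_vac le_SucI order_refl)
    finally show ?thesis ..
  qed
  obtain h where h: "additive h"
    and h_vac: "\<And>m u. h (wedge u (vac m)) = wedge (delta_ext A u) (vac m) + wedge u (d m)"
  proof (rule fock_lift[where \<phi> = "\<lambda>m u. wedge (delta_ext A u) (vac m) + wedge u (d m)"])
    show "additive (\<lambda>u. wedge (delta_ext A u) (vac m) + wedge u (d m))" for m
      by (simp add: additive_def delta_ext_add wedge_add_left)
    show "wedge (delta_ext A (u * bas m)) (vac (m - 1)) + wedge (u * bas m) (d (m - 1)) =
        wedge (delta_ext A u) (vac m) + wedge u (d m)" for m u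
      by (simp add: absorb[of m] delta_ext_mult wedge_add_left wedge_add_right wedge_mult wedge_bas_vac_pred)
    have "wedge u (wedge (delta_ext A (bas m)) (vac m) + wedge (bas m) (d m)) = 0" for m u
      by (simp add: vanish)
    then show "wedge (delta_ext A (u * bas m)) (vac m) + wedge (u * bas m) (d m) = 0" for m u
      by (simp add: delta_ext_mult wedge_add_left wedge_add_right wedge_mult)
  qed blast
  have delta_1: "delta_ext A 1 = 0"
    using delta_ext_mult[of A 1 1] by simp
  have h_wedge: "h (wedge u x) = wedge (delta_ext A u) x + wedge u (h x)" for u x
  proof (induction x arbitrary: u rule: fock_induct)
    case (vac m)
    then show ?case
      using h_vac[of 1 m] by (simp add: h_vac delta_1)
  next
    case (bas k x)
    show ?case
      using bas[of "u * bas k"] bas[of "bas k"]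
      by (simp add: delta_ext_mult wedge_add_left wedge_add_right wedge_mult add.assoc)
  qed (simp add: wedge_diff_right additive.diff[OF h])
  have d_0: "d m = 0" if "m < Min (snd ` Poly_Mapping.keys A)" for m
    using that by (simp add: d_def delta_len_def bvec_def delta_1)
  have "wedge (delta_ext A (bvec (delta_len A m lam) m lam)) (vac (m - int (delta_len A m lam))) = h (bvac m lam)"
    for m lam
  proof -
    let ?r = "delta_len A m lam"
    \<comment> \<open>The remaining vacuum lies below every nonzero column, so \<open>d\<close>
      vanishes there and only the finite word contributes.\<close>
    have "m - int ?r < Min (snd ` Poly_Mapping.keys A)" "length lam \<le> ?r"
      by (auto simp: delta_len_def)
    then show ?thesis
      using h_vac[of "bvec ?r m lam" "m - int ?r"] by (simp add: d_0 bvac_eq)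
  qed
  then have *: "delta_fock A = h"
    unfolding delta_fock_def by (intro ext lin_ext_additive[OF h])
  show "additive (delta_fock A)" "delta_fock A (wedge u x) = wedge (delta_ext A u) x + wedge u (delta_fock A x)"
    unfolding * by (fact h, fact h_wedge)
  show "m < Min (snd ` Poly_Mapping.keys A) \<Longrightarrow> delta_fock A (vac m) = 0"
    unfolding * using h_vac[of 1 m] by (simp add: delta_1 d_0)
qed

lemma delta_Bmat_bas:
  "delta_fock (Bmat i j) (wedge (bas k) x) =
     (if j = k then wedge (bas i) x else 0) + wedge (bas k) (delta_fock (Bmat i j) x)"
  using delta_ext_incl[of "Bmat i j" "bM k"] by (simp add: delta_fock(2) gl_apply_Bmat)

lemma delta_Bmat_vac_0: "m < j \<Longrightarrow> delta_fock (Bmat i j) (vac m) = 0"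
  by (rule delta_fock(3)) (simp add: Bmat_def)

section \<open>Sums of finitely many nonzero terms\<close>

lemma finite_support_comp:
  "finite {l. f l \<noteq> 0} \<Longrightarrow> (\<And>l. g l 0 = 0) \<Longrightarrow> finite {l. g l (f l) \<noteq> 0}"
  by (erule rev_finite_subset) auto

lemma Sum_any_shift: "Sum_any (\<lambda>l::int. f (l + c)) = Sum_any f"
  by (rule Sum_any.reindex_cong[symmetric, where l = "\<lambda>l. l + c"])
    (auto simp: bij_def inj_def surj_def intro: exI[of _ "_ - c"])

lemma finite_support_shift:
  assumes "finite {l::int. f l \<noteq> 0}"
  shows "finite {l. f (l + c) \<noteq> 0}"
proof (rule finite_subset)
  show "{l. f (l + c) \<noteq> 0} \<subseteq> (\<lambda>l. l - c) ` {l. f l \<noteq> 0}"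
    by (auto simp: image_iff intro!: exI[of _ "_ + c"])
qed (use assms in simp)

lemma additive_Sum_any:
  assumes h: "additive h" and f: "finite {l. f l \<noteq> 0}"
  shows "h (Sum_any f) = Sum_any (\<lambda>l. h (f l))"
proof -
  have "Sum_any (\<lambda>l. h (f l)) = (\<Sum>l\<in>{l. f l \<noteq> 0}. h (f l))"
    by (rule Sum_any.expand_superset) (use f additive.zero[OF h] in auto)
  then show ?thesis
    by (simp add: Sum_any.expand_set[of f] additive.sum[OF h])
qed

lemma Sum_any_diff:
  fixes f g :: "'a \<Rightarrow> 'b::ab_group_add"
  assumes "finite {l. f l \<noteq> 0}" "finite {l. g l \<noteq> 0}"
  shows "Sum_any (\<lambda>l. f l - g l) = Sum_any f - Sum_any g"
proof -
  have "Sum_any (\<lambda>l. - g l) = - Sum_any g"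
    using additive_Sum_any[of uminus g] assms(2) by (simp add: additive_def)
  then show ?thesis
    using Sum_any.distrib[of f "\<lambda>l. - g l"] assms by simp
qed

lemma Sum_any_nat_int:
  assumes "\<And>j. j < 0 \<Longrightarrow> f j = 0"
  shows "Sum_any (\<lambda>k::nat. f (int k)) = Sum_any f"
proof -
  have "{j. f j \<noteq> 0} = int ` {k. f (int k) \<noteq> 0}"
  proof (intro equalityI subsetI)
    fix j assume "j \<in> {j. f j \<noteq> 0}"
    then show "j \<in> int ` {k. f (int k) \<noteq> 0}"
      using assms[of j] by (intro image_eqI[of _ _ "nat j"]) (auto simp: not_less[symmetric])
  qed auto
  then show ?thesis
    by (simp add: Sum_any.expand_set sum.reindex)
qed

section \<open>Fermionic form of the vertex operators\<close>

text \<open>\<open>vertex p\<close> is the coefficient of \<open>z\<^sup>p\<close> in \<open>\<sigma>\<^sub>+(z) \<sigma>\<^sub>-\<^sup>-\<^sup>1(z)\<close>, and \<open>vertex_dual q\<close> that of \<open>w\<^sup>q\<close> in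
  \<open>\<sigma>\<^sub>+\<^sup>-\<^sup>1(w) \<sigma>\<^sub>-(w)\<close>.\<close>

definition vertex :: "int \<Rightarrow> fock \<Rightarrow> fock" where
  "vertex p x = Sum_any (\<lambda>l. sp (l + p) (sbm l x))"

definition vertex_dual :: "int \<Rightarrow> fock \<Rightarrow> fock" where
  "vertex_dual q x = Sum_any (\<lambda>l. sbp (l + q) (sm l x))"

lemma additive_vertex: "additive (vertex p)"
  unfolding additive_def vertex_def cf_add
  by (intro allI Sum_any.distrib) (rule finite_support_comp[OF finite_sbm], simp)+

lemma additive_vertex_dual: "additive (vertex_dual p)"
  unfolding additive_def vertex_dual_def cf_add
  by (intro allI Sum_any.distrib) (rule finite_support_comp[OF finite_sm], simp)+

lemma vertex_vac: "vertex p (vac m) = sp p (vac m)"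
proof -
  have "vertex p (vac m) = Sum_any (\<lambda>l. if l = 0 then sp (l + p) (vac m) else 0)"
    unfolding vertex_def by (rule Sum_any.cong) (simp add: sbm_vac)
  then show ?thesis by simp
qed

lemma vertex_dual_vac: "vertex_dual p (vac m) = sbp p (vac m)"
proof -
  have "vertex_dual p (vac m) = Sum_any (\<lambda>l. if l = 0 then sbp (l + p) (vac m) else 0)"
    unfolding vertex_dual_def by (rule Sum_any.cong) (simp add: sm_vac)
  then show ?thesis by simp
qed

text \<open>On b_k the inverse of sigma_-(z) also creates -z^-1 b_(k-1), and the geometric tail of
  sigma_+(z) at b_(k-1) cancels the contribution of b_k. In coefficients, the two \<open>F\<close>
  sums agree after a shift of l.\<close>

lemma vertex_bas: "vertex p (wedge (bas k) x) = - wedge (bas (k - 1)) (vertex (p + 1) x)"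
proof -
  define F where "F l = sp (l + p) (wedge (bas k) (sbm l x))" for l
  define G where "G l = wedge (bas (k - 1)) (sp (l + (p + 1)) (sbm l x))" for l
  have F: "finite {l. F l \<noteq> 0}" and G: "finite {l. G l \<noteq> 0}"
    unfolding F_def G_def by (rule finite_support_comp[OF finite_sbm]; simp)+
  have summand: "sp (l + p) (sbm l (wedge (bas k) x)) = F l - G (l + - 1) - F (l + - 1)" for l
    using sp_bas[of "l + p" "k - 1" "sbm (l - 1) x"]
    by (simp add: sbm_bas cf_diff F_def G_def algebra_simps)
  have "vertex p (wedge (bas k) x) = Sum_any (\<lambda>l. F l - G (l + - 1) - F (l + - 1))"
    unfolding vertex_def by (rule Sum_any.cong) (rule summand)
  also have "\<dots> = Sum_any (\<lambda>l. F l - G (l + - 1)) - Sum_any (\<lambda>l. F (l + - 1))"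
    by (intro Sum_any_diff finite_support_shift F)
      (rule finite_subset[OF _ finite_UnI[OF F finite_support_shift[OF G, of "- 1"]]], auto)
  also have "\<dots> = - Sum_any G"
    by (simp only: Sum_any_diff[OF F finite_support_shift[OF G]] Sum_any_shift) simp
  also have "Sum_any G = wedge (bas (k - 1)) (vertex (p + 1) x)"
    unfolding vertex_def G_def
    by (rule additive_Sum_any[OF additive_wedge, symmetric]) (rule finite_support_comp[OF finite_sbm], simp)
  finally show ?thesis .
qed

text \<open>Here the geometric tail comes from sigma_-, the operator applied first, and survives as
  a term with k lowered and q raised. The recursion is closed later by lowering k until b_k
  annihilates x.\<close>

lemma vertex_dual_bas:
  "vertex_dual q (wedge (bas k) x) = wedge (bas k) (vertex_dual q x) - wedge (bas (k + 1)) (vertex_dual (q - 1) x) +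
     vertex_dual (q + 1) (wedge (bas (k - 1)) x)"
proof -
  define F where "F q l = sbp (l + q) (sm l x)" for q l
  define H where "H l = sbp (l + (q + 1)) (sm l (wedge (bas (k - 1)) x))" for l
  have F: "finite {l. F q l \<noteq> 0}" for q
    unfolding F_def by (rule finite_support_comp[OF finite_sm]) simp
  have H: "finite {l. H l \<noteq> 0}"
    unfolding H_def by (rule finite_support_comp[OF finite_sm]) simp
  have wF: "finite {l. wedge (bas j) (F q l) \<noteq> 0}" for j q
    by (rule finite_support_comp[OF F]) simp
  have vertex_dual: "wedge (bas j) (vertex_dual q x) = Sum_any (\<lambda>l. wedge (bas j) (F q l))" for j q
    unfolding vertex_dual_def F_def[symmetric] by (rule additive_Sum_any[OF additive_wedge F])
  have "vertex_dual q (wedge (bas k) x) = Sum_any (\<lambda>l. wedge (bas k) (F q l) - wedge (bas (k + 1)) (F (q - 1) l) + H (l + - 1))"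
    unfolding vertex_dual_def
    by (rule Sum_any.cong) (simp add: sm_bas[of _ k x] cf_add sbp_bas F_def H_def add_diff_eq)
  also have "\<dots> = Sum_any (\<lambda>l. wedge (bas k) (F q l) - wedge (bas (k + 1)) (F (q - 1) l)) + Sum_any (\<lambda>l. H (l + - 1))"
    by (intro Sum_any.distrib finite_support_shift H)
      (rule finite_subset[OF _ finite_UnI[OF wF wF, of k q "k + 1" "q - 1"]], auto)
  also have "Sum_any (\<lambda>l. H (l + - 1)) = vertex_dual (q + 1) (wedge (bas (k - 1)) x)"
    unfolding Sum_any_shift by (simp add: H_def vertex_dual_def)
  finally show ?thesis
    by (simp add: Sum_any_diff wF vertex_dual)
qed

text \<open>An inductive form of membership in F_m. It tracks the charge along the generation by
  b_k, because the exponents in the vertex operator formulas depend on m.\<close>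

inductive deg :: "int \<Rightarrow> fock \<Rightarrow> bool" where
  vac: "deg m (vac m)"
| bas: "deg m x \<Longrightarrow> deg (m + 1) (wedge (bas k) x)"
| diff: "deg m x \<Longrightarrow> deg m y \<Longrightarrow> deg m (x - y)"

lemma deg_0: "deg m 0"
  using deg.diff[OF deg.vac deg.vac] by simp

lemma deg_uminus: "deg m x \<Longrightarrow> deg m (- x)"
  using deg.diff[OF deg_0] by simp

lemma deg_add: "deg m x \<Longrightarrow> deg m y \<Longrightarrow> deg m (x + y)"
  using deg.diff[OF _ deg_uminus] by simp

lemma deg_int_scale: "deg m x \<Longrightarrow> deg m (int_scale c x)"
  by (induction c rule: int_induct[where k = 0]) (auto simp: int_scale_succ intro: deg_0 deg_add deg.diff)

lemma deg_bvac: "deg m (bvac m lam)"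
proof -
  have "deg (m + int (length w)) (wedge (bword w) (vac m))" for w m
  proof (induction w)
    case (Cons a w)
    then show ?case
      using deg.bas[OF Cons, of a] by (simp add: bword_Cons wedge_mult algebra_simps)
  qed (simp add: deg.vac)
  from this[of "m - int (length lam)" "map (bidx m lam) [0..<length lam]"] show ?thesis
    by (simp add: bvac_def bvec_eq_bword)
qed

lemma Fock_deg:
  assumes "u \<in> Fock m"
  shows "deg m u"
proof -
  have "deg m (\<Sum>lam\<in>A. int_scale (g lam) (bvac m lam))" if "finite A" for A g
    using that by (induction A) (auto intro: deg_0 deg_add deg_int_scale deg_bvac)
  then show ?thesis
    using assms by (auto simp: Fock_def)
qed

text \<open>The index shift comes from a Hasse-Schmidt derivation with constant series, so
  \<open>extend_fock\<close> applies and coefficient 0 carries everything.\<close>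

definition shift :: "fock \<Rightarrow> fock" where
  "shift x = extend_fock (hs (\<lambda>j. fps_const (bM (j + 1)))) (\<lambda>m. fps_const (vac (m + 1))) x $ 0"

lemma shift:
  "additive shift" "shift (wedge (bas k) x) = wedge (bas (k + 1)) (shift x)" "shift (vac m) = vac (m + 1)"
proof -
  let ?T = "hs (\<lambda>j. fps_const (bM (j + 1)))" and ?V = "\<lambda>m. fps_const (vac (m + 1))"
  have T: "?T (bas j) $ n = (if n = 0 then bas (j + 1) else 0)" for j n
    by (simp add: hs_bas fps_incl_def)
  have 1: "fps_wedge (?T (bas m)) (?V (m - 1)) = ?V m" for m
    by (rule fps_ext) (simp add: fps_wedge_const T wedge_bas_vac_pred)
  have 2: "fps_wedge (?T (bas m)) (?V m) = 0" for m
    by (rule fps_ext) (simp add: fps_wedge_const T)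
  note e = extend_fock[OF HS_derivation_hs hs_1 1 2]
  show "additive shift" "shift (vac m) = vac (m + 1)"
    by (simp_all add: shift_def additive_def additive.add[OF e(1)] e(3))
  show "shift (wedge (bas k) x) = wedge (bas (k + 1)) (shift x)"
    by (simp add: shift_def e(2) fps_wedge_nth T)
qed

text \<open>On vacua this is \<open>sp_vac\<close>. For b_k, \<open>shift\<close> raises the index,
  \<open>vertex_bas\<close> lowers it again with a sign, and swapping b_k with the new factor
  removes the sign.\<close>

lemma vertex_shift: "deg m x \<Longrightarrow> vertex p (shift x) = wedge (bas (m + 1 + p)) x"
proof (induction arbitrary: p rule: deg.induct)
  case (vac m)
  then show ?case by (simp add: shift vertex_vac sp_vac)
next
  case (bas m x k)
  have "vertex p (shift (wedge (bas k) x)) = - wedge (bas k) (wedge (bas (m + 2 + p)) x)"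
    using bas.IH[of "p + 1"] by (simp add: shift vertex_bas algebra_simps)
  then show ?case
    using wedge_bas_swap[of k "m + 2 + p" x] by (simp add: algebra_simps)
next
  case (diff m x y)
  then show ?case
    by (simp add: additive.diff[OF shift(1)] additive.diff[OF additive_vertex] wedge_diff_right)
qed

text \<open>For q at least 0, \<open>sbp q (vac m)\<close> is, up to (-1)^q, the vector occupying
  all indices up to m + 1 except m + 1 - q. Only this hole can be filled, and moving the new factor
  past q others restores the sign.\<close>

lemma wedge_bas_sbp_vac:
  "j \<le> m + 1 \<Longrightarrow> wedge (bas j) (sbp q (vac m)) = (if q = m + 1 - j then vac (m + 1) else 0)"
proof (induction "nat q" arbitrary: q m j rule: less_induct)
  case less
  consider "q < 0" | "q = 0" | "q > 0"
    by linarith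
  then show ?case
  proof cases
    case 1
    then show ?thesis using less.prems by simp
  next
    case 2
    then show ?thesis using less.prems by (auto simp: sbp_vac_0 wedge_bas_vac_pred)
  next
    case 3
    show ?thesis
    proof (cases "j = m + 1")
      case True
      then show ?thesis using 3 by (simp add: sbp_vac wedge_uminus_right)
    next
      case False
      then have "wedge (bas j) (sbp (q - 1) (vac (m - 1))) = (if q = m + 1 - j then vac m else 0)"
        using less.hyps[of "q - 1" j "m - 1"] less.prems 3 by auto
      then show ?thesis
        using 3 by (simp add: sbp_vac wedge_uminus_right wedge_bas_swap[of j "m + 1"] wedge_bas_vac_pred)
    qed
  qed
qed

text \<open>The defect \<open>f\<close> of anticommutation is unchanged when i drops and q rises by
  one. Far down b_i annihilates x, so \<open>f\<close> equals its second summand, which the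
  assumption evaluates.\<close>

lemma vertex_dual_bas_shift_aux:
  assumes "\<And>j q. j \<le> J \<Longrightarrow> wedge (bas j) (vertex_dual q x) = (if q = m + 1 - j then shift x else 0)"
  shows "vertex_dual q (wedge (bas i) x) = - wedge (bas (i + 1)) (vertex_dual (q - 1) x) + (if q = m + 1 - i then shift x else 0)"
proof -
  define f where "f i q = vertex_dual q (wedge (bas i) x) + wedge (bas (i + 1)) (vertex_dual (q - 1) x)" for i q
  have step: "f i q = f (i - 1) (q + 1)" for i q
    by (simp add: f_def vertex_dual_bas[of q i x])
  have steps: "f i q = f (i - int n) (q + int n)" for i q n
  proof (induction n)
    case (Suc n)
    then show ?case
      using step[of "i - int n" "q + int n"] by (simp add: algebra_simps)
  qed simp
  obtain K where K: "\<forall>j\<le>K. wedge (bas j) x = 0"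
    using wedge_bas_eventually_0 by blast
  \<comment> \<open>The index i - n must annihilate x, and i - n + 1, the factor in the boundary
    term, must lie in the range of the assumption.\<close>
  define n where "n = nat (max (i - K) (i + 1 - J))"
  have n: "i - int n \<le> K" "i - int n + 1 \<le> J"
    by (auto simp: n_def)
  have "f i q = f (i - int n) (q + int n)"
    by (rule steps)
  also have "\<dots> = (if q = m + 1 - i then shift x else 0)"
    using K n by (auto simp: f_def assms additive.zero[OF additive_vertex_dual])
  finally show ?thesis
    by (simp add: f_def eq_diff_eq algebra_simps)
qed

text \<open>Supplies the boundary term of \<open>vertex_dual_bas_shift_aux\<close>, with J depending
  on x but not on q. The induction step applies that lemma to x; taking j also below
  \<open>K\<close> makes b_j kill the extra summand \<open>shift x\<close>.\<close>

lemma wedge_bas_vertex_dual: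
  "deg m x \<Longrightarrow> \<exists>J. \<forall>j\<le>J. \<forall>q. wedge (bas j) (vertex_dual q x) = (if q = m + 1 - j then shift x else 0)"
proof (induction rule: deg.induct)
  case (vac m)
  then show ?case
    by (intro exI[of _ "m + 1"]) (simp add: vertex_dual_vac wedge_bas_sbp_vac shift)
next
  case (bas m x i)
  then obtain J where J: "\<forall>j\<le>J. \<forall>q. wedge (bas j) (vertex_dual q x) = (if q = m + 1 - j then shift x else 0)"
    by auto
  obtain K where K: "\<forall>j\<le>K. wedge (bas j) (shift x) = 0"
    using wedge_bas_eventually_0 by blast
  have vertex_dual: "vertex_dual q (wedge (bas i) x) = - wedge (bas (i + 1)) (vertex_dual (q - 1) x) +
      (if q = m + 1 - i then shift x else 0)" for q
    using J by (intro vertex_dual_bas_shift_aux) auto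
  have "wedge (bas j) (vertex_dual q (wedge (bas i) x)) = (if q = m + 1 + 1 - j then shift (wedge (bas i) x) else 0)"
    if "j \<le> min J K" for j q
    using that J K wedge_bas_swap[of j "i + 1" "vertex_dual (q - 1) x"]
    by (auto simp: vertex_dual wedge_add_right wedge_uminus_right wedge_diff_right shift)
  then show ?case by blast
next
  case (diff m x y)
  then obtain J K where "\<forall>j\<le>J. \<forall>q. wedge (bas j) (vertex_dual q x) = (if q = m + 1 - j then shift x else 0)"
    "\<forall>j\<le>K. \<forall>q. wedge (bas j) (vertex_dual q y) = (if q = m + 1 - j then shift y else 0)"
    by auto
  then show ?case
    by (intro exI[of _ "min J K"])
      (auto simp: additive.diff[OF additive_vertex_dual] wedge_diff_right additive.diff[OF shift(1)])
qed

lemma vertex_dual_bas_shift: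
  assumes "deg m x"
  shows "vertex_dual q (wedge (bas i) x) = - wedge (bas (i + 1)) (vertex_dual (q - 1) x) + (if q = m + 1 - i then shift x else 0)"
  using wedge_bas_vertex_dual[OF assms] vertex_dual_bas_shift_aux by metis

text \<open>Induction on the number of vacuum factors with index at least -q. With none, both sides
  vanish; if -q = m, the matrix unit replaces b_m by b_p; otherwise b_m is peeled off on both
  sides.\<close>

lemma delta_eq_vertex_vac:
  "delta_fock (Bmat p (- q)) (vac m) = vertex (p - m) (vertex_dual (q + m) (vac m))"
proof (induction "nat (q + m + 1)" arbitrary: m)
  case 0
  then show ?case
    by (simp add: delta_Bmat_vac_0 vertex_dual_vac additive.zero[OF additive_vertex])
next
  case (Suc n)
  have vac_m: "delta_fock (Bmat p (- q)) (vac m) = (if - q = m then wedge (bas p) (vac (m - 1)) else 0) +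
      wedge (bas m) (delta_fock (Bmat p (- q)) (vac (m - 1)))"
    using delta_Bmat_bas[of p "- q" m "vac (m - 1)"] by (simp add: wedge_bas_vac_pred)
  show ?case
  proof (cases "q + m = 0")
    case True
    then have "vertex (p - m) (vertex_dual (q + m) (vac m)) = wedge (bas p) (vac (m - 1))"
      using vertex_shift[OF deg.vac[of "m - 1"], of "p - m"] by (simp add: vertex_dual_vac sbp_vac_0 shift)
    then show ?thesis
      using True by (simp add: vac_m delta_Bmat_vac_0)
  next
    case False
    then have "vertex (p - m) (vertex_dual (q + m) (vac m)) = wedge (bas m) (vertex (p - (m - 1)) (vertex_dual (q + (m - 1)) (vac (m - 1))))"
      by (simp add: vertex_dual_vac sbp_vac additive.minus[OF additive_vertex] vertex_bas algebra_simps)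
    moreover have "n = nat (q + (m - 1) + 1)"
      using Suc.hyps(2) by simp
    ultimately show ?thesis
      using False Suc.hyps(1)[of "m - 1"] by (auto simp: vac_m)
  qed
qed

text \<open>The two recursions turn b_k into -b_(k+1) and then back into b_k, while
  \<open>vertex_shift\<close> turns the summand \<open>shift x\<close> into b_p wedge x. This is the
  Leibniz rule for the matrix unit with column -q.\<close>

lemma delta_eq_vertex: "deg m x \<Longrightarrow> delta_fock (Bmat p (- q)) x = vertex (p - m) (vertex_dual (q + m) x)"
proof (induction rule: deg.induct)
  case (vac m)
  then show ?case by (rule delta_eq_vertex_vac)
next
  case (bas m x k)
  have "vertex (p - (m + 1)) (vertex_dual (q + (m + 1)) (wedge (bas k) x)) =
      wedge (bas k) (vertex (p - m) (vertex_dual (q + m) x)) + (if - q = k then wedge (bas p) x else 0)"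
    using vertex_shift[OF bas.hyps, of "p - (m + 1)"]
    by (auto simp: vertex_dual_bas_shift[OF bas.hyps] additive.add[OF additive_vertex] additive.minus[OF additive_vertex]
        additive.diff[OF additive_vertex] additive.zero[OF additive_vertex] vertex_bas algebra_simps)
  then show ?case
    by (simp add: delta_Bmat_bas bas.IH)
next
  case (diff m x y)
  then show ?case
    by (simp add: additive.diff[OF delta_fock(1)] additive.diff[OF additive_vertex] additive.diff[OF additive_vertex_dual])
qed

section \<open>Normal ordering\<close>

text \<open>The vacuum case of the commutation relation: the inverse of sigma_-(z) fixes the vacuum,
  so only the factor 1/(1 - w/z), expanded in w/z, remains.\<close>

lemma sbm_sbp_vac: "0 \<le> a \<Longrightarrow> sbm a (sbp b (vac m)) = sbp (b - a) (vac m)"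
proof (induction "nat b" arbitrary: a b m rule: less_induct)
  case less
  consider "b < 0" | "b = 0" | "b > 0"
    by linarith
  then show ?case
  proof cases
    case 1
    then show ?thesis using less.prems by simp
  next
    case 2
    then show ?thesis using less.prems by (simp add: sbp_vac_0 sbm_vac)
  next
    case 3
    define v where "v = vac (m - 1)"
    have IH: "sbm c (sbp (b - 1) v) = sbp (b - 1 - c) v" if "0 \<le> c" for c
      unfolding v_def using less.hyps[of "b - 1" c "m - 1"] that 3 by simp
    have b: "sbp b (vac m) = - wedge (bas (m + 1)) (sbp (b - 1) v)"
      using 3 by (simp add: sbp_vac v_def)
    show ?thesis
    proof (cases "a = 0")
      case True
      then show ?thesis
        using IH[of 0] by (simp add: b cf_uminus sbm_bas)
    next
      case False
      have "sbm a (sbp b (vac m)) = wedge (bas m) (sbp (b - a) v) - wedge (bas (m + 1)) (sbp (b - a - 1) v)"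
        using IH[of a] IH[of "a - 1"] False less.prems
        by (simp add: b cf_uminus sbm_bas algebra_simps)
      also have "\<dots> = sbp (b - a) (vac m)"
        using sbp_bas[of "b - a" m v] by (simp add: v_def wedge_bas_vac_pred)
      finally show ?thesis .
    qed
  qed
qed

text \<open>This is \<open>(1 - w/z) \<sigma>\<^sub>-\<^sup>-\<^sup>1(z) \<sigma>\<^sub>+\<^sup>-\<^sup>1(w) = \<sigma>\<^sub>+\<^sup>-\<^sup>1(w) \<sigma>\<^sub>-\<^sup>-\<^sup>1(z)\<close>.\<close>

lemma sbm_sbp: "sbm a (sbp b x) = sbp b (sbm a x) + sbm (a - 1) (sbp (b - 1) x)"
proof (induction x arbitrary: a b rule: fock_induct)
  case (vac m)
  consider "a < 0" | "a = 0" | "a > 0"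
    by linarith
  then show ?case
  proof cases
    case 2
    then show ?thesis using sbm_sbp_vac[of 0 b m] by (simp add: sbm_vac)
  next
    case 3
    then show ?thesis
      using sbm_sbp_vac[of a b m] sbm_sbp_vac[of "a - 1" "b - 1" m] by (simp add: sbm_vac)
  qed simp
next
  case (bas k x)
  \<comment> \<open>On b_k both operators are linear polynomials in commuting index shifts, so the
    correction factor is the one for x.\<close>
  show ?case
    by (simp add: sbm_bas sbp_bas cf_diff bas[of a b] bas[of "a - 1" b] bas[of a "b - 1"]
        bas[of "a - 1" "b - 1"] wedge_add_right algebra_simps)
next
  case (diff x y)
  show ?case
    by (simp add: cf_diff diff(1)[of a b] diff(2)[of a b])
qed

text \<open>The coefficient of z^-l w^q in sigma_+(w)^-1 sigma_-(z)^-1 sigma_-(w);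
  \<open>normal_zw p q\<close> is that of z^p w^q once sigma_+(z) is put in front.\<close>

definition normal_w :: "int \<Rightarrow> int \<Rightarrow> fock \<Rightarrow> fock" where
  "normal_w l q x = Sum_any (\<lambda>k. sbp (k + q) (sbm l (sm k x)))"

definition normal_zw :: "int \<Rightarrow> int \<Rightarrow> fock \<Rightarrow> fock" where
  "normal_zw p q x = Sum_any (\<lambda>l. sp (l + p) (normal_w l q x))"

lemma finite_sbm_sm: "finite {(l, k). sbm l (sm k x) \<noteq> 0}"
proof (rule finite_subset)
  show "{(l, k). sbm l (sm k x) \<noteq> 0} \<subseteq> (\<Union>k\<in>{k. sm k x \<noteq> 0}. {l. sbm l (sm k x) \<noteq> 0} \<times> {k})"
    by auto
qed (auto simp: finite_sm finite_sbm)

lemma finite_normal_w: "finite {l. normal_w l q x \<noteq> 0}"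
proof (rule finite_subset)
  show "{l. normal_w l q x \<noteq> 0} \<subseteq> fst ` {(l, k). sbm l (sm k x) \<noteq> 0}"
  proof
    fix l assume "l \<in> {l. normal_w l q x \<noteq> 0}"
    then obtain k where "sbp (k + q) (sbm l (sm k x)) \<noteq> 0"
      unfolding normal_w_def by (auto elim: Sum_any.not_neutral_obtains_not_neutral)
    then have "sbm l (sm k x) \<noteq> 0"
      by auto
    then show "l \<in> fst ` {(l, k). sbm l (sm k x) \<noteq> 0}"
      by (auto intro: rev_image_eqI)
  qed
qed (simp add: finite_sbm_sm)

lemma sbm_vertex_dual: "sbm l (vertex_dual q x) = normal_w l q x + sbm (l - 1) (vertex_dual (q - 1) x)"
proof -
  have vertex_dual: "sbm l (vertex_dual q x) = Sum_any (\<lambda>k. sbm l (sbp (k + q) (sm k x)))" for l q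
    unfolding vertex_dual_def by (rule additive_Sum_any[OF additive_sbm]) (rule finite_support_comp[OF finite_sm], simp)
  have "sbm l (vertex_dual q x) =
      Sum_any (\<lambda>k. sbp (k + q) (sbm l (sm k x)) + sbm (l - 1) (sbp (k + (q - 1)) (sm k x)))"
    unfolding vertex_dual by (rule Sum_any.cong) (simp add: sbm_sbp[of l "_ + q"] add_diff_eq)
  also have "\<dots> = normal_w l q x + sbm (l - 1) (vertex_dual (q - 1) x)"
    unfolding vertex_dual normal_w_def by (rule Sum_any.distrib; rule finite_support_comp[OF finite_sm]; simp)
  finally show ?thesis .
qed

text \<open>In series form, (1 - w/z) X(z) Y(w) is the normally ordered product; the last summand is
  the w/z term.\<close>

lemma vertex_vertex_dual: "vertex p (vertex_dual q x) = normal_zw p q x + vertex (p + 1) (vertex_dual (q - 1) x)"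
proof -
  define F where "F l = sp (l + (p + 1)) (sbm l (vertex_dual (q - 1) x))" for l
  have F: "finite {l. F l \<noteq> 0}"
    unfolding F_def by (rule finite_support_comp[OF finite_sbm]) simp
  have "vertex p (vertex_dual q x) = Sum_any (\<lambda>l. sp (l + p) (normal_w l q x) + F (l + - 1))"
    unfolding vertex_def by (rule Sum_any.cong) (simp add: sbm_vertex_dual[of _ q] cf_add F_def)
  also have "\<dots> = normal_zw p q x + Sum_any (\<lambda>l. F (l + - 1))"
    unfolding normal_zw_def
    by (intro Sum_any.distrib finite_support_shift F) (rule finite_support_comp[OF finite_normal_w], simp)
  finally show ?thesis
    unfolding Sum_any_shift by (simp add: F_def vertex_def)
qed

text \<open>For l beyond the support of \<open>sm\<close> the inner term is zero, and for smaller l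
  the index l + q is negative once q is small. This bound makes the sum of the expansion in w/z
  finite.\<close>

lemma vertex_dual_bounded_below: "\<exists>Q. \<forall>q\<le>Q. vertex_dual q x = 0"
proof -
  obtain M where M: "\<forall>n\<ge>M. sm n x = 0"
    using sm_eventually_0 by blast
  have "sbp (l + q) (sm l x) = 0" if "q < - M" for l q
    using M that by (cases "l \<ge> M") auto
  then have "vertex_dual q x = 0" if "q \<le> - M - 1" for q
    using that by (simp add: vertex_dual_def)
  then show ?thesis by blast
qed

lemma geom_normal: "mult2 int_scale geom_zw (\<lambda>p q. normal_zw p q x) = (\<lambda>p q. vertex p (vertex_dual q x))"
proof (intro ext)
  fix p q
  obtain Q where Q: "\<forall>q\<le>Q. vertex_dual q x = 0"
    using vertex_dual_bounded_below by blast
  have N_0: "normal_zw p q x = 0" if "q \<le> Q" for p q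
    using vertex_vertex_dual[of p q x] Q that by (simp add: additive.zero[OF additive_vertex])
  have telescope: "(\<Sum>n<k. normal_zw (p + int n) (q - int n) x) = vertex p (vertex_dual q x) - vertex (p + int k) (vertex_dual (q - int k) x)" for k
  proof (induction k)
    case (Suc k)
    then show ?case
      using vertex_vertex_dual[of "p + int k" "q - int k" x] by (simp add: algebra_simps)
  qed simp
  \<comment> \<open>After \<open>K\<close> steps the exponent of w is at most \<open>Q\<close>, so
    the remainder of the telescoping sum is zero.\<close>
  define K where "K = nat (q - Q)"
  let ?f = "\<lambda>n. (- int n, int n)"
  have "mult2 int_scale geom_zw (\<lambda>p q. normal_zw p q x) p q =
      (\<Sum>(i, j)\<in>?f ` {..<K}. int_scale (geom_zw i j) (normal_zw (p - i) (q - j) x))"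
    unfolding mult2_def
  proof (rule Sum_any.expand_superset)
    show "{a. (case a of (i, j) \<Rightarrow> int_scale (geom_zw i j) (normal_zw (p - i) (q - j) x)) \<noteq> 0} \<subseteq> ?f ` {..<K}"
    proof clarify
      fix i j assume *: "int_scale (geom_zw i j) (normal_zw (p - i) (q - j) x) \<noteq> 0"
      then have "geom_zw i j \<noteq> 0" "normal_zw (p - i) (q - j) x \<noteq> 0"
        by auto
      then have "0 \<le> j" "i = - j" "q - j > Q"
        using N_0 by (auto simp: geom_zw_def not_le[symmetric] split: if_splits)
      then show "(i, j) \<in> ?f ` {..<K}"
        by (intro image_eqI[of _ _ "nat j"]) (auto simp: K_def)
    qed
  qed simp
  also have "\<dots> = (\<Sum>n<K. normal_zw (p + int n) (q - int n) x)"
    by (subst sum.reindex) (auto simp: inj_on_def geom_zw_def)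
  also have "\<dots> = vertex p (vertex_dual q x) - vertex (p + int K) (vertex_dual (q - int K) x)"
    by (rule telescope)
  also have "vertex (p + int K) (vertex_dual (q - int K) x) = 0"
    using Q by (simp add: K_def additive.zero[OF additive_vertex])
  finally show "mult2 int_scale geom_zw (\<lambda>p q. normal_zw p q x) p q = vertex p (vertex_dual q x)"
    by simp
qed

section \<open>Coefficientwise application of series as sums over integer indices\<close>

lemma Sum_any_cf:
  assumes "\<tau> 0 = 0"
  shows "Sum_any (\<lambda>k::nat. \<tau> (S (q - int k)) $ k) = Sum_any (\<lambda>l. cf \<tau> (l + q) (S (- l)))"
proof -
  have "Sum_any (\<lambda>k::nat. \<tau> (S (q - int k)) $ k) = Sum_any (\<lambda>k::nat. cf \<tau> (int k) (S (q - int k)))"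
    by (rule Sum_any.cong) (simp add: cf_def)
  also have "\<dots> = Sum_any (\<lambda>j. cf \<tau> j (S (q - j)))"
    by (rule Sum_any_nat_int) simp
  also have "\<dots> = Sum_any (\<lambda>l. cf \<tau> (l + q) (S (q - (l + q))))"
    by (rule Sum_any_shift[symmetric])
  finally show ?thesis by simp
qed

text \<open>At most one k survives; for positive q none does, in agreement with \<open>cf\<close> at
  a negative index.\<close>

lemma Sum_any_cf_minus:
  assumes "\<tau> 0 = 0"
  shows "Sum_any (\<lambda>k::nat. \<tau> (if q + int k = 0 then v else 0) $ k) = cf \<tau> (- q) v"
proof -
  have "Sum_any (\<lambda>k::nat. \<tau> (if q + int k = 0 then v else 0) $ k) =
      Sum_any (\<lambda>k. if k = nat (- q) then cf \<tau> (- q) v else 0)"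
    by (rule Sum_any.cong) (auto simp: assms cf_def)
  then show ?thesis by simp
qed

lemma app_z_plus: "\<tau> 0 = 0 \<Longrightarrow> app_z 1 \<tau> S p q = Sum_any (\<lambda>l. cf \<tau> (l + p) (S (- l) q))"
  using Sum_any_cf[of \<tau> "\<lambda>p. S p q" p] by (simp add: app_z_def)

lemma app_w_plus: "\<tau> 0 = 0 \<Longrightarrow> app_w 1 \<tau> S p q = Sum_any (\<lambda>l. cf \<tau> (l + q) (S p (- l)))"
  using Sum_any_cf[of \<tau> "S p" q] by (simp add: app_w_def)

lemma app_z_minus:
  "\<tau> 0 = 0 \<Longrightarrow> app_z (- 1) \<tau> (\<lambda>p q. if p = 0 then v q else 0) = (\<lambda>p q. cf \<tau> (- p) (v q))"
  by (intro ext) (simp add: app_z_def Sum_any_cf_minus)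

lemma app_w_minus:
  "\<tau> 0 = 0 \<Longrightarrow> app_w (- 1) \<tau> (const2 u) = (\<lambda>p q. if p = 0 then cf \<tau> (- q) u else 0)"
  by (intro ext) (auto simp: app_w_def const2_def Sum_any_cf_minus)

lemmas sigma_zero = additive.zero[OF sigma_p(1)] additive.zero[OF sigma_m(1)]
  additive.zero[OF sigma_bar_p(1)] additive.zero[OF sigma_bar_m(1)]

lemma app_eq_vertex:
  "app_z 1 sigma_p (app_z (- 1) sigma_bar_m (app_w 1 sigma_bar_p (app_w (- 1) sigma_m (const2 u)))) =
     (\<lambda>p q. vertex p (vertex_dual q u))"
proof -
  have "app_w 1 sigma_bar_p (app_w (- 1) sigma_m (const2 u)) = (\<lambda>p q. if p = 0 then vertex_dual q u else 0)"
    by (intro ext) (simp add: app_w_minus app_w_plus sigma_zero vertex_dual_def)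
  then show ?thesis
    by (intro ext) (simp add: app_z_minus app_z_plus sigma_zero vertex_def)
qed

lemma app_minus_minus:
  "app_z (- 1) sigma_bar_m (app_w (- 1) sigma_m (const2 u)) = (\<lambda>p q. sbm (- p) (sm (- q) u))"
  by (simp add: app_w_minus app_z_minus sigma_zero)

lemma app_eq_normal:
  "app_z 1 sigma_p (app_w 1 sigma_bar_p (app_z (- 1) sigma_bar_m (app_w (- 1) sigma_m (const2 u)))) =
     (\<lambda>p q. normal_zw p q u)"
  unfolding app_minus_minus by (intro ext) (simp add: app_z_plus app_w_plus sigma_zero normal_zw_def normal_w_def)

lemma mult2_monom: "mult2 int_scale (monom_zw a c) S = (\<lambda>p q. S (p - a) (q - c))"
proof (intro ext)
  fix p q
  have "mult2 int_scale (monom_zw a c) S p q = Sum_any (\<lambda>ij. if ij = (a, c) then S (p - a) (q - c) else 0)"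
    unfolding mult2_def by (rule Sum_any.cong) (auto simp: monom_zw_def split: if_splits)
  then show "mult2 int_scale (monom_zw a c) S p q = S (p - a) (q - c)"
    by simp
qed

section \<open>The module structure\<close>

text \<open>The left side is a sum of b_(m+b+i) wedge b_(m-1+a-i). If a exceeds b by d + 1, the
  first d + 1 terms form a coefficient of a square and cancel, and the rest is the sum for the
  exchanged indices.\<close>

lemma sp_sp_vac: "sp (int a) (sp (int b) (vac m)) = sp (int b) (sp (int a) (vac m))"
proof -
  have *: "sp (int a) (sp (int b) (vac m)) =
      (\<Sum>i=0..a. wedge (bas (m + int b + int i)) (wedge (bas (m - 1 + int (a - i))) (vac (m - 2))))" for a b
    by (simp add: sp_vac, simp add: cf_def sigma_p(2,3) fps_wedge_nth[of _ "fps_wedge _ _"] fps_wedge_const sigma_ext_bas)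
  have **: "sp (int (b + Suc d)) (sp (int b) (vac m)) = sp (int b) (sp (int (b + Suc d)) (vac m))" for b d
  proof -
    let ?f = "\<lambda>i. wedge (bas (m + int b + int i)) (wedge (bas (m - 1 + int (d + Suc b - i))) (vac (m - 2)))"
    have "sp (int (b + Suc d)) (sp (int b) (vac m)) = (\<Sum>i=0..d + Suc b. ?f i)"
      unfolding * by (simp only: add_Suc_right add.commute[of b])
    also have "\<dots> = (\<Sum>i=0..d. ?f i) + (\<Sum>i=0 + Suc d..b + Suc d. ?f i)"
      by (subst sum.ub_add_nat) (simp_all add: add.commute)
    also have "(\<Sum>i=0..d. ?f i) =
        (\<Sum>i=0..d. wedge (bas (m + int b + int i)) (wedge (bas (m + int b + int (d - i))) (vac (m - 2))))"
      by (intro sum.cong) (auto simp: of_nat_diff algebra_simps)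
    also have "\<dots> = 0"
      by (rule sum_wedge_bas_bas)
    also have "(\<Sum>i=0 + Suc d..b + Suc d. ?f i) = (\<Sum>i=0..b. ?f (i + Suc d))"
      by (rule sum.shift_bounds_cl_nat_ivl)
    also have "\<dots> = sp (int b) (sp (int (b + Suc d)) (vac m))"
      unfolding * by (intro sum.cong) (auto simp: algebra_simps)
    finally show ?thesis by simp
  qed
  consider "a = b" | d where "a = b + Suc d" | d where "b = a + Suc d"
    by (metis less_imp_Suc_add linorder_neqE_nat add_Suc_right)
  then show ?thesis
    by cases (use ** in auto)
qed

lemma sp_sp: "sp a (sp b x) = sp b (sp a x)"
proof (induction x arbitrary: a b rule: fock_induct)
  case (vac m)
  then show ?case
    using sp_sp_vac[of "nat a" "nat b" m] by (cases "a < 0 \<or> b < 0") auto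
next
  case (bas k x)
  show ?case
  proof (induction "nat (a + b)" arbitrary: a b k rule: less_induct)
    case less
    show ?case
    proof (cases "a < 0 \<or> b < 0 \<or> a = 0 \<and> b = 0")
      case True
      then show ?thesis by auto
    next
      case False
      \<comment> \<open>Using the recursion of \<open>sp b\<close> backwards removes the mixed term
        b_(k+1) wedge \<open>sp b x\<close>. All terms but the leading one then have a smaller a +
        b, and the induction covers them for every k.\<close>
      have step: "sp a (sp b (wedge (bas k) x)) = wedge (bas k) (sp a (sp b x)) +
          sp (a - 1) (sp b (wedge (bas (k + 1)) x)) - sp (a - 1) (sp (b - 1) (wedge (bas (k + 2)) x)) +
          sp a (sp (b - 1) (wedge (bas (k + 1)) x))" for a b
      proof -
        have "wedge (bas (k + 1)) (sp b x) = sp b (wedge (bas (k + 1)) x) - sp (b - 1) (wedge (bas (k + 2)) x)"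
          using sp_bas[of b "k + 1" x] by (simp add: add.assoc)
        then show ?thesis
          by (simp add: sp_bas[of b k x] sp_bas[of a k "sp b x"] cf_add cf_diff)
      qed
      have IH: "sp (a - 1) (sp b (wedge (bas k) x)) = sp b (sp (a - 1) (wedge (bas k) x))"
        "sp a (sp (b - 1) (wedge (bas k) x)) = sp (b - 1) (sp a (wedge (bas k) x))"
        "sp (a - 1) (sp (b - 1) (wedge (bas k) x)) = sp (b - 1) (sp (a - 1) (wedge (bas k) x))" for k
        by (rule less.hyps, use False in auto)+
      show ?thesis
        unfolding step[of a b] step[of b a] by (simp add: IH bas algebra_simps)
    qed
  qed
next
  case (diff x y)
  then show ?case by (simp add: cf_diff)
qed

lemma cf_sp_0 [simp]: "sp 0 x = x"
proof (induction x rule: fock_induct)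
  case (vac m)
  then show ?case by (simp add: sp_vac wedge_bas_vac_pred)
next
  case (bas k x)
  then show ?case by (simp add: sp_bas[of 0])
qed (simp add: cf_diff)

lemma sbp_0 [simp]: "sbp 0 x = x"
proof (induction x rule: fock_induct)
  case (vac m)
  then show ?case by (simp add: sbp_vac_0)
next
  case (bas k x)
  then show ?case by (simp add: sbp_bas)
qed (simp add: cf_diff)

text \<open>The product \<open>J\<close> of the two series satisfies a recursion on b_k whose last
  two terms cancel once the values at n - 1 are known.\<close>

lemma sbp_sp_inverse: "Sum_any (\<lambda>l. sbp l (sp (n - l) x)) = (if n = 0 then x else 0)"
proof -
  define J where "J n x = Sum_any (\<lambda>l. sbp l (sp (n - l) x))" for n x
  have fin: "finite {l. sbp l (sp (n - l) x) \<noteq> 0}" for n x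
  proof (rule finite_subset)
    have "sbp l (sp (n - l) x) = 0" if "l < 0 \<or> n < l" for l
      using that by auto
    then show "{l. sbp l (sp (n - l) x) \<noteq> 0} \<subseteq> {0..n}"
      by (metis (mono_tags, lifting) atLeastAtMost_iff mem_Collect_eq not_less subsetI)
  qed simp
  have J_wedge: "wedge u (J n x) = Sum_any (\<lambda>l. wedge u (sbp l (sp (n - l) x)))" for u n x
    unfolding J_def by (rule additive_Sum_any[OF additive_wedge fin])
  have fin_wedge: "finite {l. wedge u (sbp l (sp (n - l) x)) \<noteq> 0}" for u n x
    by (rule finite_support_comp[OF fin]) simp
  have J_bas: "J n (wedge (bas k) x) =
      wedge (bas k) (J n x) - wedge (bas (k + 1)) (J (n - 1) x) + J (n - 1) (wedge (bas (k + 1)) x)" for n k x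
  proof -
    define F where "F l = wedge (bas (k + 1)) (sbp l (sp (n - 1 - l) x))" for l
    have F: "finite {l. F l \<noteq> 0}"
      unfolding F_def by (rule fin_wedge)
    have "J n (wedge (bas k) x) = Sum_any (\<lambda>l. wedge (bas k) (sbp l (sp (n - l) x)) - F (l + - 1) +
        sbp l (sp (n - 1 - l) (wedge (bas (k + 1)) x)))"
      unfolding J_def by (rule Sum_any.cong) (simp add: sp_bas[of _ k x] cf_add sbp_bas F_def algebra_simps)
    also have "\<dots> = Sum_any (\<lambda>l. wedge (bas k) (sbp l (sp (n - l) x)) - F (l + - 1)) + J (n - 1) (wedge (bas (k + 1)) x)"
      unfolding J_def
      by (intro Sum_any.distrib fin)
        (rule finite_subset[OF _ finite_UnI[OF fin_wedge[of "bas k" n x] finite_support_shift[OF F, of "- 1"]]], auto)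
    also have "Sum_any (\<lambda>l. wedge (bas k) (sbp l (sp (n - l) x)) - F (l + - 1)) = wedge (bas k) (J n x) - Sum_any F"
      by (simp only: Sum_any_diff[OF fin_wedge finite_support_shift[OF F]] Sum_any_shift J_wedge)
    finally show ?thesis
      by (simp add: F_def J_wedge)
  qed
  have J_neg: "J n x = 0" if "n < 0" for n x
  proof -
    have "sbp l (sp (n - l) x) = 0" for l
      using that by (cases "l < 0") auto
    then show ?thesis
      by (simp add: J_def)
  qed
  have "J n x = (if n = 0 then x else 0)"
  proof (induction x arbitrary: n rule: fock_induct)
    case (vac m)
    show ?case
    proof (cases "n < 0")
      case False
      \<comment> \<open>The summands are differences of consecutive \<open>G\<close> as long as l is
        at most n. Cutting \<open>G\<close> off there leaves one correction at l = n + 1, which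
        carries the value of the sum.\<close>
      define G where "G l = (if l \<le> n then wedge (bas (m + n - l)) (sbp l (vac (m - 1))) else 0)" for l
      have G: "finite {l. G l \<noteq> 0}"
        by (rule finite_subset[of _ "{0..n}"]) (auto simp: G_def not_le[symmetric] intro: ccontr)
      have "J n (vac m) = Sum_any (\<lambda>l. (G l - G (l + - 1)) +
          (if l = n + 1 then wedge (bas m) (sbp n (vac (m - 1))) else 0))"
        unfolding J_def
      proof (rule Sum_any.cong)
        fix l
        show "sbp l (sp (n - l) (vac m)) = (G l - G (l + - 1)) +
            (if l = n + 1 then wedge (bas m) (sbp n (vac (m - 1))) else 0)"
        proof (cases "l \<le> n")
          case True
          then show ?thesis by (simp add: sp_vac sbp_bas G_def algebra_simps)
        next
          case False
          then show ?thesis by (cases "l = n + 1") (auto simp: G_def)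
        qed
      qed
      also have "\<dots> = Sum_any (\<lambda>l. G l - G (l + - 1)) + wedge (bas m) (sbp n (vac (m - 1)))"
        by (subst Sum_any.distrib)
          (auto intro: finite_subset[OF _ finite_UnI[OF G finite_support_shift[OF G, of "- 1"]]])
      also have "Sum_any (\<lambda>l. G l - G (l + - 1)) = 0"
        by (simp only: Sum_any_diff[OF G finite_support_shift[OF G]] Sum_any_shift) simp
      finally show ?thesis
        by (auto simp: sbp_vac wedge_uminus_right wedge_bas_vac_pred)
    qed (simp add: J_neg)
  next
    case (bas k x)
    show ?case
    \<comment> \<open>The index k must vary, since \<open>J_bas\<close> raises k while lowering
      n.\<close>
    proof (induction "nat (n + 1)" arbitrary: n k)
      case 0
      then show ?case by (simp add: J_neg)
    next
      case (Suc i)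
      then have "J (n - 1) (wedge (bas (k + 1)) x) = (if n - 1 = 0 then wedge (bas (k + 1)) x else 0)"
        by (intro Suc.hyps(1)) simp
      then show ?case
        unfolding J_bas[of n] by (simp add: bas)
    qed
  next
    case (diff x y)
    have "J n (x - y) = J n x - J n y"
      unfolding J_def cf_diff by (rule Sum_any_diff[OF fin fin])
    with diff show ?case by simp
  qed
  then show ?thesis
    by (simp add: J_def)
qed

lemma sum_sbp_sp: "(\<Sum>i=0..n. sbp (int i) (sp (int (n - i)) x)) = (if n = 0 then x else 0)"
proof -
  have "Sum_any (\<lambda>l. sbp l (sp (int n - l) x)) = Sum_any (\<lambda>i::nat. sbp (int i) (sp (int n - int i) x))"
    by (rule Sum_any_nat_int[symmetric]) simp
  also have "\<dots> = (\<Sum>i=0..n. sbp (int i) (sp (int n - int i) x))"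
    by (rule Sum_any.expand_superset) (auto simp: not_le[symmetric] intro: ccontr)
  also have "\<dots> = (\<Sum>i=0..n. sbp (int i) (sp (int (n - i)) x))"
    by (intro sum.cong) (auto simp: of_nat_diff)
  finally show ?thesis
    by (simp add: sbp_sp_inverse)
qed

text \<open>Solving the inverse relation for its top term expresses \<open>sbp\<close> through lower
  ones and \<open>sp\<close>. Commutation with all \<open>sp\<close> thereby passes to all
  \<open>sbp\<close>.\<close>

lemma sbp_rec: "sbp (int n) x = (if n = 0 then x else 0) - (\<Sum>i<n. sbp (int i) (sp (int (n - i)) x))"
proof -
  have "(\<Sum>i=0..n. sbp (int i) (sp (int (n - i)) x)) =
      (\<Sum>i<n. sbp (int i) (sp (int (n - i)) x)) + sbp (int n) x"
    by (simp add: atLeast0AtMost flip: lessThan_Suc_atMost)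
  then show ?thesis
    unfolding sum_sbp_sp by (simp add: eq_diff_eq add.commute)
qed

lemma commute_sbp:
  assumes h: "additive h" and "\<And>k x. h (sp k x) = sp k (h x)"
  shows "h (sbp n x) = sbp n (h x)"
proof -
  have "h (sbp (int n) x) = sbp (int n) (h x)" for n
  proof (induction n arbitrary: x rule: less_induct)
    case (less n)
    show ?case
      unfolding sbp_rec[of n]
      by (simp add: additive.diff[OF h] additive.sum[OF h] additive.zero[OF h] less assms(2))
  qed
  from this[of "nat n"] show ?thesis
    by (cases "n < 0") (auto simp: additive.zero[OF h])
qed

lemma sp_sbp: "sp k (sbp n x) = sbp n (sp k x)"
  by (rule commute_sbp[OF additive_sp sp_sp])

lemma sbp_sbp: "sbp k (sbp n x) = sbp n (sbp k x)"
  by (rule commute_sbp[OF additive_sbp sp_sbp[symmetric]])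

text \<open>The variable with index v is e_(v+1), which occurs in E(z) with the sign (-1)^(v+1); the
  scalar undoes this sign so that E(z) acts as \<open>sigma_bar_p\<close>.\<close>

definition eop :: "nat \<Rightarrow> fock \<Rightarrow> fock" where
  "eop v x = int_scale ((- 1) ^ Suc v) (sbp (int (Suc v)) x)"

lemma additive_eop: "additive (eop v)"
  using additive_comp[OF additive_int_scale additive_sbp] by (simp add: eop_def[abs_def])

lemma eop_eop: "eop v (eop w x) = eop w (eop v x)"
  by (simp add: eop_def additive_int_scale_commute[OF additive_sbp] sbp_sbp[of "int (Suc v)"]
      additive_int_scale_commute[OF additive_int_scale] del: of_nat_Suc power_Suc)

interpretation eop: comp_fun_commute eop
  by standard (simp add: fun_eq_iff eop_eop)

text \<open>Monomials become multisets of variables so that the commuting operators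
  \<open>eop\<close> can be folded in any order.\<close>

definition mono_mset :: "(nat \<Rightarrow>\<^sub>0 nat) \<Rightarrow> nat multiset" where
  "mono_mset f = Abs_multiset (Poly_Mapping.lookup f)"

lemma count_mono_mset [simp]: "count (mono_mset f) v = Poly_Mapping.lookup f v"
  unfolding mono_mset_def by (subst Abs_multiset_inverse) (auto intro: finite_lookup)

lemma mono_mset_add: "mono_mset (f + g) = mono_mset f + mono_mset g"
  by (rule multiset_eqI) (simp add: lookup_add)

lemma mono_mset_0 [simp]: "mono_mset 0 = {#}"
  by (rule multiset_eqI) simp

lemma mono_mset_single [simp]: "mono_mset (Poly_Mapping.single v 1) = {#v#}"
  by (rule multiset_eqI) (simp add: lookup_single when_def)

definition mono_op :: "(nat \<Rightarrow>\<^sub>0 nat) \<Rightarrow> fock \<Rightarrow> fock" where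
  "mono_op f x = fold_mset eop x (mono_mset f)"

lemma additive_mono_op: "additive (mono_op f)"
proof -
  have "additive (\<lambda>x. fold_mset eop x A)" for A
    by (induction A) (simp_all add: additive_def additive.add[OF additive_eop])
  then show ?thesis
    by (simp add: mono_op_def[abs_def])
qed

lemma mono_op_0 [simp]: "mono_op 0 x = x"
  by (simp add: mono_op_def)

lemma mono_op_add: "mono_op (f + g) x = mono_op f (mono_op g x)"
  by (simp add: mono_op_def mono_mset_add add.commute[of "mono_mset f"])

lemma mono_op_single [simp]: "mono_op (Poly_Mapping.single v 1) x = eop v x"
  by (simp add: mono_op_def del: One_nat_def)

definition eact :: "B \<Rightarrow> fock \<Rightarrow> fock" where
  "eact b x = flin (\<lambda>f. mono_op f x) b"

lemma eact_add: "eact (a + b) x = eact a x + eact b x"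
  by (simp add: eact_def additive.add[OF additive_flin])

lemma eact_zero: "eact 0 x = 0"
  by (simp add: eact_def flin_def)

lemma eact_single: "eact (Poly_Mapping.single f c) x = int_scale c (mono_op f x)"
  by (simp add: eact_def)

lemma eact_add_right: "eact a (x + y) = eact a x + eact a y"
  by (simp add: eact_def flin_def additive.add[OF additive_mono_op] additive.add[OF additive_int_scale] sum.distrib)

lemma additive_eact_left: "additive (\<lambda>b. eact b x)"
  by (simp add: additive_def eact_add)

lemma additive_eact: "additive (eact a)"
  by (simp add: additive_def eact_add_right)

lemma int_scale_mult: "int_scale (c * d) x = int_scale c (int_scale d x)"
  by (simp add: int_scale_def wedge_mult)

lemma eact_mult: "eact (a * b) x = eact a (eact b x)"
proof (induction a rule: poly_mapping_int_induct)
  case (single f c)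
  show ?case
  proof (induction b rule: poly_mapping_int_induct)
    case (single g d)
    show ?case
      by (simp add: mult_single eact_single mono_op_add int_scale_mult
          additive_int_scale_commute[OF additive_mono_op])
  qed (auto simp: distrib_left eact_add eact_add_right eact_zero additive.zero[OF additive_eact])
qed (auto simp: distrib_right eact_add eact_zero)

lemma eact_1: "eact 1 x = x"
  by (simp add: eact_single flip: single_one)

lemma module_eact: "module eact"
  by unfold_locales (simp_all add: eact_add eact_add_right eact_1 eact_mult)

lemma E_ser_0: "E_ser $ 0 = 1"
  by (simp add: E_ser_def)

lemma E_ser_Suc: "E_ser $ Suc v = (- 1) ^ Suc v * Poly_Mapping.single (Poly_Mapping.single v 1) 1"
  by (simp add: E_ser_def e_gen_def)

lemma sum_E_h: "(\<Sum>i=0..n. E_ser $ i * h_gen (n - i)) = (if n = 0 then 1 else 0)"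
  using arg_cong[OF E_ser_times_inv, of "\<lambda>f. f $ n"] by (simp add: fps_mult_nth h_gen_def)

lemma eact_E: "eact (E_ser $ n) x = sbp (int n) x"
proof (cases n)
  case (Suc v)
  show ?thesis
    unfolding Suc E_ser_Suc
    by (cases "even v") (simp_all add: additive.minus[OF additive_eact_left] eact_single eop_def int_scale_uminus del: One_nat_def)
qed (simp add: E_ser_0 eact_1)

text \<open>The relation between \<open>E_ser\<close> and \<open>h_gen\<close> and its operator
  counterpart \<open>sum_sbp_sp\<close> give the same recursion, whose leading coefficient is the
  identity.\<close>

lemma eact_h: "eact (h_gen n) x = sp (int n) x"
proof (induction n arbitrary: x rule: less_induct)
  case (less n)
  have sum: "(\<Sum>i=0..n. f i) = f 0 + (\<Sum>i=1..n. f i)" for f :: "nat \<Rightarrow> fock"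
    by (simp add: sum.atLeast_Suc_atMost)
  have "(\<Sum>i=0..n. eact (E_ser $ i) (eact (h_gen (n - i)) x)) = eact (\<Sum>i=0..n. E_ser $ i * h_gen (n - i)) x"
    by (simp add: additive.sum[OF additive_eact_left] eact_mult)
  also have "\<dots> = (\<Sum>i=0..n. sbp (int i) (sp (int (n - i)) x))"
    unfolding sum_E_h sum_sbp_sp by (simp add: eact_1 eact_zero)
  finally have *: "eact (h_gen n) x + (\<Sum>i=1..n. sbp (int i) (eact (h_gen (n - i)) x)) =
      sp (int n) x + (\<Sum>i=1..n. sbp (int i) (sp (int (n - i)) x))"
    unfolding sum by (simp add: eact_E E_ser_0 eact_1)
  have "(\<Sum>i=1..n. sbp (int i) (eact (h_gen (n - i)) x)) = (\<Sum>i=1..n. sbp (int i) (sp (int (n - i)) x))"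
    by (intro sum.cong) (auto simp: less)
  with * show ?case by simp
qed

text \<open>The h_i determine the e_j through E(z) H(z) = 1, and the e_j generate B. Agreement
  passes from \<open>h_gen\<close> on partition vectors to \<open>E_ser\<close>, then to variables,
  monomials and integer multiples.\<close>

lemma module_sigma_p_unique:
  assumes "module act" and h: "\<And>m u i. u \<in> Fock m \<Longrightarrow> act (h_gen i) u = sigma_p u $ i"
  shows "act = eact"
proof -
  interpret module act by fact
  have add: "additive (\<lambda>b. act b x)" "additive (act b)" for b x
    by (simp_all add: additive_def scale_left_distrib scale_right_distrib)
  have act_h: "act (h_gen i) x = sp (int i) x" for i x
  proof (induction x rule: bvac_induct)
    case (bvac m lam)
    have "bvac m lam \<in> Fock m"
      unfolding Fock_def using bvac by (auto intro!: exI[of _ "Poly_Mapping.single lam 1"])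
    then show ?case
      by (simp add: h cf_def)
  qed (simp add: cf_diff additive.diff[OF add(2)])
  have act_E: "act (E_ser $ n) x = sbp (int n) x" for n x
  proof (induction n arbitrary: x rule: less_induct)
    case (less n)
    have sum: "(\<Sum>i=0..n. f i) = f n + (\<Sum>i<n. f i)" for f :: "nat \<Rightarrow> fock"
      by (simp add: atLeast0AtMost add.commute flip: lessThan_Suc_atMost)
    have "(\<Sum>i=0..n. act (E_ser $ i) (act (h_gen (n - i)) x)) = act (\<Sum>i=0..n. E_ser $ i * h_gen (n - i)) x"
      by (simp add: additive.sum[OF add(1)])
    also have "\<dots> = (\<Sum>i=0..n. sbp (int i) (sp (int (n - i)) x))"
      unfolding sum_E_h sum_sbp_sp by simp
    finally have *: "act (E_ser $ n) x + (\<Sum>i<n. act (E_ser $ i) (sp (int (n - i)) x)) =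
        sbp (int n) x + (\<Sum>i<n. sbp (int i) (sp (int (n - i)) x))"
      unfolding sum by (simp add: act_h)
    have "(\<Sum>i<n. act (E_ser $ i) (sp (int (n - i)) x)) = (\<Sum>i<n. sbp (int i) (sp (int (n - i)) x))"
      by (intro sum.cong) (auto simp: less)
    with * show ?case by simp
  qed
  have act_e: "act (Poly_Mapping.single (Poly_Mapping.single v 1) 1) x = eop v x" for v x
  proof -
    have "act (E_ser $ Suc v) x = eact (E_ser $ Suc v) x"
      by (simp only: act_E eact_E)
    then show ?thesis
      unfolding E_ser_Suc
      by (cases "even v") (simp_all add: eact_single additive.minus[OF additive_eact_left] del: One_nat_def)
  qed
  have act_mono: "act (Poly_Mapping.single f 1) x = mono_op f x" for f x
  proof (induction "size (mono_mset f)" arbitrary: f x rule: less_induct)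
    case less
    show ?case
    proof (cases "f = 0")
      case False
      then obtain v where v: "Poly_Mapping.lookup f v \<noteq> 0"
        by (metis lookup_zero poly_mapping_eqI)
      define g where "g = f - Poly_Mapping.single v 1"
      have f: "f = Poly_Mapping.single v 1 + g"
        using v by (intro poly_mapping_eqI) (auto simp: g_def lookup_add lookup_minus lookup_single when_def)
      have "size (mono_mset g) < size (mono_mset f)"
        by (simp add: f mono_mset_add del: One_nat_def)
      then have g: "act (Poly_Mapping.single g 1) x = mono_op g x"
        by (rule less)
      have "Poly_Mapping.single f 1 = Poly_Mapping.single (Poly_Mapping.single v 1) 1 * Poly_Mapping.single g (1::int)"
        by (simp add: f mult_single)
      then have "act (Poly_Mapping.single f 1) x =
          act (Poly_Mapping.single (Poly_Mapping.single v 1) 1) (act (Poly_Mapping.single g 1) x)"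
        by simp
      then show ?thesis
        unfolding act_e g by (simp add: f mono_op_add del: One_nat_def)
    qed simp
  qed
  have act_single: "act (Poly_Mapping.single f c) x = int_scale c (mono_op f x)" for f c x
  proof (induction c rule: int_induct[where k = 0])
    case (step1 i)
    then show ?case
      by (simp add: int_scale_succ single_add scale_left_distrib act_mono)
  next
    case (step2 i)
    then show ?case
      by (simp add: int_scale_succ single_diff scale_left_diff_distrib act_mono)
  qed simp
  show ?thesis
  proof (intro ext)
    fix b x
    show "act b x = eact b x"
      by (induction b rule: poly_mapping_int_induct)
        (simp_all add: eact_zero eact_add scale_left_distrib act_single eact_single)
  qed
qed

lemma B_act_eq: "B_act = eact"
  unfolding B_act_def
proof (rule the_equality)
  show "module eact \<and> (\<forall>m. \<forall>u\<in>Fock m. \<forall>i. eact (h_gen i) u = sigma_p u $ i)"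
    by (simp add: module_eact eact_h cf_def)
qed (use module_sigma_p_unique in blast)

text \<open>E(w)/E(z) acts as sigma_+(z) sigma_+(w)^-1, so the finite double sum only has to be
  regrouped into the iterated sums of \<open>normal_zw\<close>.\<close>

lemma E_ratio_normal: "mult2 B_act E_ratio (\<lambda>p q. sbm (- p) (sm (- q) x)) = (\<lambda>p q. normal_zw p q x)"
proof (intro ext)
  fix p q
  define G where "G i j = sbm (i - p) (sm (j - q) x)" for i j
  \<comment> \<open>For a negative index the scalar is zero, and so is \<open>sp i\<close> or
    \<open>sbp j\<close>.\<close>
  have E: "B_act (E_ratio i j) y = sp i (sbp j y)" for i j y
    by (auto simp: B_act_eq E_ratio_def eact_mult eact_E eact_h sp_sbp simp flip: h_gen_def)
      (simp_all add: eact_zero)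
  let ?S = "{(l, k). sbm l (sm k x) \<noteq> 0}"
  have fin: "finite ?S"
    by (rule finite_sbm_sm)
  have "mult2 B_act E_ratio (\<lambda>p q. sbm (- p) (sm (- q) x)) p q = Sum_any (\<lambda>(i, j). sp i (sbp j (G i j)))"
    unfolding mult2_def by (rule Sum_any.cong) (simp add: E G_def case_prod_unfold)
  also have "\<dots> = Sum_any (\<lambda>i. Sum_any (\<lambda>j. sp i (sbp j (G i j))))"
  \<comment> \<open>Splitting needs a finite rectangle containing all nonzero terms; the projections
    of the support \<open>?S\<close>, moved by p and q, provide it.\<close>
  proof (rule Sum_any.cartesian_product[symmetric])
    have nonzero: "(i - p, j - q) \<in> ?S" if "sp i (sbp j (G i j)) \<noteq> 0" for i j
      using that by (auto simp: G_def)
    show "{i. \<exists>j. sp i (sbp j (G i j)) \<noteq> 0} \<times> {j. \<exists>i. sp i (sbp j (G i j)) \<noteq> 0} \<subseteq>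
        ((\<lambda>(l, k). l + p) ` ?S) \<times> ((\<lambda>(l, k). k + q) ` ?S)"
    proof clarify
      fix i j i' j' assume "sp i (sbp j' (G i j')) \<noteq> 0" "sp i' (sbp j (G i' j)) \<noteq> 0"
      then have "(i - p, j' - q) \<in> ?S" "(i' - p, j - q) \<in> ?S"
        by (auto dest: nonzero)
      then show "i \<in> (\<lambda>(l, k). l + p) ` ?S \<and> j \<in> (\<lambda>(l, k). k + q) ` ?S"
        by (intro conjI) (erule rev_image_eqI, simp)+
    qed
    show "finite (((\<lambda>(l, k). l + p) ` ?S) \<times> ((\<lambda>(l, k). k + q) ` ?S))"
      using fin by simp
  qed
  also have "\<dots> = Sum_any (\<lambda>i. sp i (normal_w (i - p) q x))"
  proof (rule Sum_any.cong)
    fix i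
    define F where "F k = sbp (k + q) (sbm (i - p) (sm k x))" for k
    have F: "finite {k. F k \<noteq> 0}"
      unfolding F_def by (rule finite_support_comp[OF finite_sm]) simp
    have "sp i (normal_w (i - p) q x) = Sum_any (\<lambda>k. sp i (F k))"
      unfolding normal_w_def F_def[symmetric] by (rule additive_Sum_any[OF additive_sp F])
    also have "\<dots> = Sum_any (\<lambda>j. sp i (F (j + - q)))"
      by (rule Sum_any_shift[symmetric])
    finally show "Sum_any (\<lambda>j. sp i (sbp j (G i j))) = sp i (normal_w (i - p) q x)"
      by (simp add: F_def G_def)
  qed
  also have "\<dots> = Sum_any (\<lambda>l. sp (l + p) (normal_w (l + p - p) q x))"
    by (rule Sum_any_shift[symmetric])
  finally show "mult2 B_act E_ratio (\<lambda>p q. sbm (- p) (sm (- q) x)) p q = normal_zw p q x"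
    by (simp add: normal_zw_def)
qed

theorem theorem9p3:
  fixes m :: int and u :: fock
  assumes "u \<in> Fock m"
  shows
    "let zm_wm = mult2 int_scale (monom_zw m (- m));
         S1 = zm_wm (app_z 1 sigma_p (app_z (- 1) sigma_bar_m
                (app_w 1 sigma_bar_p (app_w (- 1) sigma_m (const2 u)))));
         S2 = zm_wm (mult2 int_scale geom_zw
                (app_z 1 sigma_p (app_w 1 sigma_bar_p
                (app_z (- 1) sigma_bar_m (app_w (- 1) sigma_m (const2 u))))));
         S3 = zm_wm (mult2 int_scale geom_zw (mult2 B_act E_ratio
                (app_z (- 1) sigma_bar_m (app_w (- 1) sigma_m (const2 u)))))
     in delta_series u = S1 \<and> S1 = S2 \<and> S2 = S3"
proof -
  \<comment> \<open>The monomial replaces the exponents p and q by p - m and q + m, the indices in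
    \<open>delta_eq_vertex\<close>.\<close>
  have "delta_series u = mult2 int_scale (monom_zw m (- m)) (\<lambda>p q. vertex p (vertex_dual q u))"
    using delta_eq_vertex[OF Fock_deg[OF assms]] by (intro ext) (simp add: mult2_monom delta_series_def)
  then show ?thesis
    unfolding Let_def app_eq_vertex app_eq_normal by (simp add: app_minus_minus geom_normal E_ratio_normal)
qed

end
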